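(* Let $a,b,c\in\mathbb R$ satisfy $a=-1$, $b>-1$, $0\le 2-c+b<1$ and $c\le1$. Then the following hold. (a) Suppose $c=1$. Then: (1) $T_{a,b,c}$ and $S_{a,b,c}$ map $L^p(\mathbb D)$ boundedly into $L^{1,\infty}(\mathbb D)$ if $0\le\frac1p<b+1$, while both are unbounded from $L^{\frac{1}{b+1}}(\mathbb D)$ to $L^{1,\infty}(\mathbb D)$. (2) $T_{a,b,c}$ maps $L^{\frac{1}{b+1},1}(\mathbb D)$ boundedly into $L^{1,\infty}(\mathbb D)$, while $S_{a,b,c}$ does not. (3) $T_{a,b,c}$ and $S_{a,b,c}$ are unbounded from $L^{p,1}(\mathbb D)$ to $L^{1,\infty}(\mathbb D)$ if $b+1<\frac1p\le1$. (b) Suppose $c<1$. Then: (1) $T_{a,b,c}$ and $S_{a,b,c}$ map $L^p(\mathbb D)$ boundedly into $L^{1,\infty}(\mathbb D)$ if $0\le\frac1p<b+1$, while both are unbounded from $L^{\frac{1}{b+1}}(\mathbb D)$ to $L^{1,\infty}(\mathbb D)$. (2) $T_{a,b,c}$ and $S_{a,b,c}$ map $L^{\frac{1}{b+1},1}(\mathbb D)$ boundedly into $L^{1,\infty}(\mathbb D)$, while both are unbounded from $L^{p,1}(\mathbb D)$ to $L^{1,\infty}(\mathbb D)$ if $b+1<\frac1p\le1$.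
   Context: $\mathbb D$ is the open unit disc in $\mathbb C$, $dA$ is normalized area measure on $\mathbb D$, and $|E|$ is the $dA$-measure of $E\subseteq\mathbb D$. For $a,b,c\in\mathbb R$, $$T_{a,b,c}f(z):=(1-|z|^2)^a\int_{\mathbb D}\frac{(1-|w|^2)^b}{(1-z\overline w)^c}f(w)\,dA(w),\qquad S_{a,b,c}f(z):=(1-|z|^2)^a\int_{\mathbb D}\frac{(1-|w|^2)^b}{|1-z\overline w|^c}f(w)\,dA(w),$$ with the principal branch of the power. $L^p(\mathbb D)=L^p(\mathbb D,dA)$, and $\|f\|_{L^{1,\infty}}=\sup_{\lambda>0}\lambda|\{|f|>\lambda\}|$. For $1\le p<\infty$, $\|f\|_{L^{p,1}}=p\int_0^\infty|\{|f|>\lambda\}|^{1/p}\,d\lambda$. An operator $\mathcal T$ maps $X$ boundedly into $Y$ if for every $f\in X$ the defining integral converges absolutely for a.e. $z$ and $\|\mathcal Tf\|_Y\le C\|f\|_X$ with $C$ independent of $f$; otherwise it is unbounded from $X$ to $Y$. *)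

theory Defs
  imports "HOL-Analysis.Analysis" "HOL-Probability.Essential_Supremum"
begin

definition disc_area :: "complex measure" where
  "disc_area = scale_measure (ennreal (1 / pi)) (lebesgue_on (ball 0 1))"

text \<open>A root of an extended nonnegative number; it is only used with \<open>r > 0\<close>, where
  \<open>\<infinity>\<close> to the power \<open>r\<close> is \<open>\<infinity>\<close>.\<close>

definition ennreal_powr :: "ennreal \<Rightarrow> real \<Rightarrow> ennreal" where
  "ennreal_powr x r = (if x = \<infinity> then \<infinity> else ennreal (enn2real x powr r))"

definition Lp_norm :: "ennreal \<Rightarrow> (complex \<Rightarrow> complex) \<Rightarrow> ennreal" where
  "Lp_norm p f =
     (if p = \<infinity> then esssup disc_area (\<lambda>z. ennreal (norm (f z)))
      else ennreal_powr (\<integral>\<^sup>+ z. ennreal (norm (f z) powr enn2real p) \<partial>disc_area) (1 / enn2real p))"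

definition weak_L1_norm :: "(complex \<Rightarrow> complex) \<Rightarrow> ennreal" where
  "weak_L1_norm f =
     (SUP t\<in>{0::real<..}. ennreal t * emeasure disc_area {z \<in> space disc_area. norm (f z) > t})"

definition Lorentz_p1_norm :: "real \<Rightarrow> (complex \<Rightarrow> complex) \<Rightarrow> ennreal" where
  "Lorentz_p1_norm p f =
     ennreal p * (\<integral>\<^sup>+ t\<in>{0::real<..}.
       ennreal (measure disc_area {z \<in> space disc_area. norm (f z) > t} powr (1 / p)) \<partial>lborel)"

text \<open>A function space on the disc is represented by its (quasi-)norm with values in
  \<open>[0,\<infinity>]\<close>; its elements are the measurable functions of finite norm.\<close>

definition space_of_norm :: "((complex \<Rightarrow> complex) \<Rightarrow> ennreal) \<Rightarrow> (complex \<Rightarrow> complex) set" where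
  "space_of_norm N = {f \<in> borel_measurable disc_area. N f < \<infinity>}"

definition T_kernel :: "real \<Rightarrow> real \<Rightarrow> complex \<Rightarrow> complex \<Rightarrow> complex" where
  "T_kernel b c z w =
     of_real ((1 - (norm w)\<^sup>2) powr b) / (1 - z * cnj w) powr of_real c"

definition S_kernel :: "real \<Rightarrow> real \<Rightarrow> complex \<Rightarrow> complex \<Rightarrow> complex" where
  "S_kernel b c z w =
     of_real ((1 - (norm w)\<^sup>2) powr b / norm (1 - z * cnj w) powr c)"

text \<open>The operator \<open>T\<^sub>a\<^sub>,\<^sub>b\<^sub>,\<^sub>c\<close> is \<open>disc_operator a (T_kernel b c)\<close>, and
  \<open>S\<^sub>a\<^sub>,\<^sub>b\<^sub>,\<^sub>c\<close> is \<open>disc_operator a (S_kernel b c)\<close>.\<close>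

definition disc_operator ::
  "real \<Rightarrow> (complex \<Rightarrow> complex \<Rightarrow> complex) \<Rightarrow> (complex \<Rightarrow> complex) \<Rightarrow> complex \<Rightarrow> complex" where
  "disc_operator a k f z =
     of_real ((1 - (norm z)\<^sup>2) powr a) * (\<integral>w. k z w * f w \<partial>disc_area)"

text \<open>The Bochner integral is \<open>0\<close> when it does not converge absolutely, so convergence
  has to be required separately.\<close>

definition maps_boundedly ::
  "real \<Rightarrow> (complex \<Rightarrow> complex \<Rightarrow> complex) \<Rightarrow>
   ((complex \<Rightarrow> complex) \<Rightarrow> ennreal) \<Rightarrow> ((complex \<Rightarrow> complex) \<Rightarrow> ennreal) \<Rightarrow> bool" where
  "maps_boundedly a k NX NY \<longleftrightarrow>
     (\<forall>f\<in>space_of_norm NX. AE z in disc_area. integrable disc_area (\<lambda>w. k z w * f w)) \<and>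
     (\<exists>C::real. \<forall>f\<in>space_of_norm NX.
        disc_operator a k f \<in> space_of_norm NY \<and>
        NY (disc_operator a k f) \<le> ennreal C * NX f)"

abbreviation T_maps_boundedly ::
  "real \<Rightarrow> real \<Rightarrow> real \<Rightarrow>
   ((complex \<Rightarrow> complex) \<Rightarrow> ennreal) \<Rightarrow> ((complex \<Rightarrow> complex) \<Rightarrow> ennreal) \<Rightarrow> bool" where
  "T_maps_boundedly a b c NX NY \<equiv> maps_boundedly a (T_kernel b c) NX NY"

abbreviation S_maps_boundedly ::
  "real \<Rightarrow> real \<Rightarrow> real \<Rightarrow>
   ((complex \<Rightarrow> complex) \<Rightarrow> ennreal) \<Rightarrow> ((complex \<Rightarrow> complex) \<Rightarrow> ennreal) \<Rightarrow> bool" where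
  "S_maps_boundedly a b c NX NY \<equiv> maps_boundedly a (S_kernel b c) NX NY"

end

theory Submission
  imports Defs "HOL-Complex_Analysis.Complex_Analysis" "HOL-Probability.Probability_Measure"
begin

text \<open>Put \<open>\<beta> = b + 1\<close>; the hypotheses give \<open>0 < \<beta> < c \<le> 1\<close>. As \<open>a = -1\<close>, a bound for the circular
  \<open>L\<^sup>q\<close> means of the unweighted transform \<open>F\<close>, uniform in the radius and with some \<open>q > 1\<close>, already puts
  \<open>(1 - |z|\<^sup>2) powr -1 * F z\<close> into weak \<open>L\<^sup>1\<close>, by Chebyshev's inequality on each circle.

  For a positive kernel with bounded circular means in both variables such a bound follows from
  \<open>f \<in> L\<^bsup>1/\<beta>,1\<^esup>\<close>: write \<open>|f|\<close> as an integral of indicators of superlevel sets, split each set of measure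
  \<open>m\<close> at distance \<open>m\<close> from the boundary, and apply Hoelder's inequality to the inner part. With \<open>w'\<close> the conjugate of \<open>w\<close>, this covers
  \<open>|1 - z w'|\<^bsup>-c\<^esup>\<close> for \<open>c < 1\<close>, where the mean is controlled by that of the harmonic function
  \<open>Re (1 - z w')\<^bsup>-c\<^esup>\<close>; for \<open>f \<in> L\<^sup>p\<close> with \<open>1/p < \<beta>\<close> a small power of \<open>1 - |w|\<^sup>2\<close> can be traded to reduce \<open>c = 1\<close>
  to \<open>c < 1\<close>. For \<open>T\<close> with \<open>c = 1\<close> one decomposes \<open>f\<close> into nonnegative parts, whose transforms are
  holomorphic with positive real part, and M. Riesz's inequality reduces to the kernel
  \<open>Re (1 / (1 - z w'))\<close>, which has mean \<open>1\<close>.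

  The function \<open>(1 - |w|\<^sup>2) powr - \<beta> / (1 - ln (1 - |w|\<^sup>2))\<close> lies in \<open>L\<^bsup>1/\<beta>\<^esup>\<close> but makes the integrals diverge,
  and indicators of thin annuli show that \<open>S\<close> fails for \<open>c = 1\<close>.\<close>

unbundle no fps_syntax

subsection \<open>Rotations and radial integration on the disc\<close>

text \<open>The exponent \<open>q\<close> is constrained from two sides. Summing the Chebyshev
  bounds over all circles needs \<open>q > 1\<close>. In the Hoelder step, with
  \<open>1/p + 1/q = 1\<close>, the inner part of a superlevel set of measure \<open>m\<close> leads
  to the integral of \<open>x powr ((\<beta> - 1) * p)\<close> over \<open>x \<ge> m\<close>; it is
  governed by the endpoint \<open>m\<close>, and so scales like the boundary part, when
  \<open>(\<beta> - 1) * p < -1\<close>, that is \<open>q * \<beta> < 1\<close>. Both can be met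
  because \<open>\<beta> < 1\<close>.

  The obstacle at \<open>c = 1\<close> is that the circular means of \<open>1 / |1 - z w'|\<close>
  are bounded below by a logarithm, so an argument that sees only the modulus of the kernel cannot
  reach the endpoint. The real part of the Cauchy kernel keeps a bounded mean, and this is what
  makes the passage through M. Riesz's inequality worthwhile; its condition \<open>q < 2\<close> is
  harmless, since any \<open>q > 1\<close> will do.

  Polar coordinates are avoided: rotation invariance of area lets every integral be averaged over
  circles, and \<open>1 - |w|^2\<close> is uniformly distributed on the unit interval.\<close>

text \<open>The preimage of a box is its image under the inverse \<open>R'\<close>, which is again
  orthogonal and preserves Lebesgue measure; boxes determine \<open>lborel\<close>. The facts on
  orthogonal images concern \<open>real^2\<close>, hence the detour through this space.\<close>

lemma distr_lborel_orthogonal: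
  fixes R :: "real^2 \<Rightarrow> real^2"
  assumes R: "orthogonal_transformation R"
  shows "distr lborel borel R = lborel"
proof (rule sym, rule lborel_eqI)
  have lin: "linear R" using R by (rule orthogonal_transformation_linear)
  have [measurable]: "R \<in> borel_measurable borel"
    by (intro borel_measurable_continuous_onI linear_continuous_on linear_conv_bounded_linear[THEN iffD1] lin)
  obtain R' where R': "orthogonal_transformation R'" "\<And>x. R' (R x) = x" "\<And>x. R (R' x) = x"
    by (metis R inv_f_f orthogonal_transformation_inj orthogonal_transformation_inv orthogonal_transformation_surj surj_f_inv_f)
  fix l u :: "real^2"
  assume "\<And>b. b \<in> Basis \<Longrightarrow> l \<bullet> b \<le> u \<bullet> b"
  have pre: "R -` box l u = R' ` box l u"
  proof (intro set_eqI iffI)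
    fix x assume "x \<in> R -` box l u"
    then show "x \<in> R' ` box l u" using R'(2)[of x] by (metis imageI vimageD)
  next
    fix x assume "x \<in> R' ` box l u"
    then show "x \<in> R -` box l u" using R'(3) by (metis imageE vimageI)
  qed
  have "emeasure (distr lborel borel R) (box l u) = emeasure lborel (R -` box l u)"
    by (subst emeasure_distr) auto
  also have "\<dots> = emeasure lebesgue (R' ` box l u)"
    unfolding pre[symmetric] using measurable_sets_borel[of R borel "box l u"] by simp
  also have "\<dots> = ennreal (measure lebesgue (R' ` box l u))"
    using measurable_orthogonal_image[OF R'(1) lmeasurable_box]
    by (intro emeasure_eq_ennreal_measure fmeasurableD2)
  also have "\<dots> = ennreal (measure lebesgue (box l u))"
    by (simp add: measure_orthogonal_image[OF R'(1)])
  also have "\<dots> = (\<Prod>b\<in>Basis. (u - l) \<bullet> b)"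
    using \<open>\<And>b. b \<in> Basis \<Longrightarrow> l \<bullet> b \<le> u \<bullet> b\<close> by (simp add: emeasure_lborel_box_eq measure_def)
  finally show "emeasure (distr lborel borel R) (box l u) = ennreal (\<Prod>b\<in>Basis. (u - l) \<bullet> b)" .
qed simp

lemma distr_lborel_vec_complex:
  "distr (lborel :: (real^2) measure) borel (\<lambda>v. Complex (v$1) (v$2)) = lborel"
proof (rule sym, rule lborel_eqI)
  have [measurable]: "(\<lambda>v::real^2. Complex (v$1) (v$2)) \<in> borel_measurable borel"
    by (intro borel_measurable_continuous_onI continuous_intros)
  fix l u :: complex
  assume le: "\<And>b. b \<in> Basis \<Longrightarrow> l \<bullet> b \<le> u \<bullet> b"
  have pre: "(\<lambda>v::real^2. Complex (v$1) (v$2)) -` box l u = box (vector [Re l, Im l]) (vector [Re u, Im u])"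
    by (auto simp: box_def Basis_complex_def Basis_vec_def inner_axis forall_2)
  show "emeasure (distr (lborel :: (real^2) measure) borel (\<lambda>v. Complex (v$1) (v$2))) (box l u)
     = ennreal (\<Prod>b\<in>Basis. (u - l) \<bullet> b)"
    using le[of 1] le[of \<i>]
    by (subst emeasure_distr)
      (auto simp: Basis_complex_def pre emeasure_lborel_box_eq Basis_vec_def inner_axis UNIV_2 axis_eq_axis)
qed simp

text \<open>In real coordinates multiplication by \<open>u\<close> is the linear map
  \<open>R\<close>, orthogonal because \<open>(Re u)^2 + (Im u)^2 = 1\<close>; the invariance is
  carried over along the coordinate map.\<close>

lemma distr_lborel_rotation:
  assumes "norm u = (1::real)"
  shows "distr lborel borel (\<lambda>z::complex. u * z) = lborel"
proof -
  let ?c = "\<lambda>v::real^2. Complex (v$1) (v$2)"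
  define R :: "real^2 \<Rightarrow> real^2" where
    "R = (\<lambda>v. vector [Re u * v$1 - Im u * v$2, Re u * v$2 + Im u * v$1])"
  have lin: "linear R"
    by (rule linearI) (auto simp: R_def vec_eq_iff forall_2 algebra_simps)
  have u: "(Re u)^2 + (Im u)^2 = 1"
    using assms by (simp add: cmod_def)
  have "norm (R v) = norm v" for v
  proof -
    have "(norm (R v))^2 = ((Re u)^2 + (Im u)^2) * (norm v)^2"
      by (simp add: norm_vec_def L2_set_def R_def UNIV_2 real_sqrt_pow2 sum_nonneg)
        (simp add: power2_eq_square algebra_simps)
    then show ?thesis using u by simp
  qed
  then have R: "orthogonal_transformation R"
    using lin by (simp add: orthogonal_transformation)
  have [measurable]: "R \<in> borel_measurable borel"
    by (intro borel_measurable_continuous_onI linear_continuous_on linear_conv_bounded_linear[THEN iffD1] lin)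
  have [measurable]: "?c \<in> borel_measurable borel"
    by (intro borel_measurable_continuous_onI continuous_intros)
  have comm: "(\<lambda>z. u * z) \<circ> ?c = ?c \<circ> R"
    by (auto simp: R_def fun_eq_iff complex_eq_iff)
  have "distr lborel borel (\<lambda>z::complex. u * z) = distr (distr lborel borel ?c) borel (\<lambda>z. u * z)"
    by (simp add: distr_lborel_vec_complex)
  also have "\<dots> = distr (distr lborel borel R) borel ?c"
    by (subst (1 2) distr_distr) (auto simp: comm)
  also have "\<dots> = lborel"
    by (simp add: distr_lborel_orthogonal[OF R] distr_lborel_vec_complex)
  finally show ?thesis .
qed

lemma space_disc_area [simp]: "space disc_area = ball 0 1"
  by (simp add: disc_area_def space_scale_measure)

lemma measurable_disc_area_borel: "f \<in> borel_measurable borel \<Longrightarrow> f \<in> borel_measurable disc_area"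
  unfolding disc_area_def measurable_cong_sets[OF sets_scale_measure refl]
  by (intro measurable_restrict_space1 measurable_completion) auto

lemma measurable_ident_disc_area [measurable (raw)]: "(\<lambda>x. x) \<in> measurable disc_area borel"
  by (rule measurable_disc_area_borel) simp

text \<open>\<open>disc_area\<close> carries the Lebesgue sets. Regarding its projections as maps
  into \<open>borel\<close> makes jointly Borel kernels measurable on products with
  \<open>disc_area\<close>.\<close>

lemma measurable_fst_disc_area [measurable]: "fst \<in> measurable (disc_area \<Otimes>\<^sub>M M) borel"
  and measurable_snd_disc_area [measurable]: "snd \<in> measurable (M \<Otimes>\<^sub>M disc_area) borel"
  by (rule measurable_compose[OF _ measurable_ident_disc_area], simp)+

lemma nn_integral_disc_area:
  assumes [measurable]: "f \<in> borel_measurable borel"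
  shows "(\<integral>\<^sup>+w. f w \<partial>disc_area) = ennreal (1 / pi) * (\<integral>\<^sup>+w. f w * indicator (ball 0 1) w \<partial>lborel)"
proof -
  have "f \<in> borel_measurable (lebesgue_on (ball 0 1))"
    by (intro measurable_restrict_space1 measurable_completion) auto
  then have "(\<integral>\<^sup>+w. f w \<partial>disc_area) = ennreal (1 / pi) * (\<integral>\<^sup>+w. f w \<partial>lebesgue_on (ball 0 1))"
    unfolding disc_area_def by (rule nn_integral_scale_measure)
  also have "(\<integral>\<^sup>+w. f w \<partial>lebesgue_on (ball 0 1)) = (\<integral>\<^sup>+w. f w * indicator (ball 0 1) w \<partial>lborel)"
    by (subst nn_integral_restrict_space) (auto simp: nn_integral_completion)
  finally show ?thesis .
qed

lemma borel_in_sets_disc_area: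
  assumes "A \<in> sets borel" "A \<subseteq> ball 0 1"
  shows "A \<in> sets disc_area"
  using assms by (auto simp: disc_area_def sets_restrict_space_iff)

lemma emeasure_disc_area_ball:
  assumes "0 \<le> r" "r \<le> 1"
  shows "emeasure disc_area (ball 0 r) = ennreal (r^2)"
proof -
  have *: "ball 0 1 \<inter> ball 0 r = (ball 0 r :: complex set)" using assms by auto
  have "emeasure disc_area (ball 0 r) = (\<integral>\<^sup>+w. indicator (ball 0 r) w \<partial>disc_area)"
    using assms by (subst nn_integral_indicator) (auto intro!: borel_in_sets_disc_area)
  also have "\<dots> = ennreal (1/pi) * emeasure lborel (ball 0 r :: complex set)"
    by (subst nn_integral_disc_area)
       (auto simp: indicator_inter_arith[symmetric] Int_commute * intro!: borel_measurable_indicator simp flip: nn_integral_indicator)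
  also have "\<dots> = ennreal (r^2)"
    using assms by (simp add: emeasure_ball unit_ball_vol_2 ennreal_mult[symmetric])
  finally show ?thesis .
qed

lemma prob_space_disc_area: "prob_space disc_area"
proof
  show "emeasure disc_area (space disc_area) = 1"
    using emeasure_disc_area_ball[of 1] by simp
qed

interpretation disc: prob_space disc_area by (rule prob_space_disc_area)

lemma nn_integral_disc_area_rotate:
  assumes [measurable]: "f \<in> borel_measurable borel" and "norm u = 1"
  shows "(\<integral>\<^sup>+w. f (u * w) \<partial>disc_area) = (\<integral>\<^sup>+w. f w \<partial>disc_area)"
proof -
  have "indicator (ball 0 1) (u * w) = (indicator (ball 0 1) w :: ennreal)" for w :: complex
    using assms by (simp add: indicator_def norm_mult)
  then have "(\<integral>\<^sup>+w. f (u * w) * indicator (ball 0 1) w \<partial>lborel)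
     = (\<integral>\<^sup>+w. f w * indicator (ball 0 1) w \<partial>distr lborel borel (\<lambda>z. u * z))"
    by (subst nn_integral_distr) (auto intro!: borel_measurable_times_ennreal borel_measurable_indicator)
  then show ?thesis
    using assms by (simp add: nn_integral_disc_area distr_lborel_rotation)
qed

text \<open>Normalised arc length, taken as a Borel probability measure on the whole plane so that
  it can be multiplied with points of the disc and used in Fubini's theorem.\<close>

definition circle :: "complex measure" where
  "circle = distr (restrict_space lborel {0..1}) borel (\<lambda>t::real. cis (2 * pi * t))"

lemma measurable_cis_restrict [measurable]:
  "(\<lambda>t::real. cis (2 * pi * t)) \<in> borel_measurable (restrict_space lborel {0..1})"
proof -
  have "(\<lambda>t::real. cis (2 * pi * t)) \<in> borel_measurable borel"
    by (intro borel_measurable_continuous_onI continuous_intros)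
  then show ?thesis by (intro measurable_restrict_space1) auto
qed

lemma space_circle [simp]: "space circle = UNIV" and sets_circle [simp, measurable_cong]: "sets circle = sets borel"
  by (simp_all add: circle_def)

lemma prob_space_circle: "prob_space circle"
proof -
  have "prob_space (restrict_space lborel {0..1::real})"
    by standard (simp add: emeasure_restrict_space)
  then show ?thesis
    unfolding circle_def by (rule prob_space.prob_space_distr) simp
qed

interpretation circ: prob_space circle by (rule prob_space_circle)

lemma nn_integral_circle:
  assumes [measurable]: "f \<in> borel_measurable borel"
  shows "(\<integral>\<^sup>+u. f u \<partial>circle) = (\<integral>\<^sup>+t\<in>{0..1::real}. f (cis (2 * pi * t)) \<partial>lborel)"
  unfolding circle_def by (subst nn_integral_distr) (auto simp: nn_integral_restrict_space)

lemma AE_circle: "AE u in circle. norm u = 1"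
  unfolding circle_def by (subst AE_distr_iff) auto

text \<open>This replaces polar coordinates: each rotation leaves the area integral unchanged, hence
  so does the average over all rotations, and Fubini moves the circular mean inside.\<close>

lemma nn_integral_disc_area_circle:
  assumes [measurable]: "f \<in> borel_measurable borel"
  shows "(\<integral>\<^sup>+w. f w \<partial>disc_area) = (\<integral>\<^sup>+w. (\<integral>\<^sup>+u. f (w * u) \<partial>circle) \<partial>disc_area)"
proof -
  interpret pair_sigma_finite disc_area circle ..
  have "(\<integral>\<^sup>+w. (\<integral>\<^sup>+u. f (w * u) \<partial>circle) \<partial>disc_area) = (\<integral>\<^sup>+u. (\<integral>\<^sup>+w. f (u * w) \<partial>disc_area) \<partial>circle)"
    by (subst Fubini') (auto simp: mult.commute)
  also have "\<dots> = (\<integral>\<^sup>+u. (\<integral>\<^sup>+w. f w \<partial>disc_area) \<partial>circle)"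
    by (intro nn_integral_cong_AE, use AE_circle in eventually_elim) (simp add: nn_integral_disc_area_rotate)
  finally show ?thesis by (simp add: circ.emeasure_space_1[simplified])
qed

section \<open>The distribution of \<open>1 - |w|^2\<close> and integration of radial
  functions\<close>

abbreviation defect :: "complex \<Rightarrow> real" where
  "defect w \<equiv> 1 - (norm w)\<^sup>2"

lemma defect_pos: "w \<in> ball 0 1 \<Longrightarrow> 0 < defect w"
  by (auto simp: abs_square_less_1)

text \<open>A disc of radius \<open>r\<close> has normalised area \<open>r^2\<close>. This is why
  the squared modulus appears: \<open>1 - |w|^2\<close> is exactly uniform, so radial integrals
  carry no Jacobian.\<close>

lemma distr_defect: "distr disc_area borel defect = uniform_measure lborel {0..1}"
proof (rule measure_eqI_lessThan)
  fix x :: real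
  have [measurable]: "defect \<in> borel_measurable disc_area"
    by (intro measurable_disc_area_borel) measurable
  interpret D: prob_space "distr disc_area borel defect" by (rule disc.prob_space_distr) simp
  show "emeasure (distr disc_area borel defect) {x<..} < \<infinity>"
    by (simp add: D.emeasure_finite less_top[symmetric])
  have "emeasure (distr disc_area borel defect) {x<..} = emeasure disc_area {w \<in> ball 0 1. x < defect w}"
    by (subst emeasure_distr) (auto intro!: arg_cong2[where f=emeasure])
  \<comment> \<open>Clamping \<open>x\<close> to the unit interval treats all real \<open>x\<close>
    at once: the set is the whole disc for negative \<open>x\<close> and empty for
    \<open>x \<ge> 1\<close>.\<close>
  also have "{w \<in> ball 0 1. x < defect w} = ball 0 (sqrt (1 - max 0 (min 1 x)))"
  proof (rule set_eqI)
    fix w :: complex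
    have sq: "norm w < sqrt y \<longleftrightarrow> (norm w)^2 < y" for y
      by (metis norm_ge_zero real_sqrt_less_iff real_sqrt_unique)
    have "norm w < 1 \<longleftrightarrow> (norm w)^2 < 1"
      using sq[of 1] by simp
    then show "w \<in> {w \<in> ball 0 1. x < defect w} \<longleftrightarrow> w \<in> ball 0 (sqrt (1 - max 0 (min 1 x)))"
      unfolding mem_Collect_eq mem_ball dist_0_norm sq
      by (smt (verit) zero_le_power2 min_def max_def)
  qed
  also have "emeasure disc_area \<dots> = ennreal (1 - max 0 (min 1 x))"
    by (subst emeasure_disc_area_ball) auto
  also have "\<dots> = emeasure lborel ({0..1} \<inter> {x<..}) "
  proof -
    have "{0..1} \<inter> {x<..} = (if x < 0 then {0..1} else {x<..1})" by auto
    then show ?thesis by (auto simp: min_def max_def)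
  qed
  finally show "emeasure (distr disc_area borel defect) {x<..} = emeasure (uniform_measure lborel {0..1}) {x<..}"
    by (simp add: divide_ennreal_def)
qed auto

lemma nn_integral_defect:
  assumes [measurable]: "f \<in> borel_measurable borel"
  shows "(\<integral>\<^sup>+w. f (defect w) \<partial>disc_area) = (\<integral>\<^sup>+x\<in>{0<..<1}. f x \<partial>lborel)"
proof -
  have [measurable]: "defect \<in> borel_measurable disc_area"
    by (intro measurable_disc_area_borel) measurable
  have "(\<integral>\<^sup>+w. f (defect w) \<partial>disc_area) = (\<integral>\<^sup>+x. f x \<partial>uniform_measure lborel {0..1})"
    by (subst distr_defect[symmetric], subst nn_integral_distr) auto
  also have "\<dots> = (\<integral>\<^sup>+x\<in>{0..1}. f x \<partial>lborel)"
    by (subst nn_integral_uniform_measure) (auto simp: divide_ennreal_def)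
  also have "\<dots> = (\<integral>\<^sup>+x\<in>{0<..<1}. f x \<partial>lborel)"
  proof (rule nn_integral_cong_AE)
    have "AE x in lborel. x \<noteq> (0::real)" "AE x in lborel. x \<noteq> (1::real)"
      by (rule AE_lborel_singleton)+
    then show "AE x in lborel. f x * indicator {0..1} x = f x * indicator {0<..<1} x"
      by eventually_elim (auto simp: indicator_def)
  qed
  finally show ?thesis .
qed

subsection \<open>Mean values on circles\<close>

text \<open>The velocity of the parametrised circle cancels the \<open>2 * pi * \<i>\<close> of
  Cauchy's formula. The case \<open>a = 0\<close> gives the mean value property, other
  \<open>a\<close> the logarithmic lower bound.\<close>

lemma Cauchy_circle:
  assumes h: "h holomorphic_on cball 0 1" and a: "norm a < 1"
  shows "((\<lambda>t. h (cis (2 * pi * t)) * (cis (2 * pi * t) / (cis (2 * pi * t) - a))) has_integral h a) {0..1}"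
proof -
  have "((\<lambda>u. h u / (u - a)) has_contour_integral (2 * of_real pi * \<i> * h a)) (circlepath 0 1)"
    using assms by (intro Cauchy_integral_circlepath_simple) auto
  then have "((\<lambda>t. h (cis (2 * pi * t)) / (cis (2 * pi * t) - a) * (2 * pi * \<i> * cis (2 * pi * t)))
      has_integral (2 * of_real pi * \<i> * h a)) {0..1}"
    unfolding has_contour_integral vector_derivative_circlepath
    by (simp add: circlepath cis_conv_exp mult_ac)
  from has_integral_mult_right[OF this, of "1 / (2 * of_real pi * \<i>)"]
  show ?thesis by (simp add: field_simps)
qed

text \<open>Since \<open>norm z < 1\<close>, the function taking \<open>u\<close> to
  \<open>h (z * u)\<close> is holomorphic on the closed disc, so \<open>h\<close> needs no boundary
  regularity.\<close>

lemma circle_mean_value: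
  assumes h: "h holomorphic_on ball 0 1" and z: "z \<in> ball 0 1"
  shows "((\<lambda>t. h (z * cis (2 * pi * t))) has_integral h 0) {0..1}"
proof -
  have "norm (z * u) < 1" if "norm u \<le> 1" for u
    using that z mult_left_le[of "norm u" "norm z"] by (simp add: norm_mult)
  then have "(\<lambda>u. h (z * u)) holomorphic_on cball 0 1"
    by (intro holomorphic_on_compose_gen[OF _ h, unfolded o_def] holomorphic_intros) auto
  from Cauchy_circle[OF this, of 0] show ?thesis by simp
qed

lemma continuous_on_circle:
  assumes h: "h holomorphic_on ball 0 1" and z: "z \<in> ball 0 1"
  shows "continuous_on {0..1::real} (\<lambda>t. h (z * cis (2 * pi * t)))"
  using z by (intro continuous_on_compose2[OF holomorphic_on_imp_continuous_on[OF h]] continuous_intros)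
    (auto simp: norm_mult)

lemma nn_integral_circle_eq:
  assumes [measurable]: "\<phi> \<in> borel_measurable borel" and pos: "\<And>w. w \<in> ball 0 1 \<Longrightarrow> 0 \<le> \<phi> w"
    and z: "z \<in> ball 0 1" and I: "((\<lambda>t. \<phi> (z * cis (2 * pi * t))) has_integral I) {0..1}"
  shows "(\<integral>\<^sup>+u. ennreal (\<phi> (z * u)) \<partial>circle) = ennreal I"
proof -
  have "(\<integral>\<^sup>+u. ennreal (\<phi> (z * u)) \<partial>circle)
    = (\<integral>\<^sup>+t. ennreal (indicator {0..1} t * \<phi> (z * cis (2 * pi * t))) \<partial>lborel)"
    by (subst nn_integral_circle) (auto simp: indicator_def intro!: nn_integral_cong)
  also have "\<dots> = ennreal I"
  proof (rule nn_integral_has_integral_lebesgue[OF _ I])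
    show "0 \<le> \<phi> (z * cis (2 * pi * t))" for t
      using z by (intro pos) (simp add: norm_mult)
  qed
  finally show ?thesis .
qed

text \<open>The mean of a harmonic majorant is its value at the centre, whatever the radius; the
  upper bounds for the means of the kernels come from this.\<close>

lemma nn_integral_circle_le_Re:
  assumes h: "h holomorphic_on ball 0 1" and [measurable]: "\<phi> \<in> borel_measurable borel"
    and le: "\<And>w. w \<in> ball 0 1 \<Longrightarrow> 0 \<le> \<phi> w" "\<And>w. w \<in> ball 0 1 \<Longrightarrow> \<phi> w \<le> Re (h w)"
    and z: "z \<in> ball 0 1"
  shows "(\<integral>\<^sup>+u. ennreal (\<phi> (z * u)) \<partial>circle) \<le> ennreal (Re (h 0))"
proof -
  have zu: "z * cis t \<in> ball 0 1" for t using z by (simp add: norm_mult)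
  have "((\<lambda>t. Re (h (z * cis (2 * pi * t)))) has_integral Re (h 0)) {0..1}"
    using has_integral_linear[OF circle_mean_value[OF h z] bounded_linear_Re] by (simp add: o_def)
  then have "(\<integral>\<^sup>+t. ennreal (indicator {0..1} t * Re (h (z * cis (2 * pi * t)))) \<partial>lborel) = ennreal (Re (h 0))"
    using le[OF zu] by (intro nn_integral_has_integral_lebesgue) (auto intro: order_trans)
  moreover have "(\<integral>\<^sup>+u. ennreal (\<phi> (z * u)) \<partial>circle) \<le> (\<integral>\<^sup>+t. ennreal (indicator {0..1} t * Re (h (z * cis (2 * pi * t)))) \<partial>lborel)"
    using z by (subst nn_integral_circle) (auto simp: indicator_def norm_mult intro!: nn_integral_mono ennreal_leI le)
  ultimately show ?thesis by simp
qed

lemma one_minus_mult_cnj_Re_pos: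
  fixes z w :: complex
  assumes "z \<in> ball 0 1" "w \<in> ball 0 1"
  shows "0 < Re (1 - z * cnj w)"
proof -
  have "Re (z * cnj w) \<le> norm (z * cnj w)" by (rule complex_Re_le_cmod)
  also have "\<dots> < 1 * 1" unfolding norm_mult complex_mod_cnj
    using assms by (intro mult_strict_mono') auto
  finally show ?thesis by simp
qed

lemma one_minus_mult_cnj_nonzero:
  fixes z w :: complex
  assumes "z \<in> ball 0 1" "w \<in> ball 0 1"
  shows "1 - z * cnj w \<noteq> 0"
  using one_minus_mult_cnj_Re_pos[OF assms] by (metis less_irrefl zero_complex.simps(1))

lemma Re_inverse_one_minus_mean:
  assumes z: "z \<in> ball 0 1" and w: "w \<in> ball 0 1"
  shows "(\<integral>\<^sup>+u. ennreal (Re (1 / (1 - z * u * cnj w))) \<partial>circle) \<le> 1"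
proof -
  have "(\<lambda>v. 1 / (1 - v * cnj w)) holomorphic_on ball 0 1"
    using one_minus_mult_cnj_nonzero[OF _ w] by (intro holomorphic_intros) auto
  from nn_integral_circle_le_Re[OF this _ _ _ z, of "\<lambda>v. Re (1 / (1 - v * cnj w))"]
  show ?thesis
    using one_minus_mult_cnj_Re_pos[OF _ w] by (simp add: Re_divide less_imp_le)
qed

text \<open>The number \<open>1 - z * cnj w\<close> lies in the right half plane, so its argument is
  below \<open>pi / 2\<close> in modulus and the real part of its power \<open>- k\<close> is at
  least \<open>cos (k * pi / 2)\<close> times the modulus. For \<open>k < 1\<close> this cosine is
  positive; dividing by it gives the harmonic majorant \<open>Re h\<close>.\<close>

lemma norm_one_minus_powr_mean:
  assumes z: "z \<in> ball 0 1" and w: "w \<in> ball 0 1" and k: "0 \<le> k" "k < 1"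
  shows "(\<integral>\<^sup>+u. ennreal (norm (1 - z * u * cnj w) powr - k) \<partial>circle) \<le> ennreal (1 / cos (k * pi / 2))"
proof -
  define h where "h = (\<lambda>v. (1 - v * cnj w) powr - of_real k / of_real (cos (k * pi / 2)))"
  have c: "0 < cos (k * pi / 2)"
  proof (intro cos_gt_zero_pi)
    show "- (pi / 2) < k * pi / 2" using k pi_gt_zero mult_nonneg_nonneg[of k pi] by linarith
    show "k * pi / 2 < pi / 2" using k by simp
  qed
  have "h holomorphic_on ball 0 1"
    unfolding h_def using one_minus_mult_cnj_Re_pos[OF _ w] c
    by (intro holomorphic_intros) (auto simp: complex_nonpos_Reals_iff not_le)
  moreover have "norm (1 - v * cnj w) powr - k \<le> Re (h v)" if v: "v \<in> ball 0 1" for v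
  proof -
    let ?x = "1 - v * cnj w"
    have x: "0 < Re ?x" "?x \<noteq> 0"
      using one_minus_mult_cnj_Re_pos[OF v w] one_minus_mult_cnj_nonzero[OF v w] by auto
    have "\<bar>Im (Ln ?x)\<bar> < pi / 2" using Re_Ln_pos_lt[OF x(2)] x(1) by simp
    then have "cos (k * pi / 2) \<le> cos (k * \<bar>Im (Ln ?x)\<bar>)"
    proof (intro cos_monotone_0_pi_le)
      show "k * \<bar>Im (Ln ?x)\<bar> \<le> k * pi / 2"
        using k mult_left_mono[of "\<bar>Im (Ln ?x)\<bar>" "pi / 2" k] \<open>\<bar>Im (Ln ?x)\<bar> < pi / 2\<close> by simp
      show "k * pi / 2 \<le> pi" using k pi_gt_zero mult_right_mono[of k 1 pi] by linarith
    qed (use k in simp)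
    also have "\<dots> = cos (k * Im (Ln ?x))" by (auto simp: abs_if)
    finally have "norm ?x powr - k * cos (k * pi / 2) \<le> norm ?x powr - k * cos (k * Im (Ln ?x))"
      by (intro mult_left_mono) auto
    also have "\<dots> = Re (?x powr - of_real k)"
      using x(2) by (simp add: powr_def Re_exp)
    finally show ?thesis using c by (simp add: h_def field_simps)
  qed
  ultimately have "(\<integral>\<^sup>+u. ennreal (norm (1 - z * u * cnj w) powr - k) \<partial>circle) \<le> ennreal (Re (h 0))"
    by (intro nn_integral_circle_le_Re[OF _ _ _ _ z, of h "\<lambda>v. norm (1 - v * cnj w) powr - k"]) auto
  also have "Re (h 0) = 1 / cos (k * pi / 2)" by (simp add: h_def)
  finally show ?thesis .
qed

text \<open>Let \<open>L v = - Ln (1 - v)\<close>. On the circle the Cauchy kernel for the point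
  \<open>cnj z\<close> is the conjugate of \<open>1 / (1 - z * u)\<close>, so pairing it with
  \<open>L (z * u)\<close> gives \<open>L (|z|^2)\<close>, the logarithm wanted. As \<open>L\<close>
  itself is unbounded, its conjugate is subtracted, which leaves the integral unchanged, and twice
  the imaginary part of \<open>L\<close> is at most \<open>pi\<close> in modulus.\<close>

lemma log_le_inverse_norm_mean:
  assumes z: "z \<in> ball 0 1"
  shows "ennreal (- ln (1 - (norm z)\<^sup>2) / pi) \<le> (\<integral>\<^sup>+u. ennreal (1 / norm (1 - z * u)) \<partial>circle)"
proof -
  define L where "L = (\<lambda>v. - Ln (1 - v))"
  let ?e = "\<lambda>t::real. cis (2 * pi * t)"
  have ze: "z * ?e t \<in> ball 0 1" for t using z by (simp add: norm_mult)
  have Re: "0 < Re (1 - v)" if "v \<in> ball 0 1" for v :: complex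
    using complex_Re_le_cmod[of v] that by simp
  have holL: "L holomorphic_on ball 0 1"
    unfolding L_def using Re by (intro holomorphic_intros) (auto simp: complex_nonpos_Reals_iff not_le)
  have nz: "1 - v \<noteq> 0" if "v \<in> ball 0 1" for v :: complex using Re[OF that] by (metis less_irrefl zero_complex.simps(1))
  have "norm (z * u) < 1" if "norm u \<le> 1" for u
    using that z mult_left_le[of "norm u" "norm z"] by (simp add: norm_mult)
  then have "(\<lambda>u. L (z * u)) holomorphic_on cball 0 1"
    by (intro holomorphic_on_compose_gen[OF _ holL, unfolded o_def] holomorphic_intros) auto
  then have 1: "((\<lambda>t. L (z * ?e t) * (?e t / (?e t - cnj z))) has_integral L (z * cnj z)) {0..1}"
    using z by (intro Cauchy_circle) auto
  have "(\<lambda>v. L v * (1 / (1 - v))) holomorphic_on ball 0 1"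
    using nz by (intro holomorphic_intros holL) auto
  \<comment> \<open>The value is zero because \<open>L 0 = 0\<close>; this is the term that may be
    subtracted for free.\<close>
  from has_integral_linear[OF circle_mean_value[OF this z] bounded_linear_cnj]
  have 2: "((\<lambda>t. cnj (L (z * ?e t) * (1 / (1 - z * ?e t)))) has_integral 0) {0..1}"
    by (simp only: o_def) (simp add: L_def)
  have eq: "?e t / (?e t - cnj z) = cnj (1 / (1 - z * ?e t))" for t
  proof -
    have "?e t * cnj (?e t) = 1" by (simp add: cis_cnj cis_mult)
    then have "?e t - cnj z = ?e t * cnj (1 - z * ?e t)" by (simp add: algebra_simps)
    then show ?thesis by (simp add: cis_neq_zero)
  qed
  have diff: "((\<lambda>t. (L (z * ?e t) - cnj (L (z * ?e t))) * cnj (1 / (1 - z * ?e t))) has_integral L (z * cnj z)) {0..1}"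
    using has_integral_diff[OF 1 2] unfolding eq by (simp add: algebra_simps)
  have cont: "continuous_on {0..1} (\<lambda>t. 1 / (1 - z * ?e t))"
    using nz by (intro continuous_on_circle[OF _ z] holomorphic_intros) auto
  then have int: "(\<lambda>t. 1 / norm (1 - z * ?e t)) integrable_on {0..1}"
    using continuous_on_norm[OF cont] by (intro integrable_continuous_interval) (simp add: norm_divide)
  define J where "J = integral {0..1} (\<lambda>t. 1 / norm (1 - z * ?e t))"
  have "norm (L (z * cnj z)) \<le> integral {0..1} (\<lambda>t. pi * (1 / norm (1 - z * ?e t)))"
  proof -
    have "norm ((L (z * ?e t) - cnj (L (z * ?e t))) * cnj (1 / (1 - z * ?e t))) \<le> pi * (1 / norm (1 - z * ?e t))" for t
    proof -
      let ?x = "1 - z * ?e t"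
      have "\<bar>Im (Ln ?x)\<bar> < pi / 2" using Re_Ln_pos_lt[OF nz[OF ze]] Re[OF ze] by simp
      moreover have "L (z * ?e t) - cnj (L (z * ?e t)) = of_real (- 2 * Im (Ln ?x)) * \<i>"
        by (simp add: L_def complex_eq_iff)
      ultimately have "norm (L (z * ?e t) - cnj (L (z * ?e t))) \<le> pi"
        by (simp only: norm_mult norm_of_real) simp
      then show ?thesis unfolding norm_mult complex_mod_cnj norm_divide norm_one
        by (intro mult_right_mono) auto
    qed
    from integral_norm_bound_integral[OF has_integral_integrable[OF diff] integrable_on_mult_right[OF int, of pi] this]
    show ?thesis unfolding integral_unique[OF diff] .
  qed
  also have "\<dots> = pi * J" unfolding J_def by (rule integral_mult_right)
  finally have L_le: "norm (L (z * cnj z)) \<le> pi * J" .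
  have "- ln (1 - (norm z)\<^sup>2) \<le> pi * J"
  proof -
    have "1 - z * cnj z = of_real (1 - (norm z)\<^sup>2)" using complex_norm_square[of z] by simp
    moreover have "0 < 1 - (norm z)\<^sup>2" using z by (simp add: abs_square_less_1)
    ultimately have "L (z * cnj z) = of_real (- ln (1 - (norm z)\<^sup>2))"
      by (simp only: L_def Ln_of_real of_real_minus)
    then show ?thesis using L_le by (simp del: of_real_minus)
  qed
  moreover have "(\<integral>\<^sup>+u. ennreal (1 / norm (1 - z * u)) \<partial>circle) = ennreal J"
    unfolding J_def using integrable_integral[OF int]
    by (intro nn_integral_circle_eq[of "\<lambda>v. 1 / norm (1 - v)", OF _ _ z]) auto
  ultimately show ?thesis by (auto intro!: ennreal_leI simp: field_simps)
qed

subsection \<open>Weak-type estimates from circular means\<close>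

lemma nn_integral_powr_from_0:
  assumes "-1 < a" "0 \<le> c"
  shows "(\<integral>\<^sup>+x\<in>{0..c}. ennreal (x powr a) \<partial>lborel) = ennreal (c powr (a + 1) / (a + 1))"
proof -
  have "(\<integral>\<^sup>+x\<in>{0..c}. ennreal (x powr a) \<partial>lborel) = (\<integral>\<^sup>+x. ennreal (indicator {0..c} x * x powr a) \<partial>lborel)"
    by (intro nn_integral_cong) (auto simp: indicator_def)
  also have "\<dots> = ennreal (c powr (a + 1) / (a + 1))"
    using assms by (intro nn_integral_has_integral_lebesgue has_integral_powr_from_0) auto
  finally show ?thesis .
qed

lemma nn_integral_powr_to_inf:
  assumes "e < -1" "0 < (c::real)"
  shows "(\<integral>\<^sup>+x\<in>{c..}. ennreal (x powr e) \<partial>lborel) = ennreal (c powr (e + 1) / (- 1 - e))"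
proof -
  have "(\<integral>\<^sup>+x\<in>{c..}. ennreal (x powr e) \<partial>lborel) = (\<integral>\<^sup>+x. ennreal (indicator {c..} x * x powr e) \<partial>lborel)"
    by (intro nn_integral_cong) (auto simp: indicator_def)
  also have "\<dots> = ennreal (- (c powr (e + 1)) / (e + 1))"
    using assms by (intro nn_integral_has_integral_lebesgue has_integral_powr_to_inf) auto
  also have "- (c powr (e + 1)) / (e + 1) = c powr (e + 1) / (- 1 - e)"
    using assms by (simp add: field_simps)
  finally show ?thesis .
qed

text \<open>Young's inequality is applied to \<open>u\<close> and \<open>v\<close> divided by
  \<open>A powr (1 / p)\<close> and \<open>B powr (1 / q)\<close>, so vanishing bounds are treated
  separately. Finite upper bounds replace the norms, which is the form in which the factors are
  known later.\<close>

lemma nn_integral_Holder: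
  fixes u v :: "'a \<Rightarrow> real"
  assumes [measurable]: "u \<in> borel_measurable M" "v \<in> borel_measurable M"
    and uv: "\<And>x. 0 \<le> u x" "\<And>x. 0 \<le> v x" and pq: "1 < p" "1 < q" "1 / p + 1 / q = 1"
    and AB: "0 \<le> A" "0 \<le> B"
    and A: "(\<integral>\<^sup>+x. ennreal (u x powr p) \<partial>M) \<le> ennreal A"
    and B: "(\<integral>\<^sup>+x. ennreal (v x powr q) \<partial>M) \<le> ennreal B"
  shows "(\<integral>\<^sup>+x. ennreal (u x * v x) \<partial>M) \<le> ennreal (A powr (1 / p) * B powr (1 / q))"
proof (cases "A = 0 \<or> B = 0")
  case True
  have "AE x in M. u x * v x = 0"
    using True
  proof
    assume "A = 0"
    then have "AE x in M. u x powr p = 0"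
      using A by (simp add: nn_integral_0_iff_AE)
    then show ?thesis by eventually_elim simp
  next
    assume "B = 0"
    then have "AE x in M. v x powr q = 0"
      using B by (simp add: nn_integral_0_iff_AE)
    then show ?thesis by eventually_elim simp
  qed
  then have "(\<integral>\<^sup>+x. ennreal (u x * v x) \<partial>M) = (\<integral>\<^sup>+x. 0 \<partial>M)"
    by (intro nn_integral_cong_AE) (auto elim: eventually_mono)
  then show ?thesis by simp
next
  case False
  with AB have pos: "0 < A" "0 < B" by auto
  define c where "c = A powr (1 / p) * B powr (1 / q)"
  have c: "0 < c" using pos by (simp add: c_def)
  have young: "u x * v x \<le> c * (u x powr p / (A * p) + v x powr q / (B * q))" for x
  proof -
    have "(u x / A powr (1 / p)) * (v x / B powr (1 / q))
       \<le> (u x / A powr (1 / p)) powr p / p + (v x / B powr (1 / q)) powr q / q"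
      using uv[of x] pq pos by (intro Youngs_inequality) auto
    also have "\<dots> = u x powr p / (A * p) + v x powr q / (B * q)"
      using uv[of x] pq pos by (simp add: powr_divide powr_powr)
    finally have "c * ((u x / A powr (1 / p)) * (v x / B powr (1 / q))) \<le> c * (u x powr p / (A * p) + v x powr q / (B * q))"
      using c by (intro mult_left_mono) auto
    moreover have "c * ((u x / A powr (1 / p)) * (v x / B powr (1 / q))) = u x * v x"
      using pos by (simp add: c_def)
    ultimately show ?thesis by simp
  qed
  have "(\<integral>\<^sup>+x. ennreal (u x * v x) \<partial>M)
     \<le> (\<integral>\<^sup>+x. ennreal (c / (A * p)) * ennreal (u x powr p) + ennreal (c / (B * q)) * ennreal (v x powr q) \<partial>M)"
    using c pos pq young
    by (intro nn_integral_mono)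
      (simp add: ennreal_mult[symmetric] ennreal_plus[symmetric] distrib_left del: ennreal_plus)
  also have "\<dots> = ennreal (c / (A * p)) * (\<integral>\<^sup>+x. ennreal (u x powr p) \<partial>M) + ennreal (c / (B * q)) * (\<integral>\<^sup>+x. ennreal (v x powr q) \<partial>M)"
    by (simp add: nn_integral_add nn_integral_cmult)
  also have "\<dots> \<le> ennreal (c / (A * p)) * ennreal A + ennreal (c / (B * q)) * ennreal B"
    by (intro add_mono mult_left_mono A B) auto
  also have "\<dots> = ennreal (c * (1 / p + 1 / q))"
    unfolding distrib_left using c pos pq by (simp add: ennreal_mult[symmetric] ennreal_plus[symmetric] del: ennreal_plus)
  finally show ?thesis using pq by (simp add: c_def)
qed

text \<open>Chebyshev's inequality on each circle bounds the part of the level set at distance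
  \<open>x\<close> from the boundary by \<open>min 1 ((M / (\<lambda> x)) powr q)\<close>, which is integrable in \<open>x\<close> as \<open>q > 1\<close>.\<close>

lemma weak_type_of_circle_means:
  assumes [measurable]: "X \<in> borel_measurable borel" "H \<in> borel_measurable borel"
    and q: "1 < q" and M: "0 < M" and l: "0 < l"
    and X: "\<And>z. z \<in> ball 0 1 \<Longrightarrow> (\<integral>\<^sup>+u. X (z * u) \<partial>circle) \<le> ennreal (M powr q)"
    and H: "\<And>z. z \<in> ball 0 1 \<Longrightarrow> ennreal (H z powr q) \<le> X z"
  shows "emeasure disc_area {z \<in> ball 0 1. H z > l * defect z} \<le> ennreal (M / l * (1 + 1 / (q - 1)))"
proof -
  define S where "S = {z. ennreal ((l * defect z) powr q) \<le> X z}"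
  have [measurable]: "S \<in> sets borel" unfolding S_def by measurable
  define \<phi> where "\<phi> x = (min 1 (ennreal ((M / (l * x)) powr q)))" for x :: real
  have [measurable]: "\<phi> \<in> borel_measurable borel" unfolding \<phi>_def by measurable
  have "{z \<in> ball 0 1. H z > l * defect z} \<in> sets disc_area"
    by (intro borel_in_sets_disc_area) auto
  then have "emeasure disc_area {z \<in> ball 0 1. H z > l * defect z}
      = (\<integral>\<^sup>+z. indicator {z \<in> ball 0 1. H z > l * defect z} z \<partial>disc_area)" by simp
  also have "\<dots> \<le> (\<integral>\<^sup>+z. indicator S z \<partial>disc_area)"
  proof (intro nn_integral_mono)
    fix z assume z: "z \<in> space disc_area"
    show "indicator {z \<in> ball 0 1. H z > l * defect z} z \<le> (indicator S z :: ennreal)"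
    proof (cases "H z > l * defect z")
      case True
      with z q l defect_pos[of z] have "ennreal ((l * defect z) powr q) \<le> ennreal (H z powr q)"
        by (intro ennreal_leI powr_mono2) auto
      also have "\<dots> \<le> X z" using z by (intro H) simp
      finally show ?thesis by (auto simp: S_def indicator_def)
    qed simp
  qed
  also have "\<dots> = (\<integral>\<^sup>+z. (\<integral>\<^sup>+u. indicator S (z * u) \<partial>circle) \<partial>disc_area)"
    by (rule nn_integral_disc_area_circle) measurable
  also have "\<dots> \<le> (\<integral>\<^sup>+z. \<phi> (defect z) \<partial>disc_area)"
  proof (rule nn_integral_mono)
    fix z assume "z \<in> space disc_area"
    then have z: "z \<in> ball 0 1" by simp
    have d: "0 < l * defect z" using defect_pos[OF z] l by simp
    have "(\<integral>\<^sup>+u. indicator S (z * u) \<partial>circle) \<le> (\<integral>\<^sup>+u. 1 \<partial>circle)"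
      by (intro nn_integral_mono) (auto simp: indicator_def)
    moreover have "(\<integral>\<^sup>+u. indicator S (z * u) \<partial>circle) \<le> ennreal ((M / (l * defect z)) powr q)"
    proof -
      have "(\<integral>\<^sup>+u. indicator S (z * u) \<partial>circle) \<le> (\<integral>\<^sup>+u. ennreal ((l * defect z) powr - q) * X (z * u) \<partial>circle)"
      proof (intro nn_integral_mono_AE, use AE_circle in eventually_elim)
        fix u :: complex assume "norm u = 1"
        then have eq: "defect (z * u) = defect z" by (simp add: norm_mult)
        show "indicator S (z * u) \<le> ennreal ((l * defect z) powr - q) * X (z * u)"
        proof (cases "z * u \<in> S")
          case True
          then have "ennreal ((l * defect z) powr - q) * ennreal ((l * defect z) powr q)
              \<le> ennreal ((l * defect z) powr - q) * X (z * u)"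
            unfolding S_def eq mem_Collect_eq by (intro mult_left_mono) auto
          moreover have "ennreal ((l * defect z) powr - q) * ennreal ((l * defect z) powr q) = 1"
            unfolding ennreal_mult[OF powr_ge_zero powr_ge_zero, symmetric] powr_add[symmetric] using less_imp_neq[OF d] by simp
          ultimately show ?thesis using True by simp
        qed simp
      qed
      also have "\<dots> = ennreal ((l * defect z) powr - q) * (\<integral>\<^sup>+u. X (z * u) \<partial>circle)"
        by (rule nn_integral_cmult) measurable
      also have "\<dots> \<le> ennreal ((l * defect z) powr - q) * ennreal (M powr q)"
        by (intro mult_left_mono X z) auto
      also have "\<dots> = ennreal ((M / (l * defect z)) powr q)"
        using d M by (simp add: ennreal_mult[symmetric] powr_divide powr_minus field_simps)
      finally show ?thesis .
    qed
    ultimately show "(\<integral>\<^sup>+u. indicator S (z * u) \<partial>circle) \<le> \<phi> (defect z)"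
      by (simp add: \<phi>_def circ.emeasure_space_1[simplified])
  qed
  also have "\<dots> = (\<integral>\<^sup>+x\<in>{0<..<1}. \<phi> x \<partial>lborel)"
    by (rule nn_integral_defect) measurable
  \<comment> \<open>The trivial bound \<open>1\<close> and the Chebyshev bound cross at
    \<open>x = M / l\<close>, so the integral is split there.\<close>
  also have "\<dots> \<le> (\<integral>\<^sup>+x. indicator {0..M / l} x + ennreal ((M / l) powr q) * (ennreal (x powr - q) * indicator {M / l..} x) \<partial>lborel)"
  proof (intro nn_integral_mono)
    fix x :: real
    consider "x \<le> 0" | "0 < x" "x \<le> M / l" | "0 < x" "M / l \<le> x" by linarith
    then show "\<phi> x * indicator {0<..<1} x \<le> indicator {0..M / l} x + ennreal ((M / l) powr q) * (ennreal (x powr - q) * indicator {M / l..} x)"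
    proof cases
      case 2
      then have "\<phi> x * indicator {0<..<1} x \<le> 1" by (auto simp: \<phi>_def indicator_def)
      with 2 show ?thesis by (auto intro: add_increasing2)
    next
      case 3
      then have "\<phi> x * indicator {0<..<1} x \<le> ennreal ((M / (l * x)) powr q)"
        by (auto simp: \<phi>_def indicator_def)
      also have "(M / (l * x)) powr q = (M / l) powr q * x powr - q"
        using 3 M l by (simp add: powr_divide powr_mult powr_minus field_simps)
      finally show ?thesis using 3 by (auto simp: ennreal_mult intro: add_increasing)
    qed auto
  qed
  also have "\<dots> = ennreal (M / l) + ennreal ((M / l) powr q) * ennreal ((M / l) powr (- q + 1) / (- 1 - - q))"
    using M l q by (subst nn_integral_add) (auto simp: nn_integral_cmult nn_integral_powr_to_inf)
  also have "\<dots> = ennreal (M / l * (1 + 1 / (q - 1)))"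
  proof -
    have "(M / l) powr q * (M / l) powr (- q + 1) = M / l"
      using M l by (simp add: powr_add[symmetric])
    then have "(M / l) powr q * ((M / l) powr (- q + 1) / (- 1 - - q)) = M / l / (q - 1)"
      by (simp add: field_simps)
    then show ?thesis
      using M l q by (simp add: ennreal_mult[symmetric] ennreal_plus[symmetric] distrib_left del: ennreal_plus)
  qed
  finally show ?thesis .
qed

subsection \<open>A weighted integral operator with a rotation-bounded kernel\<close>

definition distribution :: "(complex \<Rightarrow> real) \<Rightarrow> real \<Rightarrow> real" where
  "distribution g t = measure disc_area {w \<in> ball 0 1. t < g w}"

text \<open>For \<open>\<beta> = 1 / p\<close> this is the Lorentz norm without its leading factor
  \<open>p\<close>.\<close>

definition lorentz_integral :: "real \<Rightarrow> (complex \<Rightarrow> real) \<Rightarrow> ennreal" where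
  "lorentz_integral \<beta> g = (\<integral>\<^sup>+t\<in>{0<..}. ennreal (distribution g t powr \<beta>) \<partial>lborel)"

text \<open>The exponent \<open>\<beta> - 1\<close> is the \<open>b\<close> of the operators. Values
  in \<open>ennreal\<close> make the integral usable before its convergence is known.\<close>

definition weighted_integral :: "real \<Rightarrow> (complex \<Rightarrow> complex \<Rightarrow> ennreal) \<Rightarrow> (complex \<Rightarrow> real) \<Rightarrow> complex \<Rightarrow> ennreal" where
  "weighted_integral \<beta> K g z = (\<integral>\<^sup>+w. ennreal (defect w powr (\<beta> - 1) * g w) * K z w \<partial>disc_area)"

lemma superlevel_in_sets [measurable]:
  "g \<in> borel_measurable disc_area \<Longrightarrow> {w \<in> ball 0 1. t < g w} \<in> sets disc_area" for g :: "complex \<Rightarrow> real"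
  using borel_measurable_less[of "\<lambda>_. t" disc_area g] by simp

lemma distribution_nonneg: "0 \<le> distribution g t"
  by (simp add: distribution_def)

lemma emeasure_superlevel:
  "emeasure disc_area {w \<in> ball 0 1. t < g w} = ennreal (distribution g t)"
  by (simp add: distribution_def disc.emeasure_eq_measure)

lemma measurable_distribution [measurable]:
  assumes [measurable]: "g \<in> borel_measurable disc_area"
  shows "distribution g \<in> borel_measurable borel"
proof -
  have "mono (\<lambda>t. - distribution g t)"
    unfolding distribution_def
    by (intro monoI le_imp_neg_le disc.finite_measure_mono superlevel_in_sets assms) auto
  from borel_measurable_mono[OF this] have "(\<lambda>t. - (- distribution g t)) \<in> borel_measurable borel"
    by (rule borel_measurable_uminus)
  then show ?thesis by simp
qed

lemma distribution_mono:
  assumes "g \<in> borel_measurable disc_area" "\<And>w. w \<in> ball 0 1 \<Longrightarrow> f w \<le> g w"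
  shows "distribution f t \<le> distribution g t"
  unfolding distribution_def using assms
  by (intro disc.finite_measure_mono superlevel_in_sets) force+

lemma lorentz_integral_mono:
  assumes "g \<in> borel_measurable disc_area" "\<And>w. w \<in> ball 0 1 \<Longrightarrow> f w \<le> g w" "0 \<le> \<beta>"
  shows "lorentz_integral \<beta> f \<le> lorentz_integral \<beta> g"
  unfolding lorentz_integral_def using distribution_mono[OF assms(1,2)] assms(3)
  by (intro nn_integral_mono mult_right_mono ennreal_leI powr_mono2 distribution_nonneg) auto

text \<open>The two mean bounds have different tasks: \<open>mean_right\<close> controls the
  integral of a radial weight against the kernel at a fixed \<open>z\<close>,
  \<open>mean_left\<close> the circular mean of the resulting function of \<open>z\<close>. The
  instances are a power of \<open>|1 - z * cnj w|\<close>, the real part of the Cauchy kernel, and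
  the constant \<open>1\<close>.\<close>

locale circle_kernel =
  fixes K :: "complex \<Rightarrow> complex \<Rightarrow> ennreal" and \<kappa> :: real
  assumes measurable_kernel: "case_prod K \<in> borel_measurable (borel \<Otimes>\<^sub>M borel)"
    and kappa_pos: "0 < \<kappa>"
    and mean_left: "\<And>z w. z \<in> ball 0 1 \<Longrightarrow> w \<in> ball 0 1 \<Longrightarrow> (\<integral>\<^sup>+u. K (z * u) w \<partial>circle) \<le> ennreal \<kappa>"
    and mean_right: "\<And>z w. z \<in> ball 0 1 \<Longrightarrow> w \<in> ball 0 1 \<Longrightarrow> (\<integral>\<^sup>+u. K z (w * u) \<partial>circle) \<le> ennreal \<kappa>"
begin

lemma measurable_kernel' [measurable (raw)]:
  assumes "f \<in> borel_measurable M" "h \<in> borel_measurable M"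
  shows "(\<lambda>x. K (f x) (h x)) \<in> borel_measurable M"
  using measurable_compose[OF measurable_Pair[OF assms] measurable_kernel] by simp

text \<open>Averaging over rotations of \<open>w\<close> does not touch the radial factor and
  replaces the kernel by \<open>\<kappa>\<close>; what remains is an integral over the unit
  interval.\<close>

lemma integral_radial_kernel:
  assumes [measurable]: "\<phi> \<in> borel_measurable borel" and z: "z \<in> ball 0 1"
  shows "(\<integral>\<^sup>+w. \<phi> (defect w) * K z w \<partial>disc_area) \<le> (\<integral>\<^sup>+x\<in>{0<..<1}. \<phi> x \<partial>lborel) * ennreal \<kappa>"
proof -
  have "(\<integral>\<^sup>+w. \<phi> (defect w) * K z w \<partial>disc_area)
     = (\<integral>\<^sup>+w. (\<integral>\<^sup>+u. \<phi> (defect (w * u)) * K z (w * u) \<partial>circle) \<partial>disc_area)"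
    by (rule nn_integral_disc_area_circle) measurable
  also have "\<dots> \<le> (\<integral>\<^sup>+w. \<phi> (defect w) * ennreal \<kappa> \<partial>disc_area)"
  proof (rule nn_integral_mono)
    fix w assume w: "w \<in> space disc_area"
    have "(\<integral>\<^sup>+u. \<phi> (defect (w * u)) * K z (w * u) \<partial>circle) = (\<integral>\<^sup>+u. \<phi> (defect w) * K z (w * u) \<partial>circle)"
      by (intro nn_integral_cong_AE, use AE_circle in eventually_elim) (simp add: norm_mult)
    also have "\<dots> = \<phi> (defect w) * (\<integral>\<^sup>+u. K z (w * u) \<partial>circle)"
      by (rule nn_integral_cmult) measurable
    also have "\<dots> \<le> \<phi> (defect w) * ennreal \<kappa>"
      using w by (intro mult_left_mono mean_right z) auto
    finally show "(\<integral>\<^sup>+u. \<phi> (defect (w * u)) * K z (w * u) \<partial>circle) \<le> \<phi> (defect w) * ennreal \<kappa>" .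
  qed
  also have "\<dots> = (\<integral>\<^sup>+w. \<phi> (defect w) \<partial>disc_area) * ennreal \<kappa>"
    by (rule nn_integral_multc) (intro measurable_disc_area_borel, measurable)
  also have "(\<integral>\<^sup>+w. \<phi> (defect w) \<partial>disc_area) = (\<integral>\<^sup>+x\<in>{0<..<1}. \<phi> x \<partial>lborel)"
    by (rule nn_integral_defect) measurable
  finally show ?thesis .
qed

text \<open>For \<open>m \<le> 1\<close> the region is an annulus of area \<open>m\<close>, so it is
  comparable with a superlevel set of that measure, and its cost \<open>m powr \<beta>\<close> is
  the integrand of \<open>lorentz_integral\<close>.\<close>

lemma integral_kernel_near_boundary:
  assumes "0 < \<beta>" "0 \<le> m" "z \<in> ball 0 1"
  shows "(\<integral>\<^sup>+w. (if defect w < m then ennreal (defect w powr (\<beta> - 1)) * K z w else 0) \<partial>disc_area)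
    \<le> ennreal (m powr \<beta> / \<beta> * \<kappa>)"
proof -
  have "(\<integral>\<^sup>+w. (if defect w < m then ennreal (defect w powr (\<beta> - 1)) * K z w else 0) \<partial>disc_area)
     = (\<integral>\<^sup>+w. (if defect w < m then ennreal (defect w powr (\<beta> - 1)) else 0) * K z w \<partial>disc_area)"
    by (intro nn_integral_cong) auto
  also have "\<dots> \<le> (\<integral>\<^sup>+x\<in>{0<..<1}. (if x < m then ennreal (x powr (\<beta> - 1)) else 0) \<partial>lborel) * ennreal \<kappa>"
    by (rule integral_radial_kernel[OF _ assms(3)]) measurable
  also have "\<dots> \<le> ennreal (m powr \<beta> / \<beta>) * ennreal \<kappa>"
  proof (rule mult_right_mono)
    have "(\<integral>\<^sup>+x\<in>{0<..<1}. (if x < m then ennreal (x powr (\<beta> - 1)) else 0) \<partial>lborel)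
        \<le> (\<integral>\<^sup>+x\<in>{0..m}. ennreal (x powr (\<beta> - 1)) \<partial>lborel)"
      by (intro nn_integral_mono) (auto simp: indicator_def)
    also have "\<dots> = ennreal (m powr \<beta> / \<beta>)"
      using assms by (subst nn_integral_powr_from_0) auto
    finally show "(\<integral>\<^sup>+x\<in>{0<..<1}. (if x < m then ennreal (x powr (\<beta> - 1)) else 0) \<partial>lborel) \<le> ennreal (m powr \<beta> / \<beta>)" .
  qed simp
  also have "\<dots> = ennreal (m powr \<beta> / \<beta> * \<kappa>)"
    using assms kappa_pos by (intro ennreal_mult[symmetric]) auto
  finally show ?thesis .
qed

text \<open>Used with \<open>e = (\<beta> - 1) * p\<close>; the condition \<open>e < -1\<close> lets
  the lower limit \<open>m\<close> dominate the radial integral.\<close>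

lemma integral_kernel_off_boundary:
  assumes "e < -1" "0 < m" "z \<in> ball 0 1"
  shows "(\<integral>\<^sup>+w. (if m \<le> defect w then ennreal (defect w powr e) * K z w else 0) \<partial>disc_area)
    \<le> ennreal (m powr (e + 1) / (- 1 - e) * \<kappa>)"
proof -
  have "(\<integral>\<^sup>+w. (if m \<le> defect w then ennreal (defect w powr e) * K z w else 0) \<partial>disc_area)
     = (\<integral>\<^sup>+w. (if m \<le> defect w then ennreal (defect w powr e) else 0) * K z w \<partial>disc_area)"
    by (intro nn_integral_cong) auto
  also have "\<dots> \<le> (\<integral>\<^sup>+x\<in>{0<..<1}. (if m \<le> x then ennreal (x powr e) else 0) \<partial>lborel) * ennreal \<kappa>"
    by (rule integral_radial_kernel[OF _ assms(3)]) measurable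
  also have "\<dots> \<le> ennreal (m powr (e + 1) / (- 1 - e)) * ennreal \<kappa>"
  proof (rule mult_right_mono)
    have "(\<integral>\<^sup>+x\<in>{0<..<1}. (if m \<le> x then ennreal (x powr e) else 0) \<partial>lborel)
        \<le> (\<integral>\<^sup>+x\<in>{m..}. ennreal (x powr e) \<partial>lborel)"
      by (intro nn_integral_mono) (auto simp: indicator_def)
    also have "\<dots> = ennreal (m powr (e + 1) / (- 1 - e))"
      using assms by (subst nn_integral_powr_to_inf) auto
    finally show "(\<integral>\<^sup>+x\<in>{0<..<1}. (if m \<le> x then ennreal (x powr e) else 0) \<partial>lborel) \<le> ennreal (m powr (e + 1) / (- 1 - e))" .
  qed simp
  also have "\<dots> = ennreal (m powr (e + 1) / (- 1 - e) * \<kappa>)"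
    using assms kappa_pos by (intro ennreal_mult[symmetric]) auto
  finally show ?thesis .
qed

end

text \<open>The auxiliary \<open>X\<close> is an integral over all levels \<open>t\<close>, so only
  its circular mean, and not its value, is controlled by \<open>n\<close>; the pointwise estimate is
  therefore left in terms of \<open>X z\<close>. The constant \<open>A0\<close> is
  \<open>-1 - (\<beta> - 1) * p\<close> and is positive exactly when \<open>q * \<beta> < 1\<close>.
  The last conclusion speaks of reals \<open>r\<close> below the weighted integral because that
  integral may be infinite.\<close>

lemma (in circle_kernel) weighted_integral_majorant:
  assumes g [measurable]: "g \<in> borel_measurable disc_area" and g0: "\<And>w. 0 \<le> g w"
    and \<beta>: "0 < \<beta>" "\<beta> < 1" and q: "1 < q" "q * \<beta> < 1"
    and n: "0 < n" "lorentz_integral \<beta> g \<le> ennreal n"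
    and A0: "A0 = (1 - \<beta>) * q / (q - 1) - 1"
    and C: "C = 2 powr q * ((\<kappa> / \<beta>) powr q + (\<kappa> / A0) powr (q - 1) * \<kappa>)"
  obtains Y where "Y \<in> borel_measurable borel"
    "\<And>z. z \<in> ball 0 1 \<Longrightarrow> (\<integral>\<^sup>+u. Y (z * u) \<partial>circle) \<le> ennreal (C * n powr q)"
    "\<And>z r. z \<in> ball 0 1 \<Longrightarrow> 0 \<le> r \<Longrightarrow> ennreal r \<le> weighted_integral \<beta> K g z \<Longrightarrow> ennreal (r powr q) \<le> Y z"
proof -
  interpret P: pair_sigma_finite "lborel :: real measure" disc_area ..
  let ?P = "(lborel :: real measure) \<Otimes>\<^sub>M disc_area"
  define b where "b = \<beta> - 1"
  define p where "p = q / (q - 1)"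
  define m where "m = distribution g"
  have pq: "1 < p" "1 / p + 1 / q = 1" "p / q = p - 1" "q / p = q - 1"
    using q by (auto simp: p_def field_simps)
  have [measurable]: "m \<in> borel_measurable borel" unfolding m_def by measurable
  have m0: "0 \<le> m t" for t by (simp add: m_def distribution_nonneg)
  have N: "(\<integral>\<^sup>+t\<in>{0<..}. ennreal (m t powr \<beta>) \<partial>lborel) \<le> ennreal n"
    using n(2) by (simp add: lorentz_integral_def m_def)
  have bp: "b * p < -1" and A0p: "0 < A0" "A0 = - 1 - b * p"
    using q \<beta> by (auto simp: A0 b_def p_def field_simps)
  \<comment> \<open>The weight \<open>m t powr b\<close> gives the superlevel set at height
    \<open>t\<close> the total mass \<open>m t powr \<beta>\<close>.\<close>
  define G where "G = (\<lambda>(t, w). if 0 < t \<and> t < g w then ennreal (m t powr b) else 0)"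
  have [measurable]: "G \<in> borel_measurable ?P" unfolding G_def by measurable
  define X where "X z = (\<integral>\<^sup>+x. G x * K z (snd x) \<partial>?P)" for z
  have [measurable]: "X \<in> borel_measurable borel" unfolding X_def by measurable
  have X_mean: "(\<integral>\<^sup>+u. X (z * u) \<partial>circle) \<le> ennreal (n * \<kappa>)" if z: "z \<in> ball 0 1" for z
  proof -
    interpret Q: pair_sigma_finite circle ?P ..
    have "(\<integral>\<^sup>+u. X (z * u) \<partial>circle) = (\<integral>\<^sup>+x. (\<integral>\<^sup>+u. G x * K (z * u) (snd x) \<partial>circle) \<partial>?P)"
      unfolding X_def by (subst Q.Fubini') auto
    also have "\<dots> \<le> (\<integral>\<^sup>+x. G x * ennreal \<kappa> \<partial>?P)"
    proof (rule nn_integral_mono)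
      fix x assume "x \<in> space ?P"
      then have x: "snd x \<in> ball 0 1" by (auto simp: space_pair_measure)
      have "(\<integral>\<^sup>+u. G x * K (z * u) (snd x) \<partial>circle) = G x * (\<integral>\<^sup>+u. K (z * u) (snd x) \<partial>circle)"
        by (rule nn_integral_cmult) measurable
      also have "\<dots> \<le> G x * ennreal \<kappa>" by (intro mult_left_mono mean_left z x) auto
      finally show "(\<integral>\<^sup>+u. G x * K (z * u) (snd x) \<partial>circle) \<le> G x * ennreal \<kappa>" .
    qed
    also have "\<dots> = (\<integral>\<^sup>+x. G x \<partial>?P) * ennreal \<kappa>"
      by (rule nn_integral_multc) measurable
    also have "(\<integral>\<^sup>+x. G x \<partial>?P) = (\<integral>\<^sup>+t. (\<integral>\<^sup>+w. G (t, w) \<partial>disc_area) \<partial>lborel)"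
      by (rule disc.nn_integral_fst[symmetric]) measurable
    also have "\<dots> = (\<integral>\<^sup>+t\<in>{0<..}. ennreal (m t powr \<beta>) \<partial>lborel)"
    proof (intro nn_integral_cong)
      fix t :: real
      show "(\<integral>\<^sup>+w. G (t, w) \<partial>disc_area) = ennreal (m t powr \<beta>) * indicator {0<..} t"
      proof (cases "0 < t")
        case True
        then have "(\<integral>\<^sup>+w. G (t, w) \<partial>disc_area) = (\<integral>\<^sup>+w. ennreal (m t powr b) * indicator {w \<in> ball 0 1. t < g w} w \<partial>disc_area)"
          by (intro nn_integral_cong) (auto simp: G_def)
        also have "\<dots> = ennreal (m t powr b) * ennreal (m t)"
          using superlevel_in_sets[OF g, of t]
          by (subst nn_integral_cmult_indicator) (simp_all only: emeasure_superlevel m_def)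
        also have "\<dots> = ennreal (m t powr \<beta>)"
        proof (cases "m t = 0")
          case False
          then have "m t powr b * m t = m t powr \<beta>"
            using m0[of t] by (simp add: b_def powr_diff)
          then show ?thesis using m0[of t] by (simp add: ennreal_mult[symmetric])
        qed simp
        finally show ?thesis using True by simp
      qed (auto simp: G_def)
    qed
    also have "(\<integral>\<^sup>+t\<in>{0<..}. ennreal (m t powr \<beta>) \<partial>lborel) * ennreal \<kappa> \<le> ennreal n * ennreal \<kappa>"
      by (intro mult_right_mono N) simp
    also have "\<dots> = ennreal (n * \<kappa>)" using n kappa_pos by (simp add: ennreal_mult)
    finally show ?thesis .
  qed
  have weighted_le: "weighted_integral \<beta> K g z \<le> ennreal (n / \<beta> * \<kappa> + (n / A0 * \<kappa>) powr (1 / p) * x powr (1 / q))"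
    if z: "z \<in> ball 0 1" and x: "0 \<le> x" "X z \<le> ennreal x" for z x
  proof -
    define F where "F = (\<lambda>(t, w). if 0 < t \<and> t < g w then ennreal (defect w powr b) * K z w else 0)"
    have [measurable]: "F \<in> borel_measurable ?P" unfolding F_def by measurable
    \<comment> \<open>Near the boundary the constraint \<open>t < g w\<close> is dropped: the full
      annulus is already cheap enough.\<close>
    define F1 where "F1 t w = (if defect w < m t then ennreal (defect w powr b) * K z w else 0)" for t w
    have [measurable]: "case_prod F1 \<in> borel_measurable ?P" unfolding F1_def by measurable
    \<comment> \<open>The rest of the superlevel set, with \<open>K\<close> absorbed into a density,
      carries the measure for Hoelder's inequality. Levels with \<open>m t = 0\<close> contribute
      nothing, and excluding them lets the powers of \<open>m t\<close> cancel in
      \<open>u * v\<close>.\<close>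
    define D where "D = (\<lambda>(t, w). if 0 < t \<and> t < g w \<and> m t \<le> defect w \<and> 0 < m t then K z w else 0)"
    have [measurable]: "D \<in> borel_measurable ?P" unfolding D_def by measurable
    \<comment> \<open>The powers of \<open>m t\<close> in \<open>u\<close> and \<open>v\<close> are
      chosen so that the \<open>q\<close>-th power of \<open>v\<close> is the weight of
      \<open>G\<close>, while the \<open>p\<close>-th power of \<open>u\<close> integrates to a
      multiple of \<open>m t powr \<beta>\<close>.\<close>
    define u where "u = (\<lambda>(t, w). defect w powr b * m t powr (- b / q))"
    define v where "v = (\<lambda>(t, w::complex). m t powr (b / q))"
    have [measurable]: "u \<in> borel_measurable ?P" "v \<in> borel_measurable ?P"
      unfolding u_def v_def by measurable
    have "weighted_integral \<beta> K g z = (\<integral>\<^sup>+w. (\<integral>\<^sup>+t. F (t, w) \<partial>lborel) \<partial>disc_area)"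
      unfolding weighted_integral_def
    proof (rule nn_integral_cong)
      fix w
      have "(\<integral>\<^sup>+t. F (t, w) \<partial>lborel) = (\<integral>\<^sup>+t. ennreal (defect w powr b) * K z w * indicator {0<..<g w} t \<partial>lborel)"
        by (intro nn_integral_cong) (auto simp: F_def indicator_def)
      also have "\<dots> = ennreal (defect w powr b) * K z w * ennreal (g w)"
        using g0 by (subst nn_integral_cmult_indicator) auto
      finally show "ennreal (defect w powr (\<beta> - 1) * g w) * K z w = (\<integral>\<^sup>+t. F (t, w) \<partial>lborel)"
        using g0 by (simp add: b_def ennreal_mult mult_ac)
    qed
    also have "\<dots> = (\<integral>\<^sup>+t. (\<integral>\<^sup>+w. F (t, w) \<partial>disc_area) \<partial>lborel)"
      by (rule P.Fubini) measurable
    also have "\<dots> \<le> (\<integral>\<^sup>+t. (\<integral>\<^sup>+w. F1 t w \<partial>disc_area) * indicator {0<..} t + (\<integral>\<^sup>+w. D (t, w) * ennreal (u (t, w) * v (t, w)) \<partial>disc_area) \<partial>lborel)"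
    proof (rule nn_integral_mono)
      fix t :: real
      consider "t \<le> 0" | "0 < t" "m t = 0" | "0 < t" "0 < m t" using m0[of t] by linarith
      then show "(\<integral>\<^sup>+w. F (t, w) \<partial>disc_area) \<le> (\<integral>\<^sup>+w. F1 t w \<partial>disc_area) * indicator {0<..} t + (\<integral>\<^sup>+w. D (t, w) * ennreal (u (t, w) * v (t, w)) \<partial>disc_area)"
      proof cases
        case 1
        then show ?thesis by (simp add: F_def)
      next
        case 2
        have "{w \<in> ball 0 1. t < g w} \<in> null_sets disc_area"
          using 2(2) superlevel_in_sets[OF g, of t]
          by (intro null_setsI) (simp_all only: emeasure_superlevel m_def ennreal_0)
        from AE_not_in[OF this] AE_space
        have "AE w in disc_area. F (t, w) = 0" by eventually_elim (simp add: F_def)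
        then have "(\<integral>\<^sup>+w. F (t, w) \<partial>disc_area) = (\<integral>\<^sup>+w. 0 \<partial>disc_area)"
          by (rule nn_integral_cong_AE)
        then show ?thesis by simp
      next
        case 3
        then have uv: "u (t, w) * v (t, w) = defect w powr b" for w
          by (simp add: u_def v_def mult.assoc powr_add[symmetric])
        have "(\<integral>\<^sup>+w. F (t, w) \<partial>disc_area) \<le> (\<integral>\<^sup>+w. F1 t w + D (t, w) * ennreal (u (t, w) * v (t, w)) \<partial>disc_area)"
          using 3 unfolding uv by (intro nn_integral_mono) (auto simp: F_def F1_def D_def mult.commute)
        also have "\<dots> = (\<integral>\<^sup>+w. F1 t w \<partial>disc_area) + (\<integral>\<^sup>+w. D (t, w) * ennreal (u (t, w) * v (t, w)) \<partial>disc_area)"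
          by (rule nn_integral_add) measurable
        finally show ?thesis using 3 by simp
      qed
    qed
    also have "\<dots> = (\<integral>\<^sup>+t\<in>{0<..}. (\<integral>\<^sup>+w. F1 t w \<partial>disc_area) \<partial>lborel) + (\<integral>\<^sup>+t. (\<integral>\<^sup>+w. D (t, w) * ennreal (u (t, w) * v (t, w)) \<partial>disc_area) \<partial>lborel)"
      by (rule nn_integral_add) measurable
    also have "\<dots> \<le> ennreal (n / \<beta> * \<kappa>) + ennreal ((n / A0 * \<kappa>) powr (1 / p) * x powr (1 / q))"
    proof (rule add_mono)
      have "(\<integral>\<^sup>+t\<in>{0<..}. (\<integral>\<^sup>+w. F1 t w \<partial>disc_area) \<partial>lborel) \<le> (\<integral>\<^sup>+t. ennreal (\<kappa> / \<beta>) * (ennreal (m t powr \<beta>) * indicator {0<..} t) \<partial>lborel)"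
      proof (rule nn_integral_mono)
        fix t :: real
        have "(\<integral>\<^sup>+w. F1 t w \<partial>disc_area) \<le> ennreal (m t powr \<beta> / \<beta> * \<kappa>)"
          unfolding F1_def b_def using \<beta> m0 z by (intro integral_kernel_near_boundary) auto
        also have "\<dots> = ennreal (\<kappa> / \<beta>) * ennreal (m t powr \<beta>)"
          using kappa_pos \<beta> by (simp add: ennreal_mult[symmetric])
        finally show "(\<integral>\<^sup>+w. F1 t w \<partial>disc_area) * indicator {0<..} t \<le> ennreal (\<kappa> / \<beta>) * (ennreal (m t powr \<beta>) * indicator {0<..} t)"
          by (auto simp: indicator_def)
      qed
      also have "\<dots> = ennreal (\<kappa> / \<beta>) * (\<integral>\<^sup>+t\<in>{0<..}. ennreal (m t powr \<beta>) \<partial>lborel)"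
        by (rule nn_integral_cmult) measurable
      also have "\<dots> \<le> ennreal (\<kappa> / \<beta>) * ennreal n" by (intro mult_left_mono N) simp
      also have "\<dots> = ennreal (n / \<beta> * \<kappa>)"
        using kappa_pos \<beta> n by (simp add: ennreal_mult[symmetric] mult.commute)
      finally show "(\<integral>\<^sup>+t\<in>{0<..}. (\<integral>\<^sup>+w. F1 t w \<partial>disc_area) \<partial>lborel) \<le> ennreal (n / \<beta> * \<kappa>)" .
    next
      have "(\<integral>\<^sup>+t. (\<integral>\<^sup>+w. D (t, w) * ennreal (u (t, w) * v (t, w)) \<partial>disc_area) \<partial>lborel)
          = (\<integral>\<^sup>+y. D y * ennreal (u y * v y) \<partial>?P)"
        by (rule disc.nn_integral_fst) measurable
      also have "\<dots> = (\<integral>\<^sup>+y. ennreal (u y * v y) \<partial>density ?P D)"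
        by (rule nn_integral_density[symmetric]) measurable
      also have "\<dots> \<le> ennreal ((n / A0 * \<kappa>) powr (1 / p) * x powr (1 / q))"
      proof (rule nn_integral_Holder)
        show "u \<in> borel_measurable (density ?P D)" "v \<in> borel_measurable (density ?P D)" by measurable
        show "0 \<le> u y" "0 \<le> v y" for y by (auto simp: u_def v_def split: prod.splits)
        show "0 \<le> n / A0 * \<kappa>" using n A0p kappa_pos by simp
        have "(\<integral>\<^sup>+y. ennreal (u y powr p) \<partial>density ?P D) = (\<integral>\<^sup>+y. D y * ennreal (u y powr p) \<partial>?P)"
          by (rule nn_integral_density) measurable
        also have "\<dots> = (\<integral>\<^sup>+t. (\<integral>\<^sup>+w. D (t, w) * ennreal (u (t, w) powr p) \<partial>disc_area) \<partial>lborel)"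
          by (rule disc.nn_integral_fst[symmetric]) measurable
        also have "\<dots> \<le> (\<integral>\<^sup>+t. ennreal (\<kappa> / A0) * (ennreal (m t powr \<beta>) * indicator {0<..} t) \<partial>lborel)"
        proof (rule nn_integral_mono)
          fix t :: real
          show "(\<integral>\<^sup>+w. D (t, w) * ennreal (u (t, w) powr p) \<partial>disc_area) \<le> ennreal (\<kappa> / A0) * (ennreal (m t powr \<beta>) * indicator {0<..} t)"
          proof (cases "0 < t \<and> 0 < m t")
            case True
            \<comment> \<open>Since \<open>p / q = p - 1\<close>, the left-hand side collapses to
              \<open>b + 1\<close>.\<close>
            have exps: "- (b * p / q) + (b * p + 1) = \<beta>"
              using pq(3) by (simp add: b_def right_diff_distrib times_divide_eq_right[symmetric] del: times_divide_eq_right)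
            have "(\<integral>\<^sup>+w. D (t, w) * ennreal (u (t, w) powr p) \<partial>disc_area)
              \<le> (\<integral>\<^sup>+w. ennreal (m t powr (- (b * p / q))) * (if m t \<le> defect w then ennreal (defect w powr (b * p)) * K z w else 0) \<partial>disc_area)"
              by (intro nn_integral_mono)
                (auto simp: D_def u_def powr_mult powr_powr ennreal_mult mult_ac)
            also have "\<dots> = ennreal (m t powr (- (b * p / q))) * (\<integral>\<^sup>+w. (if m t \<le> defect w then ennreal (defect w powr (b * p)) * K z w else 0) \<partial>disc_area)"
              by (rule nn_integral_cmult) measurable
            also have "\<dots> \<le> ennreal (m t powr (- (b * p / q))) * ennreal (m t powr (b * p + 1) / (- 1 - b * p) * \<kappa>)"
              using True bp z by (intro mult_left_mono integral_kernel_off_boundary) auto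
            also have "\<dots> = ennreal (m t powr (- (b * p / q)) * m t powr (b * p + 1) * (\<kappa> / A0))"
              using A0p kappa_pos by (simp add: ennreal_mult[symmetric])
            also have "\<dots> = ennreal (\<kappa> / A0) * ennreal (m t powr \<beta>)"
              unfolding powr_add[symmetric] exps using A0p kappa_pos by (simp add: ennreal_mult[symmetric])
            finally show ?thesis using True by simp
          qed (auto simp: D_def)
        qed
        also have "\<dots> = ennreal (\<kappa> / A0) * (\<integral>\<^sup>+t\<in>{0<..}. ennreal (m t powr \<beta>) \<partial>lborel)"
          by (rule nn_integral_cmult) measurable
        also have "\<dots> \<le> ennreal (\<kappa> / A0) * ennreal n" by (intro mult_left_mono N) simp
        also have "\<dots> = ennreal (n / A0 * \<kappa>)"
          using kappa_pos A0p n by (simp add: ennreal_mult[symmetric] mult.commute)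
        finally show "(\<integral>\<^sup>+y. ennreal (u y powr p) \<partial>density ?P D) \<le> ennreal (n / A0 * \<kappa>)" .
        have "(\<integral>\<^sup>+y. ennreal (v y powr q) \<partial>density ?P D) = (\<integral>\<^sup>+y. D y * ennreal (v y powr q) \<partial>?P)"
          by (rule nn_integral_density) measurable
        also have "\<dots> \<le> X z"
          unfolding X_def using q by (intro nn_integral_mono)
            (auto simp: D_def v_def G_def powr_powr mult.commute split: prod.splits)
        also note x(2)
        finally show "(\<integral>\<^sup>+y. ennreal (v y powr q) \<partial>density ?P D) \<le> ennreal x" .
      qed (use pq q x in auto)
      finally show "(\<integral>\<^sup>+t. (\<integral>\<^sup>+w. D (t, w) * ennreal (u (t, w) * v (t, w)) \<partial>disc_area) \<partial>lborel)
          \<le> ennreal ((n / A0 * \<kappa>) powr (1 / p) * x powr (1 / q))" .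
    qed
    finally show ?thesis
      using n \<beta> kappa_pos by (subst ennreal_plus) auto
  qed
  \<comment> \<open>Up to the factor \<open>2 powr q\<close> from a sum of two terms, these are the
    \<open>q\<close>-th powers of the summands in \<open>weighted_le\<close>, with
    \<open>q / p = q - 1\<close> and the bound \<open>x\<close> replaced by
    \<open>X z\<close>.\<close>
  define Y where "Y z = ennreal (2 powr q) * (ennreal ((n / \<beta> * \<kappa>) powr q) + ennreal ((n / A0 * \<kappa>) powr (q - 1)) * X z)" for z
  show ?thesis
  proof (rule that)
    show "Y \<in> borel_measurable borel" unfolding Y_def by measurable
  next
    fix z :: complex assume z: "z \<in> ball 0 1"
    have "(\<integral>\<^sup>+u. Y (z * u) \<partial>circle) = ennreal (2 powr q) * (ennreal ((n / \<beta> * \<kappa>) powr q) + ennreal ((n / A0 * \<kappa>) powr (q - 1)) * (\<integral>\<^sup>+u. X (z * u) \<partial>circle))"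
      unfolding Y_def by (simp add: nn_integral_cmult nn_integral_add circ.emeasure_space_1[simplified])
    also have "\<dots> \<le> ennreal (2 powr q) * (ennreal ((n / \<beta> * \<kappa>) powr q) + ennreal ((n / A0 * \<kappa>) powr (q - 1)) * ennreal (n * \<kappa>))"
      by (intro mult_left_mono add_left_mono X_mean z) auto
    also have "\<dots> = ennreal (2 powr q * ((n / \<beta> * \<kappa>) powr q + (n / A0 * \<kappa>) powr (q - 1) * (n * \<kappa>)))"
      using n kappa_pos by (simp add: ennreal_mult[symmetric] ennreal_plus[symmetric] del: ennreal_plus)
    also have "2 powr q * ((n / \<beta> * \<kappa>) powr q + (n / A0 * \<kappa>) powr (q - 1) * (n * \<kappa>)) = C * n powr q"
    proof -
      have "(n / \<beta> * \<kappa>) powr q = (\<kappa> / \<beta>) powr q * n powr q"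
        using n \<beta> kappa_pos by (simp add: powr_mult[symmetric] mult.commute)
      moreover have "(n / A0 * \<kappa>) powr (q - 1) = (\<kappa> / A0) powr (q - 1) * n powr (q - 1)"
        using n A0p kappa_pos by (simp add: powr_mult[symmetric] mult.commute)
      moreover have "n powr (q - 1) * n = n powr q"
        using n by (simp add: powr_diff)
      ultimately show ?thesis unfolding C by (simp add: algebra_simps)
    qed
    finally show "(\<integral>\<^sup>+u. Y (z * u) \<partial>circle) \<le> ennreal (C * n powr q)" .
  next
    fix z :: complex and r :: real
    assume z: "z \<in> ball 0 1" and r: "0 \<le> r" "ennreal r \<le> weighted_integral \<beta> K g z"
    show "ennreal (r powr q) \<le> Y z"
    proof (cases "X z")
      case top
      have "0 < (n / A0 * \<kappa>) powr (q - 1)" using n A0p kappa_pos by simp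
      then have "Y z = \<infinity>" unfolding Y_def top by (simp add: ennreal_mult_top ennreal_top_mult)
      then show ?thesis by simp
    next
      case (real x)
      define a where "a = n / \<beta> * \<kappa>"
      define c where "c = (n / A0 * \<kappa>) powr (1 / p) * x powr (1 / q)"
      have ac: "0 \<le> a" "0 \<le> c" using n \<beta> kappa_pos by (auto simp: a_def c_def)
      have "ennreal r \<le> ennreal (a + c)"
        using r(2) weighted_le[OF z real(1)] real(2) unfolding a_def c_def by (auto intro: order_trans)
      then have "r \<le> a + c" using ac by (subst (asm) ennreal_le_iff) auto
      then have "r \<le> 2 * max a c" by linarith
      then have "r powr q \<le> (2 * max a c) powr q" using r q by (intro powr_mono2) auto
      also have "\<dots> = 2 powr q * (max a c) powr q" using ac by (simp add: powr_mult)
      also have "\<dots> \<le> 2 powr q * (a powr q + c powr q)" by (intro mult_left_mono) (auto simp: max_def)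
      also have "c powr q = (n / A0 * \<kappa>) powr (q - 1) * x"
        using real(1) q pq(4) by (simp add: c_def powr_mult powr_powr)
      finally show ?thesis
        using real ac by (simp add: Y_def a_def ennreal_mult[symmetric] ennreal_plus[symmetric] ennreal_leI del: ennreal_plus)
    qed
  qed
qed

subsection \<open>Weak-type bounds for operators with a majorant\<close>

text \<open>Dividing by \<open>defect z\<close> turns the level set at height \<open>t\<close> into
  the one where \<open>norm (F z)\<close> exceeds \<open>t * defect z\<close>; the factor
  \<open>1 / t\<close> in the Chebyshev estimate then cancels the \<open>t\<close> of the weak
  norm.\<close>

lemma weak_L1_norm_le:
  assumes [measurable]: "X \<in> borel_measurable borel" "F \<in> borel_measurable borel"
    and q: "1 < q" and M: "0 < M"
    and X: "\<And>z. z \<in> ball 0 1 \<Longrightarrow> (\<integral>\<^sup>+u. X (z * u) \<partial>circle) \<le> ennreal (M powr q)"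
    and F: "\<And>z. z \<in> ball 0 1 \<Longrightarrow> ennreal (norm (F z) powr q) \<le> X z"
  shows "weak_L1_norm (\<lambda>z. of_real (defect z powr -1) * F z) \<le> ennreal (M * (1 + 1 / (q - 1)))"
  unfolding weak_L1_norm_def
proof (rule SUP_least)
  fix t :: real assume "t \<in> {0<..}"
  then have t: "0 < t" by simp
  have eq: "t < norm (of_real (defect z powr -1) * F z) \<longleftrightarrow> t * defect z < norm (F z)" if "z \<in> ball 0 1" for z
  proof -
    have d: "0 < defect z" using defect_pos[OF that] .
    then have "norm (of_real (defect z powr -1) * F z) = norm (F z) / defect z"
      unfolding norm_mult norm_of_real abs_of_nonneg[OF powr_ge_zero]
      by (simp only: powr_minus_divide powr_one_gt_zero_iff powr_one less_imp_le) simp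
    then show ?thesis using pos_less_divide_eq[OF d] by simp
  qed
  then have "{z \<in> space disc_area. norm (of_real (defect z powr -1) * F z) > t}
     = {z \<in> ball 0 1. norm (F z) > t * defect z}"
    unfolding space_disc_area by (intro Collect_cong) blast
  then have "ennreal t * emeasure disc_area {z \<in> space disc_area. norm (of_real (defect z powr -1) * F z) > t}
      \<le> ennreal t * ennreal (M / t * (1 + 1 / (q - 1)))"
    using weak_type_of_circle_means[OF _ _ q M t X, of "\<lambda>z. norm (F z)"] F by (intro mult_left_mono) simp_all
  also have "\<dots> = ennreal (M * (1 + 1 / (q - 1)))"
    using t M q by (simp add: ennreal_mult[symmetric])
  finally show "ennreal t * emeasure disc_area {z \<in> space disc_area. norm (of_real (defect z powr -1) * F z) > t}
      \<le> ennreal (M * (1 + 1 / (q - 1)))" .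
qed

lemma measurable_kernel_integral:
  fixes k :: "complex \<Rightarrow> complex \<Rightarrow> complex" and f :: "complex \<Rightarrow> complex"
  assumes k: "case_prod k \<in> borel_measurable (borel \<Otimes>\<^sub>M borel)" and f: "f \<in> borel_measurable disc_area"
  shows "(\<lambda>z. \<integral>w. k z w * f w \<partial>disc_area) \<in> borel_measurable (borel :: complex measure)"
proof -
  have "(\<lambda>x. k (fst x) (snd x)) \<in> borel_measurable (borel \<Otimes>\<^sub>M disc_area)"
    using measurable_compose[OF measurable_Pair[of fst _ _ snd] k] by simp
  then have "case_prod (\<lambda>z w. k z w * f w) \<in> borel_measurable (borel \<Otimes>\<^sub>M disc_area)"
    unfolding split_beta' using measurable_compose[OF measurable_snd f] by (intro borel_measurable_times)
  then show ?thesis by (rule disc.borel_measurable_lebesgue_integral)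
qed

lemma measurable_kernel_section:
  assumes k: "case_prod k \<in> borel_measurable (borel \<Otimes>\<^sub>M borel)"
  shows "(\<lambda>w. k z w) \<in> borel_measurable (disc_area)"
  using measurable_compose[OF measurable_Pair[of "\<lambda>_. z" disc_area borel "\<lambda>w. w"] k] by simp

text \<open>The source norm enters only through its control of \<open>lorentz_integral\<close>, so
  Lebesgue and Lorentz spaces share this argument. The mean bound is homogeneous of degree
  \<open>q\<close> in \<open>n\<close>, which makes the final estimate linear in the norm.\<close>

lemma maps_boundedly_of_majorant:
  assumes k: "case_prod k \<in> borel_measurable (borel \<Otimes>\<^sub>M borel)"
    and q: "1 < q" and C: "0 < C" and D: "0 \<le> D"
    and NX: "\<And>f. f \<in> borel_measurable disc_area \<Longrightarrow> lorentz_integral \<beta> (\<lambda>w. norm (f w)) \<le> ennreal D * NX f"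
    and int: "\<And>f n. f \<in> borel_measurable disc_area \<Longrightarrow> 0 < n \<Longrightarrow> lorentz_integral \<beta> (\<lambda>w. norm (f w)) \<le> ennreal n \<Longrightarrow>
       AE z in disc_area. integrable disc_area (\<lambda>w. k z w * f w)"
    and maj: "\<And>f n. f \<in> borel_measurable disc_area \<Longrightarrow> 0 < n \<Longrightarrow> lorentz_integral \<beta> (\<lambda>w. norm (f w)) \<le> ennreal n \<Longrightarrow>
       \<exists>X\<in>borel_measurable borel. (\<forall>z\<in>ball 0 1. (\<integral>\<^sup>+u. X (z * u) \<partial>circle) \<le> ennreal (C * n powr q)) \<and>
         (\<forall>z\<in>ball 0 1. ennreal (norm (\<integral>w. k z w * f w \<partial>disc_area) powr q) \<le> X z)"
  shows "maps_boundedly (-1) k NX weak_L1_norm"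
proof -
  define C' where "C' = C powr (1 / q) * (1 + 1 / (q - 1))"
  have C': "0 < C'" using C q by (simp add: C'_def add_pos_pos)
  have fin: "\<exists>\<nu>\<ge>0. ennreal D * NX f = ennreal \<nu> \<and> lorentz_integral \<beta> (\<lambda>w. norm (f w)) \<le> ennreal \<nu>"
    if "f \<in> space_of_norm NX" for f
  proof -
    from that have f: "f \<in> borel_measurable disc_area" "NX f < \<infinity>" by (auto simp: space_of_norm_def)
    then have "ennreal D * NX f \<noteq> top" by (simp add: ennreal_mult_eq_top_iff)
    with NX[OF f(1)] show ?thesis by (cases "ennreal D * NX f") auto
  qed
  have weak: "weak_L1_norm (disc_operator (-1) k f) \<le> ennreal (C' * D) * NX f" if f: "f \<in> space_of_norm NX" for f
  proof -
    from fin[OF f] obtain \<nu> where \<nu>: "0 \<le> \<nu>" "ennreal D * NX f = ennreal \<nu>" "lorentz_integral \<beta> (\<lambda>w. norm (f w)) \<le> ennreal \<nu>"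
      by auto
    have fm: "f \<in> borel_measurable disc_area" using f by (simp add: space_of_norm_def)
    have "weak_L1_norm (disc_operator (-1) k f) \<le> ennreal (C' * \<nu>)"
    proof (rule ennreal_le_epsilon)
      fix e :: real assume e: "0 < e"
      \<comment> \<open>The majorant requires a positive \<open>n\<close>, whereas
        \<open>\<nu>\<close> may vanish; the surplus is scaled so that it adds exactly
        \<open>e\<close> to the bound.\<close>
      define n where "n = \<nu> + e / C'"
      have "ennreal \<nu> \<le> ennreal n" using e C' by (intro ennreal_leI) (simp add: n_def)
      from order_trans[OF \<nu>(3) this] have n: "0 < n" "lorentz_integral \<beta> (\<lambda>w. norm (f w)) \<le> ennreal n"
        using \<nu>(1) e C' by (simp_all add: n_def add_nonneg_pos del: ennreal_plus)
      obtain X where X: "X \<in> borel_measurable borel" "\<And>z. z \<in> ball 0 1 \<Longrightarrow> (\<integral>\<^sup>+u. X (z * u) \<partial>circle) \<le> ennreal (C * n powr q)"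
        "\<And>z. z \<in> ball 0 1 \<Longrightarrow> ennreal (norm (\<integral>w. k z w * f w \<partial>disc_area) powr q) \<le> X z"
        using maj[OF fm n] by auto
      have "C * n powr q = (C powr (1 / q) * n) powr q"
        using C n q by (simp add: powr_mult powr_powr)
      then have "weak_L1_norm (disc_operator (-1) k f) \<le> ennreal (C powr (1 / q) * n * (1 + 1 / (q - 1)))"
        unfolding disc_operator_def using X C n q
        by (intro weak_L1_norm_le[of X] measurable_kernel_integral k fm) auto
      also have "C powr (1 / q) * n * (1 + 1 / (q - 1)) = C' * n"
        by (simp only: C'_def mult_ac)
      also have "\<dots> = C' * \<nu> + e"
        using C' by (simp add: n_def distrib_left)
      also have "ennreal \<dots> = ennreal (C' * \<nu>) + ennreal e"
        using C' \<nu> e by simp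
      finally show "weak_L1_norm (disc_operator (-1) k f) \<le> ennreal (C' * \<nu>) + ennreal e" .
    qed
    also have "\<dots> = ennreal (C' * D) * NX f"
      using \<nu> C' D by (simp add: ennreal_mult mult.assoc)
    finally show ?thesis .
  qed
  show ?thesis
    unfolding maps_boundedly_def
  proof (intro conjI ballI exI[of _ "C' * D"])
    fix f assume f: "f \<in> space_of_norm NX"
    then have fm [measurable]: "f \<in> borel_measurable disc_area" and NXf: "NX f < \<infinity>"
      by (simp_all add: space_of_norm_def)
    from fin[OF f] obtain \<nu> where \<nu>: "0 \<le> \<nu>" "lorentz_integral \<beta> (\<lambda>w. norm (f w)) \<le> ennreal \<nu>" by auto
    have "ennreal \<nu> \<le> ennreal (\<nu> + 1)" by (intro ennreal_leI) simp
    from int[OF fm _ order_trans[OF \<nu>(2) this]] \<nu>(1)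
    show "AE z in disc_area. integrable disc_area (\<lambda>w. k z w * f w)" by simp
    show "weak_L1_norm (disc_operator (-1) k f) \<le> ennreal (C' * D) * NX f" by (rule weak[OF f])
    also have "\<dots> < \<infinity>" using NXf by (simp add: ennreal_mult_eq_top_iff less_top[symmetric])
    finally have "weak_L1_norm (disc_operator (-1) k f) < \<infinity>" .
    moreover have "disc_operator (-1) k f \<in> borel_measurable disc_area"
      unfolding disc_operator_def using measurable_kernel_integral[OF k fm]
      by (intro measurable_disc_area_borel) simp
    ultimately show "disc_operator (-1) k f \<in> space_of_norm weak_L1_norm"
      by (simp add: space_of_norm_def)
  qed
qed

lemma ennreal_norm_integral_le:
  fixes f :: "'a \<Rightarrow> 'b :: {banach, second_countable_topology}"
  shows "ennreal (norm (\<integral>x. f x \<partial>M)) \<le> (\<integral>\<^sup>+x. ennreal (norm (f x)) \<partial>M)"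
  by (cases "integrable M f") (auto intro: integral_norm_bound_ennreal simp: not_integrable_integral_eq)

text \<open>The circular means of the majorant are bounded, so its area integral is finite and the
  majorant is finite almost everywhere; it must be infinite wherever the weighted integral
  is.\<close>

lemma (in circle_kernel) AE_weighted_integral_finite:
  assumes g: "g \<in> borel_measurable disc_area" "\<And>w. 0 \<le> g w"
    and \<beta>: "0 < \<beta>" "\<beta> < 1" and n: "0 < n" "lorentz_integral \<beta> g \<le> ennreal n"
  shows "AE z in disc_area. weighted_integral \<beta> K g z < \<infinity>"
proof -
  obtain q where q: "1 < q" "q < 1 / \<beta>" using dense[of 1 "1 / \<beta>"] \<beta> by auto
  then have q\<beta>: "q * \<beta> < 1" using \<beta> by (simp add: field_simps)
  define C where "C = 2 powr q * ((\<kappa> / \<beta>) powr q + (\<kappa> / ((1 - \<beta>) * q / (q - 1) - 1)) powr (q - 1) * \<kappa>)"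
  obtain Y where Y [measurable]: "Y \<in> borel_measurable borel" and
    Y_mean: "\<And>z. z \<in> ball 0 1 \<Longrightarrow> (\<integral>\<^sup>+u. Y (z * u) \<partial>circle) \<le> ennreal (C * n powr q)" and
    Y_ge: "\<And>z r. z \<in> ball 0 1 \<Longrightarrow> 0 \<le> r \<Longrightarrow> ennreal r \<le> weighted_integral \<beta> K g z \<Longrightarrow> ennreal (r powr q) \<le> Y z"
    using weighted_integral_majorant[OF g \<beta> q(1) q\<beta> n refl C_def] by blast
  have "(\<integral>\<^sup>+z. Y z \<partial>disc_area) = (\<integral>\<^sup>+z. (\<integral>\<^sup>+u. Y (z * u) \<partial>circle) \<partial>disc_area)"
    by (rule nn_integral_disc_area_circle) measurable
  also have "\<dots> \<le> (\<integral>\<^sup>+z. ennreal (C * n powr q) \<partial>disc_area)"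
    by (intro nn_integral_mono Y_mean) simp
  also have "\<dots> = ennreal (C * n powr q)" using disc.emeasure_space_1 by simp
  finally have "AE z in disc_area. Y z \<noteq> \<infinity>"
    by (intro nn_integral_PInf_AE measurable_disc_area_borel Y) (auto simp: top_unique)
  from this AE_space show ?thesis
  proof eventually_elim
    fix z assume z: "Y z \<noteq> \<infinity>" "z \<in> space disc_area"
    then obtain y where y: "0 \<le> y" "Y z = ennreal y" by (cases "Y z") auto
    show "weighted_integral \<beta> K g z < \<infinity>"
    proof (rule ccontr)
      assume "\<not> weighted_integral \<beta> K g z < \<infinity>"
      then have "weighted_integral \<beta> K g z = \<infinity>" by (simp add: less_top[symmetric])
      \<comment> \<open>An infinite weighted integral admits every \<open>r\<close>; this one would
        give \<open>y + 1 \<le> y\<close>.\<close>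
      then have "ennreal (((y + 1) powr (1 / q)) powr q) \<le> Y z"
        using z by (intro Y_ge) auto
      then show False using y q by (simp add: powr_powr)
    qed
  qed
qed

text \<open>No cancellation is used: the transform of \<open>f\<close> is bounded by the weighted
  integral of \<open>norm f\<close>, whose majorant, multiplied by \<open>C0 powr q\<close>, serves
  for \<open>k\<close>.\<close>

lemma (in circle_kernel) maps_boundedly_of_dominated:
  assumes k: "case_prod k \<in> borel_measurable (borel \<Otimes>\<^sub>M borel)"
    and \<beta>: "0 < \<beta>" "\<beta> < 1" and D: "0 \<le> D" and C0: "0 < C0"
    and NX: "\<And>f. f \<in> borel_measurable disc_area \<Longrightarrow> lorentz_integral \<beta> (\<lambda>w. norm (f w)) \<le> ennreal D * NX f"
    and dom: "\<And>z w. z \<in> ball 0 1 \<Longrightarrow> w \<in> ball 0 1 \<Longrightarrow> ennreal (norm (k z w)) \<le> ennreal (C0 * defect w powr (\<beta> - 1)) * K z w"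
  shows "maps_boundedly (-1) k NX weak_L1_norm"
proof -
  obtain q where q: "1 < q" "q < 1 / \<beta>" using dense[of 1 "1 / \<beta>"] \<beta> by auto
  then have q\<beta>: "q * \<beta> < 1" using \<beta> by (simp add: field_simps)
  define A0 where "A0 = (1 - \<beta>) * q / (q - 1) - 1"
  have A0: "0 < A0" using q q\<beta> by (simp add: A0_def field_simps)
  define C where "C = 2 powr q * ((\<kappa> / \<beta>) powr q + (\<kappa> / A0) powr (q - 1) * \<kappa>)"
  have C: "0 < C" using kappa_pos \<beta> A0 by (simp add: C_def add_pos_pos)
  have le: "(\<integral>\<^sup>+w. ennreal (norm (k z w * f w)) \<partial>disc_area) \<le> ennreal C0 * weighted_integral \<beta> K (\<lambda>w. norm (f w)) z"
    if f [measurable]: "f \<in> borel_measurable disc_area" and z: "z \<in> ball 0 1" for f :: "complex \<Rightarrow> complex" and z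
  proof -
    have "(\<integral>\<^sup>+w. ennreal (norm (k z w * f w)) \<partial>disc_area) \<le> (\<integral>\<^sup>+w. ennreal C0 * (ennreal (defect w powr (\<beta> - 1) * norm (f w)) * K z w) \<partial>disc_area)"
    proof (rule nn_integral_mono)
      fix w assume w: "w \<in> space disc_area"
      have "ennreal (norm (k z w * f w)) = ennreal (norm (k z w)) * ennreal (norm (f w))"
        by (simp add: norm_mult ennreal_mult)
      also have "\<dots> \<le> ennreal (C0 * defect w powr (\<beta> - 1)) * K z w * ennreal (norm (f w))"
        using w by (intro mult_right_mono dom z) auto
      also have "\<dots> = ennreal C0 * (ennreal (defect w powr (\<beta> - 1) * norm (f w)) * K z w)"
        using C0 by (simp add: ennreal_mult mult_ac)
      finally show "ennreal (norm (k z w * f w)) \<le> ennreal C0 * (ennreal (defect w powr (\<beta> - 1) * norm (f w)) * K z w)" .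
    qed
    also have "\<dots> = ennreal C0 * weighted_integral \<beta> K (\<lambda>w. norm (f w)) z"
      unfolding weighted_integral_def by (rule nn_integral_cmult) measurable
    finally show ?thesis .
  qed
  show ?thesis
  proof (rule maps_boundedly_of_majorant[OF k q(1) _ D NX, of "C0 powr q * C"])
    show "0 < C0 powr q * C" using C C0 by simp
  next
    fix f :: "complex \<Rightarrow> complex" and n assume f: "f \<in> borel_measurable disc_area" and n: "0 < n" "lorentz_integral \<beta> (\<lambda>w. norm (f w)) \<le> ennreal n"
    have g: "(\<lambda>w. norm (f w)) \<in> borel_measurable disc_area" using f by measurable
    from AE_space AE_weighted_integral_finite[OF g _ \<beta> n, simplified]
    show "AE z in disc_area. integrable disc_area (\<lambda>w. k z w * f w)"
    proof eventually_elim
      fix z assume z: "z \<in> space disc_area" and fin: "weighted_integral \<beta> K (\<lambda>w. norm (f w)) z < top"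
      have "ennreal C0 * weighted_integral \<beta> K (\<lambda>w. norm (f w)) z < \<infinity>"
        using fin by (simp add: ennreal_mult_less_top)
      with le[OF f, of z] z show "integrable disc_area (\<lambda>w. k z w * f w)"
        using measurable_kernel_section[OF k, of z] f
        by (intro integrableI_bounded) (auto intro: le_less_trans)
    qed
    obtain Y where Y [measurable]: "Y \<in> borel_measurable borel" and
      Y_mean: "\<And>z. z \<in> ball 0 1 \<Longrightarrow> (\<integral>\<^sup>+u. Y (z * u) \<partial>circle) \<le> ennreal (C * n powr q)" and
      Y_ge: "\<And>z r. z \<in> ball 0 1 \<Longrightarrow> 0 \<le> r \<Longrightarrow> ennreal r \<le> weighted_integral \<beta> K (\<lambda>w. norm (f w)) z \<Longrightarrow> ennreal (r powr q) \<le> Y z"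
      using weighted_integral_majorant[OF g _ \<beta> q(1) q\<beta> n A0_def C_def] by auto
    show "\<exists>X\<in>borel_measurable borel. (\<forall>z\<in>ball 0 1. (\<integral>\<^sup>+u. X (z * u) \<partial>circle) \<le> ennreal (C0 powr q * C * n powr q)) \<and>
         (\<forall>z\<in>ball 0 1. ennreal (norm (\<integral>w. k z w * f w \<partial>disc_area) powr q) \<le> X z)"
    proof (intro bexI[of _ "\<lambda>z. ennreal (C0 powr q) * Y z"] conjI ballI)
      fix z :: complex assume z: "z \<in> ball 0 1"
      have "(\<integral>\<^sup>+u. ennreal (C0 powr q) * Y (z * u) \<partial>circle) = ennreal (C0 powr q) * (\<integral>\<^sup>+u. Y (z * u) \<partial>circle)"
        by (rule nn_integral_cmult) measurable
      also have "\<dots> \<le> ennreal (C0 powr q) * ennreal (C * n powr q)" by (intro mult_left_mono Y_mean z) simp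
      also have "\<dots> = ennreal (C0 powr q * C * n powr q)" using C by (simp add: ennreal_mult[symmetric] mult.assoc)
      finally show "(\<integral>\<^sup>+u. ennreal (C0 powr q) * Y (z * u) \<partial>circle) \<le> ennreal (C0 powr q * C * n powr q)" .
      let ?r = "norm (\<integral>w. k z w * f w \<partial>disc_area)"
      have "ennreal C0 * ennreal (?r / C0) \<le> ennreal C0 * weighted_integral \<beta> K (\<lambda>w. norm (f w)) z"
        using order_trans[OF ennreal_norm_integral_le le[OF f z]] C0 by (simp add: ennreal_mult[symmetric])
      then have "ennreal (?r / C0) \<le> weighted_integral \<beta> K (\<lambda>w. norm (f w)) z"
        using C0 by (subst (asm) ennreal_mult_le_mult_iff) auto
      then have "ennreal ((?r / C0) powr q) \<le> Y z" using C0 by (intro Y_ge z) auto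
      then have "ennreal (C0 powr q) * ennreal ((?r / C0) powr q) \<le> ennreal (C0 powr q) * Y z" by (rule mult_left_mono) simp
      then show "ennreal (?r powr q) \<le> ennreal (C0 powr q) * Y z"
        using C0 by (simp add: ennreal_mult[symmetric] powr_divide)
    qed measurable
  qed
qed

subsection \<open>The M. Riesz inequality and the Cauchy-type operator\<close>

text \<open>Choose an angle \<open>\<gamma>\<close> below \<open>pi / 2\<close> with
  \<open>q * \<gamma>\<close> strictly between \<open>pi / 2\<close> and \<open>pi\<close>. If the
  argument of \<open>\<zeta>\<close> is at least \<open>\<gamma>\<close> in modulus, then
  \<open>Re (\<zeta> powr q)\<close> is so negative that \<open>B\<close> times it absorbs
  \<open>norm \<zeta> powr q\<close>; otherwise \<open>Re \<zeta>\<close> is at least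
  \<open>cos \<gamma> * norm \<zeta>\<close>, and \<open>A\<close> pays for both terms. The bound
  \<open>q < 2\<close> keeps \<open>q\<close> times the argument within the range where cosine
  decreases.\<close>

lemma Riesz_pointwise:
  assumes q: "1 < q" "q < 2"
  obtains A B :: real where "0 < A" "0 \<le> B"
    "\<And>\<zeta>. 0 < Re \<zeta> \<Longrightarrow> norm \<zeta> powr q + B * Re (\<zeta> powr of_real q) \<le> A * Re \<zeta> powr q"
proof -
  have "pi / (2 * q) < pi / 2" using q by (simp add: field_simps)
  then obtain \<gamma> where \<gamma>: "pi / (2 * q) < \<gamma>" and \<gamma>2: "\<gamma> < pi / 2" using dense by blast
  have "0 < pi / (2 * q)" using q by simp
  with \<gamma> have \<gamma>0: "0 < \<gamma>" by linarith
  have q\<gamma>: "pi / 2 < q * \<gamma>" using \<gamma> q by (simp add: field_simps)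
  have "q * \<gamma> < 2 * (pi / 2)" using \<gamma>2 \<gamma>0 q by (intro mult_strict_mono) auto
  then have q\<gamma>': "q * \<gamma> < pi" by simp
  have cosneg: "cos (q * \<gamma>) < 0"
    using cos_monotone_0_pi[of "pi / 2" "q * \<gamma>"] q\<gamma> q\<gamma>' by simp
  have cospos: "0 < cos \<gamma>" using \<gamma>2 \<gamma>0 by (intro cos_gt_zero) auto
  define B where "B = 1 / - cos (q * \<gamma>)"
  have B: "0 < B" using cosneg by (simp add: B_def)
  define A where "A = (1 + B) / cos \<gamma> powr q"
  have A: "0 < A" using B cospos by (simp add: A_def)
  have pw: "norm \<zeta> powr q + B * Re (\<zeta> powr of_real q) \<le> A * Re \<zeta> powr q" if \<zeta>: "0 < Re \<zeta>" for \<zeta> :: complex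
  proof -
    have nz: "\<zeta> \<noteq> 0" using \<zeta> by auto
    define \<phi> where "\<phi> = \<bar>Im (Ln \<zeta>)\<bar>"
    have \<phi>: "0 \<le> \<phi>" "\<phi> < pi / 2" using Re_Ln_pos_lt[OF nz] \<zeta> by (auto simp: \<phi>_def)
    have cosabs: "cos (x * \<phi>) = cos (x * Im (Ln \<zeta>))" for x
      by (auto simp: \<phi>_def abs_if)
    have Re1: "Re \<zeta> = norm \<zeta> * cos \<phi>"
    proof -
      have "Re \<zeta> = Re (exp (Ln \<zeta>))" using nz by simp
      also have "\<dots> = norm \<zeta> * cos (Im (Ln \<zeta>))" using nz by (simp only: Re_exp) simp
      finally show ?thesis using cosabs[of 1] by simp
    qed
    have Req: "Re (\<zeta> powr of_real q) = norm \<zeta> powr q * cos (q * \<phi>)"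
      using nz cosabs[of q] by (simp add: powr_def Re_exp)
    show ?thesis
    proof (cases "\<gamma> \<le> \<phi>")
      case True
      have "q * \<phi> \<le> 2 * (pi / 2)" using q \<phi> by (intro mult_mono) auto
      then have "cos (q * \<phi>) \<le> cos (q * \<gamma>)"
        using True q \<gamma>0 by (intro cos_monotone_0_pi_le) auto
      then have "B * cos (q * \<phi>) \<le> B * cos (q * \<gamma>)" using B by (intro mult_left_mono) auto
      also have "\<dots> = -1" using cosneg by (simp add: B_def)
      finally have "norm \<zeta> powr q * (1 + B * cos (q * \<phi>)) \<le> norm \<zeta> powr q * 0"
        by (intro mult_left_mono) auto
      moreover have "0 \<le> A * Re \<zeta> powr q" using A by simp
      ultimately show ?thesis unfolding Req by (simp add: algebra_simps)
    next
      case False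
      then have "cos \<gamma> \<le> cos \<phi>" using \<phi> \<gamma>2 by (intro cos_monotone_0_pi_le) auto
      then have "cos \<gamma> powr q \<le> cos \<phi> powr q" using cospos q by (intro powr_mono2) auto
      then have "A * cos \<gamma> powr q \<le> A * cos \<phi> powr q" using A by (intro mult_left_mono) auto
      moreover have "A * cos \<gamma> powr q = 1 + B" using cospos by (simp add: A_def)
      ultimately have "1 + B \<le> A * cos \<phi> powr q" by simp
      moreover have "B * cos (q * \<phi>) \<le> B * 1" using B by (intro mult_left_mono) auto
      ultimately have "norm \<zeta> powr q * (1 + B * cos (q * \<phi>)) \<le> norm \<zeta> powr q * (A * cos \<phi> powr q)"
        by (intro mult_left_mono) auto
      also have "\<dots> = A * Re \<zeta> powr q"
        unfolding Re1 using \<open>cos \<gamma> \<le> cos \<phi>\<close> cospos by (simp add: powr_mult)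
      finally show ?thesis unfolding Req by (simp add: algebra_simps)
    qed
  qed
  show ?thesis by (rule that[OF A less_imp_le[OF B] pw])
qed

text \<open>The pointwise inequality is averaged over the circle; the mean of \<open>Re (G powr q)\<close> is its value at
  the centre, which is nonnegative.\<close>

lemma Riesz_mean:
  assumes q: "1 < q" "q < 2"
  shows "\<exists>A>0. \<forall>G z. G holomorphic_on ball 0 1 \<longrightarrow> G \<in> borel_measurable borel \<longrightarrow> (\<forall>w\<in>ball 0 1. 0 < Re (G w)) \<longrightarrow>
       Im (G 0) = 0 \<longrightarrow> z \<in> ball 0 1 \<longrightarrow>
       (\<integral>\<^sup>+u. ennreal (norm (G (z * u)) powr q) \<partial>circle) \<le> ennreal A * (\<integral>\<^sup>+u. ennreal (Re (G (z * u)) powr q) \<partial>circle)"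
proof -
  obtain A B :: real where AB: "0 < A" "0 \<le> B"
    and pw: "\<And>\<zeta>. 0 < Re \<zeta> \<Longrightarrow> norm \<zeta> powr q + B * Re (\<zeta> powr of_real q) \<le> A * Re \<zeta> powr q"
    using Riesz_pointwise[OF q] by metis
  show ?thesis
  proof (intro exI[of _ A] conjI AB(1) allI impI)
    fix G :: "complex \<Rightarrow> complex" and z :: complex
    assume G: "G holomorphic_on ball 0 1" and [measurable]: "G \<in> borel_measurable borel"
      and pos': "\<forall>w\<in>ball 0 1. 0 < Re (G w)" and real0: "Im (G 0) = 0" and z: "z \<in> ball 0 1"
    have pos: "0 < Re (G w)" if "w \<in> ball 0 1" for w using pos' that by blast
    let ?w = "\<lambda>t::real. z * cis (2 * pi * t)"
    have w: "?w t \<in> ball 0 1" for t using z by (simp add: norm_mult)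
    have cont: "continuous_on {0..1} (\<lambda>t. G (?w t))" by (rule continuous_on_circle[OF G z])
    have Gnz: "G (?w t) \<noteq> 0" for t using pos[OF w, of t] by auto
    have "continuous_on {0..1} (\<lambda>t. norm (G (?w t)) powr q)"
      using Gnz by (intro continuous_on_powr continuous_intros cont) auto
    then have i1: "((\<lambda>t. norm (G (?w t)) powr q) has_integral integral {0..1} (\<lambda>t. norm (G (?w t)) powr q)) {0..1}"
      by (intro integrable_integral integrable_continuous_interval)
    have "continuous_on {0..1} (\<lambda>t. Re (G (?w t)) powr q)"
      using less_imp_neq[OF pos[OF w]] by (intro continuous_on_powr continuous_intros cont) auto
    then have i3: "((\<lambda>t. Re (G (?w t)) powr q) has_integral integral {0..1} (\<lambda>t. Re (G (?w t)) powr q)) {0..1}"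
      by (intro integrable_integral integrable_continuous_interval)
    have "(\<lambda>w. G w powr of_real q) holomorphic_on ball 0 1"
      using pos by (intro holomorphic_intros G) (auto simp: complex_nonpos_Reals_iff not_le)
    from has_integral_linear[OF circle_mean_value[OF this z] bounded_linear_Re]
    have i2: "((\<lambda>t. Re (G (?w t) powr of_real q)) has_integral Re (G 0 powr of_real q)) {0..1}"
      by (simp add: o_def)
    have G0: "0 \<le> Re (G 0 powr of_real q)"
    proof -
      obtain x where x: "G 0 = of_real x" "0 < x"
        using real0 pos[of 0] by (intro that[of "Re (G 0)"]) (auto simp: complex_eq_iff)
      then have "G 0 powr of_real q = of_real (x powr q)" by (simp add: powr_of_real)
      then show ?thesis by simp
    qed
    have "integral {0..1} (\<lambda>t. norm (G (?w t)) powr q) + B * Re (G 0 powr of_real q)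
        \<le> A * integral {0..1} (\<lambda>t. Re (G (?w t)) powr q)"
      using has_integral_add[OF i1 has_integral_mult_right[OF i2, of B]] has_integral_mult_right[OF i3, of A]
      by (rule has_integral_le) (rule pw[OF pos[OF w]])
    moreover have "0 \<le> B * Re (G 0 powr of_real q)" using AB G0 by simp
    ultimately have le: "integral {0..1} (\<lambda>t. norm (G (?w t)) powr q) \<le> A * integral {0..1} (\<lambda>t. Re (G (?w t)) powr q)"
      by linarith
    have "(\<integral>\<^sup>+u. ennreal (norm (G (z * u)) powr q) \<partial>circle) = ennreal (integral {0..1} (\<lambda>t. norm (G (?w t)) powr q))"
      by (rule nn_integral_circle_eq[OF _ _ z i1]) auto
    moreover have "(\<integral>\<^sup>+u. ennreal (Re (G (z * u)) powr q) \<partial>circle) = ennreal (integral {0..1} (\<lambda>t. Re (G (?w t)) powr q))"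
      by (rule nn_integral_circle_eq[OF _ _ z i3]) auto
    ultimately show "(\<integral>\<^sup>+u. ennreal (norm (G (z * u)) powr q) \<partial>circle) \<le> ennreal A * (\<integral>\<^sup>+u. ennreal (Re (G (z * u)) powr q) \<partial>circle)"
      using le AB(1) has_integral_nonneg[OF i3] by (simp add: ennreal_mult[symmetric] ennreal_leI)
  qed
qed

section \<open>Convergence and holomorphy of Cauchy transforms\<close>

lemma Re_inverse_pos: "0 < Re x \<Longrightarrow> 0 < Re (1 / x)"
  by (simp add: Re_divide add_pos_nonneg)

lemma norm_one_minus_mult_cnj_ge:
  fixes z w :: complex
  assumes "w \<in> ball 0 1"
  shows "1 - norm z \<le> norm (1 - z * cnj w)"
proof -
  have "norm (z * cnj w) \<le> norm z * 1"
    unfolding norm_mult complex_mod_cnj using assms by (intro mult_left_mono) auto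
  then show ?thesis using norm_triangle_ineq2[of 1 "z * cnj w"] by simp
qed

text \<open>For fixed \<open>z\<close> the Cauchy kernel is bounded by
  \<open>1 / (1 - norm z)\<close>, so convergence holds at every point of the disc.\<close>

lemma integrable_Cauchy_transform:
  fixes h :: "complex \<Rightarrow> complex"
  assumes h: "integrable disc_area h" and z: "z \<in> ball 0 1"
  shows "integrable disc_area (\<lambda>w. h w / (1 - z * cnj w))"
proof (rule Bochner_Integration.integrable_bound)
  show "integrable disc_area (\<lambda>w. h w / of_real (1 - norm z))" using h by simp
  have [measurable]: "h \<in> borel_measurable disc_area" using h by simp
  have "(\<lambda>w. 1 - z * cnj w) \<in> borel_measurable disc_area"
    by (intro measurable_disc_area_borel borel_measurable_continuous_onI continuous_intros)
  then show "(\<lambda>w. h w / (1 - z * cnj w)) \<in> borel_measurable disc_area" by measurable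
  show "AE w in disc_area. norm (h w / (1 - z * cnj w)) \<le> norm (h w / of_real (1 - norm z))"
    using AE_space
  proof eventually_elim
    fix w assume "w \<in> space disc_area"
    then have "norm (h w) / norm (1 - z * cnj w) \<le> norm (h w) / (1 - norm z)"
      using z norm_one_minus_mult_cnj_ge[of w z] by (intro divide_left_mono mult_pos_pos) (auto intro: less_le_trans)
    then show "norm (h w / (1 - z * cnj w)) \<le> norm (h w / of_real (1 - norm z))"
      using z by (simp add: norm_divide del: of_real_diff)
  qed
qed

text \<open>The geometric series of the kernel may be integrated term by term, being dominated by
  \<open>norm (h w) * norm z ^ n\<close>; this exhibits the transform as a power series.\<close>

lemma Cauchy_transform_holomorphic:
  fixes h :: "complex \<Rightarrow> complex"
  assumes h: "integrable disc_area h"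
  shows "(\<lambda>z. \<integral>w. h w / (1 - z * cnj w) \<partial>disc_area) holomorphic_on ball 0 1"
proof (rule power_series_holomorphic)
  fix z :: complex assume z: "z \<in> ball 0 1"
  have [measurable]: "h \<in> borel_measurable disc_area" using h by simp
  have cnj_meas: "(\<lambda>w. (z * cnj w) ^ n) \<in> borel_measurable disc_area" for n
    by (intro measurable_disc_area_borel borel_measurable_continuous_onI continuous_intros)
  have bd: "norm (h w * (z * cnj w) ^ n) \<le> norm (h w * of_real (norm z ^ n))" if "w \<in> ball 0 1" for w n
  proof -
    have "norm (z * cnj w) \<le> norm z * 1"
      unfolding norm_mult complex_mod_cnj using that by (intro mult_left_mono) auto
    then show ?thesis by (simp add: norm_mult norm_power power_mono mult_left_mono)
  qed
  have int: "integrable disc_area (\<lambda>w. h w * (z * cnj w) ^ n)" for n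
  proof (rule Bochner_Integration.integrable_bound)
    show "integrable disc_area (\<lambda>w. h w * of_real (norm z ^ n))" using h by simp
    show "(\<lambda>w. h w * (z * cnj w) ^ n) \<in> borel_measurable disc_area" using cnj_meas by measurable
    show "AE w in disc_area. norm (h w * (z * cnj w) ^ n) \<le> norm (h w * of_real (norm z ^ n))"
      using AE_space by eventually_elim (rule bd, simp)
  qed
  have lt: "norm (z * cnj w) < 1" if "w \<in> ball 0 1" for w
    using norm_one_minus_mult_cnj_ge that z mult_strict_mono'[of "norm z" 1 "norm w" 1] by (simp add: norm_mult)
  have "(\<lambda>n. \<integral>w. h w * (z * cnj w) ^ n \<partial>disc_area) sums (\<integral>w. (\<Sum>n. h w * (z * cnj w) ^ n) \<partial>disc_area)"
  proof (rule sums_integral[OF int])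
    show "AE w in disc_area. summable (\<lambda>n. norm (h w * (z * cnj w) ^ n))"
      using AE_space
    proof eventually_elim
      fix w assume "w \<in> space disc_area"
      then show "summable (\<lambda>n. norm (h w * (z * cnj w) ^ n))"
        unfolding norm_mult[of "h w"] norm_power using lt[of w] by (intro summable_mult summable_geometric) simp
    qed
    show "summable (\<lambda>n. \<integral>w. norm (h w * (z * cnj w) ^ n) \<partial>disc_area)"
    proof (rule summable_comparison_test')
      show "summable (\<lambda>n. (\<integral>w. norm (h w) \<partial>disc_area) * norm z ^ n)"
        using z by (intro summable_mult summable_geometric) simp
      fix n
      have "(\<integral>w. norm (h w * (z * cnj w) ^ n) \<partial>disc_area) \<le> (\<integral>w. norm (h w) * norm z ^ n \<partial>disc_area)"
      proof (rule integral_mono)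
        show "integrable disc_area (\<lambda>w. norm (h w * (z * cnj w) ^ n))" by (rule integrable_norm[OF int])
        show "integrable disc_area (\<lambda>w. norm (h w) * norm z ^ n)" using h by simp
      qed (use bd[of _ n] in \<open>simp add: norm_mult norm_power\<close>)
      then show "norm (\<integral>w. norm (h w * (z * cnj w) ^ n) \<partial>disc_area) \<le> (\<integral>w. norm (h w) \<partial>disc_area) * norm z ^ n"
        by simp
    qed
  qed
  moreover have "(\<integral>w. h w * (z * cnj w) ^ n \<partial>disc_area) = (\<integral>w. h w * cnj w ^ n \<partial>disc_area) * (z - 0) ^ n" for n
  proof -
    have "h w * (z * cnj w) ^ n = h w * cnj w ^ n * z ^ n" for w
      by (simp add: power_mult_distrib mult_ac)
    then show ?thesis by (simp only: integral_mult_left_zero diff_zero)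
  qed
  moreover have "(\<integral>w. (\<Sum>n. h w * (z * cnj w) ^ n) \<partial>disc_area) = (\<integral>w. h w / (1 - z * cnj w) \<partial>disc_area)"
  proof (rule Bochner_Integration.integral_cong[OF refl])
    fix w assume "w \<in> space disc_area"
    then have "norm (z * cnj w) < 1" using lt by simp
    then show "(\<Sum>n. h w * (z * cnj w) ^ n) = h w / (1 - z * cnj w)"
      by (subst suminf_mult) (auto simp: suminf_geometric summable_geometric)
  qed
  ultimately show "(\<lambda>n. (\<integral>w. h w * cnj w ^ n \<partial>disc_area) * (z - 0) ^ n) sums (\<integral>w. h w / (1 - z * cnj w) \<partial>disc_area)"
    by simp
qed

section \<open>The concrete kernels with bounded circular means\<close>

lemma measurable_one_minus_mult_cnj [measurable]:
  "case_prod (\<lambda>z w. 1 - z * cnj w) \<in> borel_measurable (borel \<Otimes>\<^sub>M borel)"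
  unfolding borel_prod split_beta' by (intro borel_measurable_continuous_onI continuous_intros)

text \<open>Exchanging \<open>z\<close> and \<open>w\<close> conjugates the kernel and leaves its
  real part unchanged, so one mean estimate serves both variables.\<close>

lemma circle_kernel_Cauchy: "circle_kernel (\<lambda>z w. ennreal (Re (1 / (1 - z * cnj w)))) 1"
proof
  show "(\<lambda>(z, w). ennreal (Re (1 / (1 - z * cnj w)))) \<in> borel_measurable (borel \<Otimes>\<^sub>M borel)"
    using measurable_one_minus_mult_cnj unfolding split_beta' by measurable
  fix z w :: complex assume zw: "z \<in> ball 0 1" "w \<in> ball 0 1"
  show "(\<integral>\<^sup>+u. ennreal (Re (1 / (1 - z * u * cnj w))) \<partial>circle) \<le> ennreal 1"
    using Re_inverse_one_minus_mean[OF zw] by simp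
  have eq: "Re (1 / (1 - z * cnj v)) = Re (1 / (1 - v * cnj z))" for v
  proof -
    have "cnj (1 / (1 - z * cnj v)) = 1 / (1 - v * cnj z)" by (simp add: mult.commute)
    then show ?thesis by (metis cnj.simps(1))
  qed
  show "(\<integral>\<^sup>+u. ennreal (Re (1 / (1 - z * cnj (w * u)))) \<partial>circle) \<le> ennreal 1"
    using Re_inverse_one_minus_mean[OF zw(2,1)] by (simp only: eq ennreal_1)
qed simp

text \<open>The trivial kernel serves to extract plain integrability of the weighted function from
  the general finiteness result.\<close>

lemma circle_kernel_one: "circle_kernel (\<lambda>_ _. 1) 1"
  by standard (auto simp: circ.emeasure_space_1[simplified])

lemma circle_kernel_powr:
  assumes "0 \<le> k" "k < 1"
  shows "circle_kernel (\<lambda>z w. ennreal (norm (1 - z * cnj w) powr - k)) (1 / cos (k * pi / 2))"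
proof
  show "(\<lambda>(z, w). ennreal (norm (1 - z * cnj w) powr - k)) \<in> borel_measurable (borel \<Otimes>\<^sub>M borel)"
    using measurable_one_minus_mult_cnj unfolding split_beta' by measurable
  have "k * pi / 2 < pi / 2" using assms by simp
  moreover have "- (pi / 2) < k * pi / 2" using assms pi_gt_zero mult_nonneg_nonneg[of k pi] by linarith
  ultimately show "0 < 1 / cos (k * pi / 2)" using cos_gt_zero_pi by simp
  fix z w :: complex assume zw: "z \<in> ball 0 1" "w \<in> ball 0 1"
  show "(\<integral>\<^sup>+u. ennreal (norm (1 - z * u * cnj w) powr - k) \<partial>circle) \<le> ennreal (1 / cos (k * pi / 2))"
    by (rule norm_one_minus_powr_mean[OF zw assms])
  have eq: "norm (1 - z * cnj v) = norm (1 - v * cnj z)" for v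
  proof -
    have "cnj (1 - z * cnj v) = 1 - v * cnj z" by (simp add: mult.commute)
    then show ?thesis by (metis complex_mod_cnj)
  qed
  show "(\<integral>\<^sup>+u. ennreal (norm (1 - z * cnj (w * u)) powr - k) \<partial>circle) \<le> ennreal (1 / cos (k * pi / 2))"
    using norm_one_minus_powr_mean[OF zw(2,1) assms] by (simp only: eq)
qed

text \<open>With the kernel \<open>1\<close> the weighted integral does not depend on
  \<open>z\<close>, so finiteness almost everywhere is finiteness.\<close>

lemma integrable_defect_powr_mult:
  fixes g :: "complex \<Rightarrow> real"
  assumes g [measurable]: "g \<in> borel_measurable disc_area" and g0: "\<And>w. 0 \<le> g w"
    and \<beta>: "0 < \<beta>" "\<beta> < 1" and n: "0 < n" "lorentz_integral \<beta> g \<le> ennreal n"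
  shows "integrable disc_area (\<lambda>w. defect w powr (\<beta> - 1) * g w)"
proof -
  have "AE z::complex in disc_area. (\<integral>\<^sup>+w. ennreal (defect w powr (\<beta> - 1) * g w) \<partial>disc_area) < \<infinity>"
    using circle_kernel.AE_weighted_integral_finite[OF circle_kernel_one g g0 \<beta> n]
    by (simp add: weighted_integral_def)
  then have "(\<integral>\<^sup>+w. ennreal (defect w powr (\<beta> - 1) * g w) \<partial>disc_area) < \<infinity>"
    using disc.AE_const by simp
  moreover have "(\<lambda>w. defect w powr (\<beta> - 1) * g w) \<in> borel_measurable disc_area" by measurable
  ultimately show ?thesis using g0 by (intro integrableI_bounded) auto
qed


text \<open>For nonnegative \<open>g\<close> the transform has positive real part, since \<open>Re (1 / (1 - \<zeta>)) > 0\<close> on the disc;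
  so the Riesz inequality reduces the bound to the positive kernel \<open>Re (1 / (1 - z * cnj w))\<close>.\<close>

lemma Cauchy_transform_circle_means:
  assumes \<beta>: "0 < \<beta>" "\<beta> < 1" and q: "1 < q" "q < 2" "q * \<beta> < 1"
  obtains C where "0 < C"
    "\<And>g n z. g \<in> borel_measurable disc_area \<Longrightarrow> (\<And>w. 0 \<le> g w) \<Longrightarrow> 0 < n \<Longrightarrow> lorentz_integral \<beta> g \<le> ennreal n \<Longrightarrow>
      z \<in> ball 0 1 \<Longrightarrow>
      (\<integral>\<^sup>+u. ennreal (norm (\<integral>w. of_real (defect w powr (\<beta> - 1) * g w) / (1 - z * u * cnj w) \<partial>disc_area) powr q) \<partial>circle)
        \<le> ennreal (C * n powr q)"
proof -
  obtain A :: real where A: "0 < A" and Riesz: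
    "\<forall>G z. G holomorphic_on ball 0 1 \<longrightarrow> G \<in> borel_measurable borel \<longrightarrow> (\<forall>w\<in>ball 0 1. 0 < Re (G w)) \<longrightarrow>
       Im (G 0) = 0 \<longrightarrow> z \<in> ball 0 1 \<longrightarrow>
       (\<integral>\<^sup>+u. ennreal (norm (G (z * u)) powr q) \<partial>circle) \<le> ennreal A * (\<integral>\<^sup>+u. ennreal (Re (G (z * u)) powr q) \<partial>circle)"
    using Riesz_mean[OF q(1,2)] by (elim exE conjE)
  define A0 where "A0 = (1 - \<beta>) * q / (q - 1) - 1"
  have A0: "0 < A0" using q by (simp add: A0_def field_simps)
  define C where "C = 2 powr q * ((1 / \<beta>) powr q + (1 / A0) powr (q - 1) * 1)"
  have C: "0 < C" using \<beta> A0 by (simp add: C_def add_pos_pos)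
  show ?thesis
  proof (rule that[of "A * C"])
    show "0 < A * C" using A C by simp
  next
    fix g :: "complex \<Rightarrow> real" and n :: real and z :: complex
    assume g [measurable]: "g \<in> borel_measurable disc_area" and g0: "\<And>w. 0 \<le> g w"
      and n: "0 < n" "lorentz_integral \<beta> g \<le> ennreal n" and z: "z \<in> ball 0 1"
    define h where "h w = defect w powr (\<beta> - 1) * g w" for w
    have h0: "0 \<le> h w" for w using g0 by (simp add: h_def)
    have h: "integrable disc_area h"
      unfolding h_def by (rule integrable_defect_powr_mult[OF g g0 \<beta> n])
    define G where "G v = (\<integral>w. of_real (h w) / (1 - v * cnj w) \<partial>disc_area)" for v
    have hol: "G holomorphic_on ball 0 1"
      unfolding G_def using h by (intro Cauchy_transform_holomorphic) simp
    have "case_prod (\<lambda>v w. 1 / (1 - v * cnj w)) \<in> borel_measurable (borel \<Otimes>\<^sub>M borel)"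
      using measurable_one_minus_mult_cnj unfolding split_beta' by measurable
    moreover have "(\<lambda>w. of_real (h w) :: complex) \<in> borel_measurable disc_area"
      using borel_measurable_integrable[OF h] by measurable
    ultimately have meas: "G \<in> borel_measurable borel"
      unfolding G_def using measurable_kernel_integral[of "\<lambda>v w. 1 / (1 - v * cnj w)" "\<lambda>w. of_real (h w)"] by simp
    have ReG: "Re (G v) = (\<integral>w. h w * Re (1 / (1 - v * cnj w)) \<partial>disc_area)"
      and intRe: "integrable disc_area (\<lambda>w. h w * Re (1 / (1 - v * cnj w)))" if v: "v \<in> ball 0 1" for v
    proof -
      have i: "integrable disc_area (\<lambda>w. of_real (h w) / (1 - v * cnj w))"
        using h v by (intro integrable_Cauchy_transform) auto
      have eq: "Re (of_real (h w) / (1 - v * cnj w)) = h w * Re (1 / (1 - v * cnj w))" for w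
        by (simp add: Re_divide)
      show "Re (G v) = (\<integral>w. h w * Re (1 / (1 - v * cnj w)) \<partial>disc_area)"
        unfolding G_def integral_Re[OF i, symmetric] eq ..
      show "integrable disc_area (\<lambda>w. h w * Re (1 / (1 - v * cnj w)))"
        using integrable_Re[OF i] unfolding eq .
    qed
    have Re0: "0 < Re (1 / (1 - v * cnj w))" if "v \<in> ball 0 1" "w \<in> ball 0 1" for v w
      by (rule Re_inverse_pos[OF one_minus_mult_cnj_Re_pos[OF that]])
    show "(\<integral>\<^sup>+u. ennreal (norm (\<integral>w. of_real (defect w powr (\<beta> - 1) * g w) / (1 - z * u * cnj w) \<partial>disc_area) powr q) \<partial>circle)
        \<le> ennreal (A * C * n powr q)"
      unfolding h_def[symmetric] G_def[symmetric]
    \<comment> \<open>The Riesz inequality asks for a strictly positive real part, which holds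
      unless \<open>h\<close> vanishes almost everywhere.\<close>
    proof (cases "AE w in disc_area. h w = 0")
      case True
      have "G v = 0" for v
      proof -
        have "G v = (\<integral>w. 0 \<partial>disc_area)"
          unfolding G_def
        proof (rule integral_cong_AE)
          show "AE w in disc_area. of_real (h w) / (1 - v * cnj w) = 0"
            using True by eventually_elim simp
          have "(\<lambda>w. 1 - v * cnj w) \<in> borel_measurable disc_area"
            by (intro measurable_disc_area_borel borel_measurable_continuous_onI continuous_intros)
          moreover have "(\<lambda>w. of_real (h w) :: complex) \<in> borel_measurable disc_area"
            using borel_measurable_integrable[OF h] by measurable
          ultimately show "(\<lambda>w. of_real (h w) / (1 - v * cnj w)) \<in> borel_measurable disc_area"
            by (intro borel_measurable_divide)
        qed simp
        then show ?thesis by simp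
      qed
      then show "(\<integral>\<^sup>+u. ennreal (norm (G (z * u)) powr q) \<partial>circle) \<le> ennreal (A * C * n powr q)" by simp
    next
      case False
      have pos: "0 < Re (G v)" if v: "v \<in> ball 0 1" for v
      proof (rule ccontr)
        assume "\<not> 0 < Re (G v)"
        moreover have nn: "AE w in disc_area. 0 \<le> h w * Re (1 / (1 - v * cnj w))"
          using AE_space by eventually_elim (use Re0[OF v] h0 in \<open>simp add: less_imp_le\<close>)
        ultimately have "(\<integral>w. h w * Re (1 / (1 - v * cnj w)) \<partial>disc_area) = 0"
          using integral_nonneg_AE[OF nn] ReG[OF v] by linarith
        then have "AE w in disc_area. h w * Re (1 / (1 - v * cnj w)) = 0"
          using integral_nonneg_eq_0_iff_AE[OF intRe[OF v] nn] by simp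
        from this AE_space have "AE w in disc_area. h w = 0"
        proof eventually_elim
          fix w assume "h w * Re (1 / (1 - v * cnj w)) = 0" "w \<in> space disc_area"
          with Re0[OF v, of w] show "h w = 0" by auto
        qed
        with False show False by simp
      qed
      \<comment> \<open>At the centre the Cauchy kernel is \<open>1\<close>, so the value is real,
        as the Riesz inequality demands.\<close>
      have "G 0 = of_real (\<integral>w. h w \<partial>disc_area)" unfolding G_def by simp
      then have Im0: "Im (G 0) = 0" by simp
      obtain Y where Y [measurable]: "Y \<in> borel_measurable borel" and
        Y_mean: "\<And>z. z \<in> ball 0 1 \<Longrightarrow> (\<integral>\<^sup>+u. Y (z * u) \<partial>circle) \<le> ennreal (C * n powr q)" and
        Y_ge: "\<And>z r. z \<in> ball 0 1 \<Longrightarrow> 0 \<le> r \<Longrightarrow> ennreal r \<le> weighted_integral \<beta> (\<lambda>z w. ennreal (Re (1 / (1 - z * cnj w)))) g z \<Longrightarrow> ennreal (r powr q) \<le> Y z"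
        using circle_kernel.weighted_integral_majorant[OF circle_kernel_Cauchy g g0 \<beta> q(1,3) n A0_def C_def] by blast
      have "ennreal (Re (G v) powr q) \<le> Y v" if v: "v \<in> ball 0 1" for v
      proof (rule Y_ge[OF v])
        show "0 \<le> Re (G v)" using pos[OF v] by simp
        have "ennreal (Re (G v)) = (\<integral>\<^sup>+w. ennreal (h w * Re (1 / (1 - v * cnj w))) \<partial>disc_area)"
          unfolding ReG[OF v]
        proof (rule nn_integral_eq_integral[OF intRe[OF v], symmetric])
          show "AE w in disc_area. 0 \<le> h w * Re (1 / (1 - v * cnj w))"
            using AE_space by eventually_elim (use Re0[OF v] h0 in \<open>simp add: less_imp_le\<close>)
        qed
        also have "\<dots> = weighted_integral \<beta> (\<lambda>z w. ennreal (Re (1 / (1 - z * cnj w)))) g v"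
          unfolding weighted_integral_def h_def
        proof (rule nn_integral_cong)
          fix w assume "w \<in> space disc_area"
          then have "0 < Re (1 / (1 - v * cnj w))" using Re0[OF v] by simp
          then show "ennreal (defect w powr (\<beta> - 1) * g w * Re (1 / (1 - v * cnj w)))
            = ennreal (defect w powr (\<beta> - 1) * g w) * ennreal (Re (1 / (1 - v * cnj w)))"
            using g0 by (intro ennreal_mult) auto
        qed
        finally show "ennreal (Re (G v)) \<le> weighted_integral \<beta> (\<lambda>z w. ennreal (Re (1 / (1 - z * cnj w)))) g v" by simp
      qed
      then have "(\<integral>\<^sup>+u. ennreal (Re (G (z * u)) powr q) \<partial>circle) \<le> (\<integral>\<^sup>+u. Y (z * u) \<partial>circle)"
        using z by (intro nn_integral_mono_AE, use AE_circle in eventually_elim) (simp add: norm_mult)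
      also have "\<dots> \<le> ennreal (C * n powr q)" by (rule Y_mean[OF z])
      finally have "ennreal A * (\<integral>\<^sup>+u. ennreal (Re (G (z * u)) powr q) \<partial>circle) \<le> ennreal A * ennreal (C * n powr q)"
        by (rule mult_left_mono) simp
      also have "\<dots> = ennreal (A * C * n powr q)" using A C by (simp add: ennreal_mult[symmetric] mult.assoc)
      finally have "ennreal A * (\<integral>\<^sup>+u. ennreal (Re (G (z * u)) powr q) \<partial>circle) \<le> ennreal (A * C * n powr q)" .
      moreover have "(\<integral>\<^sup>+u. ennreal (norm (G (z * u)) powr q) \<partial>circle) \<le> ennreal A * (\<integral>\<^sup>+u. ennreal (Re (G (z * u)) powr q) \<partial>circle)"
        by (rule Riesz[rule_format]) (use hol meas pos Im0 z in auto)
      ultimately show "(\<integral>\<^sup>+u. ennreal (norm (G (z * u)) powr q) \<partial>circle) \<le> ennreal (A * C * n powr q)"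
        by (rule order_trans[rotated])
    qed
  qed
qed

subsection \<open>Boundedness of the operators\<close>

lemma measurable_T_kernel: "case_prod (T_kernel b c) \<in> borel_measurable (borel \<Otimes>\<^sub>M borel)"
proof -
  have [measurable]: "(\<lambda>x. 1 - fst x * cnj (snd x)) \<in> borel_measurable (borel \<Otimes>\<^sub>M borel)"
    using measurable_one_minus_mult_cnj by (simp add: split_beta')
  show ?thesis unfolding T_kernel_def split_beta' powr_def by measurable
qed

lemma measurable_S_kernel: "case_prod (S_kernel b c) \<in> borel_measurable (borel \<Otimes>\<^sub>M borel)"
proof -
  have [measurable]: "(\<lambda>x. 1 - fst x * cnj (snd x)) \<in> borel_measurable (borel \<Otimes>\<^sub>M borel)"
    using measurable_one_minus_mult_cnj by (simp add: split_beta')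
  show ?thesis unfolding S_kernel_def split_beta' by measurable
qed

lemma norm_T_kernel: "norm (T_kernel b c z w) = defect w powr b * norm (1 - z * cnj w) powr - c"
  by (simp add: T_kernel_def norm_divide norm_powr_real_powr' powr_minus_divide)

lemma norm_S_kernel: "norm (S_kernel b c z w) = defect w powr b * norm (1 - z * cnj w) powr - c"
  by (simp add: S_kernel_def norm_divide powr_minus_divide)

text \<open>As \<open>defect w \<le> 2 * norm (1 - z * cnj w)\<close>, a factor
  \<open>defect w powr \<epsilon>\<close> pays for
  \<open>norm (1 - z * cnj w) powr - \<epsilon>\<close>, so the pair \<open>(b, c)\<close> may be
  replaced by \<open>(b - \<epsilon>, c - \<epsilon>)\<close>. The endpoint for \<open>c < 1\<close>
  uses \<open>\<epsilon> = 0\<close>; Lebesgue spaces strictly inside the range leave room for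
  \<open>\<epsilon> > 0\<close>, which also brings \<open>c = 1\<close> below
  \<open>1\<close>.\<close>

lemma maps_boundedly_of_powr_kernel:
  assumes k: "case_prod k \<in> borel_measurable (borel \<Otimes>\<^sub>M borel)"
    and norm_k: "\<And>z w. norm (k z w) = defect w powr b * norm (1 - z * cnj w) powr - c"
    and \<epsilon>: "0 \<le> \<epsilon>" and c: "\<epsilon> \<le> c" "c - \<epsilon> < 1" and b: "\<epsilon> < b + 1" "b - \<epsilon> < 0" and D: "0 \<le> D"
    and NX: "\<And>f. f \<in> borel_measurable disc_area \<Longrightarrow> lorentz_integral (b + 1 - \<epsilon>) (\<lambda>w. norm (f w)) \<le> ennreal D * NX f"
  shows "maps_boundedly (-1) k NX weak_L1_norm"
proof (rule circle_kernel.maps_boundedly_of_dominated[OF circle_kernel_powr[of "c - \<epsilon>"] k _ _ D _ NX])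
  show "0 \<le> c - \<epsilon>" "c - \<epsilon> < 1" "0 < b + 1 - \<epsilon>" "b + 1 - \<epsilon> < 1" using \<epsilon> c b by auto
  show "0 < 2 powr \<epsilon>" by simp
  fix z w :: complex assume zw: "z \<in> ball 0 1" "w \<in> ball 0 1"
  let ?y = "norm (1 - z * cnj w)"
  have y: "0 < ?y" using one_minus_mult_cnj_nonzero[OF zw] by simp
  have d: "0 < defect w" using defect_pos[OF zw(2)] .
  have "defect w = (1 - norm w) * (1 + norm w)" by (simp add: power2_eq_square algebra_simps)
  also have "\<dots> \<le> (1 - norm w) * 2" using zw by (intro mult_left_mono) auto
  also have "1 - norm w \<le> ?y"
  proof -
    have "norm (z * cnj w) \<le> 1 * norm w"
      unfolding norm_mult complex_mod_cnj using zw by (intro mult_right_mono) auto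
    then show ?thesis using norm_triangle_ineq2[of 1 "z * cnj w"] by simp
  qed
  finally have "defect w \<le> 2 * ?y" by simp
  then have "defect w powr \<epsilon> \<le> (2 * ?y) powr \<epsilon>" using d \<epsilon> by (intro powr_mono2) auto
  then have "defect w powr \<epsilon> * ?y powr - \<epsilon> \<le> 2 powr \<epsilon> * ?y powr \<epsilon> * ?y powr - \<epsilon>"
    by (intro mult_right_mono) (auto simp: powr_mult)
  also have "\<dots> = 2 powr \<epsilon>" using y by (simp add: mult.assoc powr_add[symmetric])
  finally have le: "defect w powr \<epsilon> * ?y powr - \<epsilon> \<le> 2 powr \<epsilon>" .
  have "norm (k z w) = (defect w powr \<epsilon> * ?y powr - \<epsilon>) * (defect w powr (b - \<epsilon>) * ?y powr - (c - \<epsilon>))"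
    using y d unfolding norm_k by (simp add: powr_diff powr_minus field_simps)
  also have "\<dots> \<le> 2 powr \<epsilon> * (defect w powr (b - \<epsilon>) * ?y powr - (c - \<epsilon>))"
    by (intro mult_right_mono le) auto
  finally show "ennreal (norm (k z w)) \<le> ennreal (2 powr \<epsilon> * defect w powr (b + 1 - \<epsilon> - 1)) * ennreal (?y powr - (c - \<epsilon>))"
    by (simp add: ennreal_mult[symmetric] ennreal_leI mult.assoc)
qed

lemma sum_powr_le:
  fixes x :: "nat \<Rightarrow> real"
  assumes "\<And>j. 0 \<le> x j" "0 \<le> q"
  shows "(\<Sum>j<m. x j) powr q \<le> real m powr q * (\<Sum>j<m. x j powr q)"
proof (cases "m = 0")
  case False
  then have "Max (x ` {..<m}) \<in> x ` {..<m}" by (intro Max_in) auto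
  then obtain i where i: "i < m" "x i = Max (x ` {..<m})" by force
  have "(\<Sum>j<m. x j) \<le> (\<Sum>j<m. x i)" using i by (intro sum_mono) auto
  then have "(\<Sum>j<m. x j) powr q \<le> (real m * x i) powr q"
    using assms by (intro powr_mono2) (auto intro: sum_nonneg)
  also have "\<dots> = real m powr q * x i powr q" using assms by (simp add: powr_mult)
  also have "\<dots> \<le> real m powr q * (\<Sum>j<m. x j powr q)"
    using i by (intro mult_left_mono member_le_sum[of i _ "\<lambda>j. x j powr q"]) auto
  finally show ?thesis .
qed simp

lemma T_kernel_maps_boundedly:
  assumes \<beta>: "0 < \<beta>" "\<beta> < 1" and D: "0 \<le> D"
    and NX: "\<And>f. f \<in> borel_measurable disc_area \<Longrightarrow> lorentz_integral \<beta> (\<lambda>w. norm (f w)) \<le> ennreal D * NX f"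
  shows "maps_boundedly (-1) (T_kernel (\<beta> - 1) 1) NX weak_L1_norm"
proof -
  \<comment> \<open>The bound \<open>2\<close> is for the Riesz inequality,
    \<open>1 / \<beta>\<close> for the Hoelder step.\<close>
  obtain q where q: "1 < q" "q < min 2 (1 / \<beta>)" using dense[of 1 "min 2 (1 / \<beta>)"] \<beta> by auto
  then have q\<beta>: "q * \<beta> < 1" and q2: "q < 2" using \<beta> by (auto simp: field_simps)
  obtain C where C: "0 < C" and means:
    "\<And>g n z. g \<in> borel_measurable disc_area \<Longrightarrow> (\<And>w. 0 \<le> g w) \<Longrightarrow> 0 < n \<Longrightarrow> lorentz_integral \<beta> g \<le> ennreal n \<Longrightarrow>
      z \<in> ball 0 1 \<Longrightarrow>
      (\<integral>\<^sup>+u. ennreal (norm (\<integral>w. of_real (defect w powr (\<beta> - 1) * g w) / (1 - z * u * cnj w) \<partial>disc_area) powr q) \<partial>circle)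
        \<le> ennreal (C * n powr q)"
    using Cauchy_transform_circle_means[OF \<beta> q(1) q2 q\<beta>] by blast
  have T_eq: "T_kernel (\<beta> - 1) 1 z w = of_real (defect w powr (\<beta> - 1)) / (1 - z * cnj w)" for z w
    by (simp add: T_kernel_def powr_def)
  \<comment> \<open>For \<open>j = 0, 1, 2, 3\<close> these are the positive parts of
    \<open>Re f\<close>, \<open>Im f\<close>, \<open>- Re f\<close> and \<open>- Im f\<close>, each
    at most \<open>norm (f w)\<close>.\<close>
  define g where "g f j w = max 0 (Re (f w / \<i> ^ j))" for f :: "complex \<Rightarrow> complex" and j :: nat and w
  have g0: "0 \<le> g f j w" for f j w by (simp add: g_def)
  have g_meas: "g f j \<in> borel_measurable disc_area" if [measurable]: "f \<in> borel_measurable disc_area" for f j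
    unfolding g_def by measurable
  have g_le: "g f j w \<le> norm (f w)" for f j w
    using complex_Re_le_cmod[of "f w / \<i> ^ j"] by (simp add: g_def norm_divide norm_power)
  have f_eq: "f w = (\<Sum>j<4. \<i> ^ j * of_real (g f j w))" for f w
    by (simp add: g_def numeral_eq_Suc complex_eq_iff max_def Re_divide power2_eq_square)
  define G where "G f j z = (\<integral>w. of_real (defect w powr (\<beta> - 1) * g f j w) / (1 - z * cnj w) \<partial>disc_area)" for f j z
  have int_g: "integrable disc_area (\<lambda>w. of_real (defect w powr (\<beta> - 1) * g f j w) / (1 - z * cnj w))"
    and g_lor: "lorentz_integral \<beta> (g f j) \<le> ennreal n"
    if f: "f \<in> borel_measurable disc_area" and n: "0 < n" "lorentz_integral \<beta> (\<lambda>w. norm (f w)) \<le> ennreal n" and z: "z \<in> ball 0 1" for f j n z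
  proof -
    have "lorentz_integral \<beta> (g f j) \<le> lorentz_integral \<beta> (\<lambda>w. norm (f w))"
      using f \<beta> g_le by (intro lorentz_integral_mono) auto
    with n show 1: "lorentz_integral \<beta> (g f j) \<le> ennreal n" by (auto intro: order_trans)
    show "integrable disc_area (\<lambda>w. of_real (defect w powr (\<beta> - 1) * g f j w) / (1 - z * cnj w))"
      using integrable_defect_powr_mult[OF g_meas[OF f] g0 \<beta> n(1) 1] z
      by (intro integrable_Cauchy_transform integrable_of_real) auto
  qed
  have decomp: "T_kernel (\<beta> - 1) 1 z w * f w = (\<Sum>j<4. \<i> ^ j * (of_real (defect w powr (\<beta> - 1) * g f j w) / (1 - z * cnj w)))" for f z w
    unfolding T_eq by (subst f_eq) (simp add: sum_distrib_left sum_divide_distrib mult_ac)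
  have G_meas: "G f j \<in> borel_measurable borel" if f: "f \<in> borel_measurable disc_area" for f j
  proof -
    have "case_prod (\<lambda>z w. of_real (defect w powr (\<beta> - 1)) / (1 - z * cnj w)) \<in> borel_measurable (borel \<Otimes>\<^sub>M borel)"
      using measurable_T_kernel[of "\<beta> - 1" 1] unfolding T_eq .
    moreover have "(\<lambda>w. of_real (g f j w) :: complex) \<in> borel_measurable disc_area"
      using g_meas[OF f, of j] by measurable
    ultimately show ?thesis
      unfolding G_def
      using measurable_kernel_integral[of "\<lambda>z w. of_real (defect w powr (\<beta> - 1)) / (1 - z * cnj w)" "\<lambda>w. of_real (g f j w)"]
      by simp
  qed
  show ?thesis
  proof (rule maps_boundedly_of_majorant[OF measurable_T_kernel q(1) _ D NX, of "4 powr q * 4 * C"])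
    show "0 < 4 powr q * 4 * C" using C by simp
  next
    fix f :: "complex \<Rightarrow> complex" and n :: real
    assume f: "f \<in> borel_measurable disc_area" and n: "0 < n" "lorentz_integral \<beta> (\<lambda>w. norm (f w)) \<le> ennreal n"
    show "AE z in disc_area. integrable disc_area (\<lambda>w. T_kernel (\<beta> - 1) 1 z w * f w)"
      using AE_space
    proof eventually_elim
      fix z assume "z \<in> space disc_area"
      then show "integrable disc_area (\<lambda>w. T_kernel (\<beta> - 1) 1 z w * f w)"
        unfolding decomp using int_g[OF f n]
        by (intro Bochner_Integration.integrable_sum integrable_mult_right) simp
    qed
    define X where "X z = ennreal (4 powr q) * (\<Sum>j<4. ennreal (norm (G f j z) powr q))" for z
    show "\<exists>X\<in>borel_measurable borel. (\<forall>z\<in>ball 0 1. (\<integral>\<^sup>+u. X (z * u) \<partial>circle) \<le> ennreal (4 powr q * 4 * C * n powr q)) \<and>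
         (\<forall>z\<in>ball 0 1. ennreal (norm (\<integral>w. T_kernel (\<beta> - 1) 1 z w * f w \<partial>disc_area) powr q) \<le> X z)"
    proof (intro bexI[of _ X] conjI ballI)
      note [measurable] = G_meas[OF f]
      show "X \<in> borel_measurable borel" unfolding X_def by measurable
      fix z :: complex assume z: "z \<in> ball 0 1"
      have "(\<integral>\<^sup>+u. X (z * u) \<partial>circle) = ennreal (4 powr q) * (\<Sum>j<4. (\<integral>\<^sup>+u. ennreal (norm (G f j (z * u)) powr q) \<partial>circle))"
        unfolding X_def by (simp add: nn_integral_cmult nn_integral_sum del: sum_ennreal)
      also have "\<dots> \<le> ennreal (4 powr q) * (\<Sum>j<(4::nat). ennreal (C * n powr q))"
        unfolding G_def using g_meas[OF f] g0 n(1) g_lor[OF f n z] z by (intro mult_left_mono sum_mono means) auto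
      also have "\<dots> = ennreal (4 powr q * 4 * C * n powr q)"
      proof -
        have "(\<Sum>j<(4::nat). ennreal (C * n powr q)) = ennreal (4 * (C * n powr q))"
          using C by (simp add: ennreal_mult)
        then show ?thesis using C by (simp add: ennreal_mult[symmetric] mult.assoc)
      qed
      finally show "(\<integral>\<^sup>+u. X (z * u) \<partial>circle) \<le> ennreal (4 powr q * 4 * C * n powr q)" .
      have "(\<integral>w. T_kernel (\<beta> - 1) 1 z w * f w \<partial>disc_area) = (\<Sum>j<4. \<i> ^ j * G f j z)"
        unfolding decomp G_def
        by (subst Bochner_Integration.integral_sum)
          (intro integrable_mult_right int_g[OF f n z], simp only: integral_mult_right_zero)
      also have "norm \<dots> \<le> (\<Sum>j<4. norm (\<i> ^ j * G f j z))" by (rule norm_sum)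
      also have "\<dots> = (\<Sum>j<4. norm (G f j z))" by (simp add: norm_mult norm_power)
      finally have "norm (\<integral>w. T_kernel (\<beta> - 1) 1 z w * f w \<partial>disc_area) powr q \<le> (\<Sum>j<4. norm (G f j z)) powr q"
        using q by (intro powr_mono2) auto
      also have "\<dots> \<le> real 4 powr q * (\<Sum>j<4. norm (G f j z) powr q)"
        using q by (intro sum_powr_le) auto
      finally show "ennreal (norm (\<integral>w. T_kernel (\<beta> - 1) 1 z w * f w \<partial>disc_area) powr q) \<le> X z"
        unfolding X_def by (simp add: ennreal_mult[symmetric] sum_ennreal ennreal_leI sum_nonneg)
    qed
  qed
qed

subsection \<open>Lebesgue spaces inside Lorentz spaces\<close>

text \<open>The area is a probability measure, so the levels up to \<open>L\<close> contribute at
  most \<open>L\<close>; beyond \<open>L\<close> the tail is integrable because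
  \<open>P * \<beta> > 1\<close>.\<close>

lemma lorentz_integral_le_of_tail:
  assumes L: "0 < L" and \<beta>: "0 < \<beta>" "1 < P * \<beta>"
    and tail: "\<And>t. 0 < t \<Longrightarrow> distribution g t \<le> (L / t) powr P"
  shows "lorentz_integral \<beta> g \<le> ennreal (L * (1 + 1 / (P * \<beta> - 1)))"
proof -
  have "lorentz_integral \<beta> g \<le> (\<integral>\<^sup>+t. indicator {0..L} t + ennreal (L powr (P * \<beta>)) * (ennreal (t powr - (P * \<beta>)) * indicator {L..} t) \<partial>lborel)"
    unfolding lorentz_integral_def
  proof (intro nn_integral_mono)
    fix t :: real
    consider "t \<le> 0" | "0 < t" "t \<le> L" | "0 < t" "L \<le> t" by linarith
    then show "ennreal (distribution g t powr \<beta>) * indicator {0<..} t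
      \<le> indicator {0..L} t + ennreal (L powr (P * \<beta>)) * (ennreal (t powr - (P * \<beta>)) * indicator {L..} t)"
    proof cases
      case 2
      have "distribution g t powr \<beta> \<le> 1 powr \<beta>"
        using \<beta> by (intro powr_mono2) (auto simp: distribution_def)
      with 2 show ?thesis by (auto intro: add_increasing2)
    next
      case 3
      have "distribution g t powr \<beta> \<le> ((L / t) powr P) powr \<beta>"
        using \<beta> tail[OF 3(1)] by (intro powr_mono2 distribution_nonneg) auto
      also have "\<dots> = L powr (P * \<beta>) * t powr - (P * \<beta>)"
        using 3 L by (simp add: powr_powr powr_divide powr_minus field_simps)
      finally show ?thesis using 3 by (auto simp: ennreal_mult[symmetric] ennreal_leI intro: add_increasing)
    qed auto
  qed
  also have "\<dots> = ennreal L + ennreal (L powr (P * \<beta>)) * ennreal (L powr (- (P * \<beta>) + 1) / (- 1 - - (P * \<beta>)))"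
    using L \<beta> by (subst nn_integral_add) (auto simp: nn_integral_cmult nn_integral_powr_to_inf)
  also have "\<dots> = ennreal (L * (1 + 1 / (P * \<beta> - 1)))"
  proof -
    have "L powr (P * \<beta>) * L powr (- (P * \<beta>) + 1) = L"
      using L by (simp add: powr_add[symmetric])
    then have "L powr (P * \<beta>) * (L powr (- (P * \<beta>) + 1) / (- 1 - - (P * \<beta>))) = L / (P * \<beta> - 1)"
      by (simp add: field_simps)
    then show ?thesis
      using L \<beta> by (simp add: ennreal_mult[symmetric] ennreal_plus[symmetric] distrib_left del: ennreal_plus)
  qed
  finally show ?thesis .
qed

text \<open>Chebyshev's inequality supplies the tail for finite \<open>p\<close>; for
  \<open>p = \<infinity>\<close> the superlevel sets are null from the essential supremum
  on.\<close>

lemma lorentz_integral_le_Lp_norm: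
  assumes \<beta>: "0 < \<beta>" and p: "1 / p < ennreal \<beta>"
  obtains D where "0 \<le> D"
    "\<And>f. f \<in> borel_measurable disc_area \<Longrightarrow> lorentz_integral \<beta> (\<lambda>w. norm (f w)) \<le> ennreal D * Lp_norm p f"
proof (cases p)
  case top
  show ?thesis
  proof (rule that[of 1])
    fix f :: "complex \<Rightarrow> complex" assume f [measurable]: "f \<in> borel_measurable disc_area"
    show "lorentz_integral \<beta> (\<lambda>w. norm (f w)) \<le> ennreal 1 * Lp_norm p f"
    proof (cases "Lp_norm p f")
      case (real L)
      have bd: "AE w in disc_area. ennreal (norm (f w)) \<le> ennreal L"
        using esssup_AE[of "\<lambda>w. ennreal (norm (f w))" disc_area] real top by (simp add: Lp_norm_def)
      have zero: "distribution (\<lambda>w. norm (f w)) t = 0" if "L \<le> t" for t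
      proof -
        have "AE w in disc_area. \<not> t < norm (f w)"
          using bd by eventually_elim (use real that in \<open>auto simp: ennreal_le_iff\<close>)
        then have "emeasure disc_area {w \<in> space disc_area. t < norm (f w)} = 0"
          by (rule emeasure_eq_0_AE)
        then show ?thesis by (simp add: distribution_def measure_def)
      qed
      have "lorentz_integral \<beta> (\<lambda>w. norm (f w)) \<le> (\<integral>\<^sup>+t. indicator {0..L} t \<partial>lborel)"
        unfolding lorentz_integral_def
      proof (rule nn_integral_mono)
        fix t :: real
        have "distribution (\<lambda>w. norm (f w)) t powr \<beta> \<le> 1 powr \<beta>"
          using \<beta> by (intro powr_mono2) (auto simp: distribution_def)
        then show "ennreal (distribution (\<lambda>w. norm (f w)) t powr \<beta>) * indicator {0<..} t \<le> indicator {0..L} t"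
          using zero[of t] \<beta> by (cases "L \<le> t") (auto simp: indicator_def)
      qed
      then show ?thesis using real by simp
    qed simp
  qed simp
next
  case (real P)
  \<comment> \<open>In \<open>ennreal\<close> the quotient \<open>1 / 0\<close> is infinite, so the
    hypothesis excludes \<open>p = 0\<close>.\<close>
  have P: "0 < P" using p real by (cases "P = 0") auto
  then have "1 / p = ennreal (1 / P)" using real by (simp add: divide_ennreal[symmetric])
  then have "1 / P < \<beta>" using p \<beta> P by (simp add: ennreal_less_iff)
  then have P\<beta>: "1 < P * \<beta>" using P by (simp add: field_simps)
  define D where "D = 1 + 1 / (P * \<beta> - 1)"
  have D: "0 < D" using P\<beta> by (simp add: D_def add_pos_pos)
  show ?thesis
  proof (rule that[of D])
    fix f :: "complex \<Rightarrow> complex" assume f [measurable]: "f \<in> borel_measurable disc_area"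
    let ?I = "\<integral>\<^sup>+w. ennreal (norm (f w) powr P) \<partial>disc_area"
    have Lp: "Lp_norm p f = ennreal_powr ?I (1 / P)" using real P by (simp add: Lp_norm_def)
    show "lorentz_integral \<beta> (\<lambda>w. norm (f w)) \<le> ennreal D * Lp_norm p f"
    proof (cases ?I)
      case top
      then have "Lp_norm p f = \<infinity>" by (simp add: Lp ennreal_powr_def)
      then show ?thesis using D by (simp add: ennreal_mult_top)
    next
      case (real J)
      have tail: "distribution (\<lambda>w. norm (f w)) t * t powr P \<le> J" if t: "0 < t" for t
      proof -
        have "ennreal (distribution (\<lambda>w. norm (f w)) t * t powr P)
           = (\<integral>\<^sup>+w. ennreal (t powr P) * indicator {w \<in> ball 0 1. t < norm (f w)} w \<partial>disc_area)"
          by (subst nn_integral_cmult_indicator[OF superlevel_in_sets[OF measurable_compose[OF f borel_measurable_norm]]])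
            (simp only: emeasure_superlevel ennreal_mult distribution_nonneg powr_ge_zero mult.commute)
        also have "\<dots> \<le> ?I"
          using t P by (intro nn_integral_mono) (auto simp: indicator_def intro!: powr_mono2)
        finally show ?thesis using real by (simp add: ennreal_le_iff)
      qed
      show ?thesis
      proof (cases "J = 0")
        case True
        have "distribution (\<lambda>w. norm (f w)) t = 0" if "0 < t" for t
          using tail[OF that] that distribution_nonneg[of "\<lambda>w. norm (f w)" t] True
          by (simp add: mult_le_0_iff) 
        then have "lorentz_integral \<beta> (\<lambda>w. norm (f w)) = (\<integral>\<^sup>+t. 0 \<partial>(lborel :: real measure))"
          unfolding lorentz_integral_def by (intro nn_integral_cong) (auto simp: indicator_def)
        then show ?thesis by simp
      next
        case False
        define L where "L = J powr (1 / P)"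
        have L: "0 < L" "L powr P = J" using False real P by (auto simp: L_def powr_powr)
        have "lorentz_integral \<beta> (\<lambda>w. norm (f w)) \<le> ennreal (L * D)"
          unfolding D_def
        proof (rule lorentz_integral_le_of_tail[OF L(1) \<beta> P\<beta>])
          fix t :: real assume "0 < t"
          then show "distribution (\<lambda>w. norm (f w)) t \<le> (L / t) powr P"
            using tail[of t] L by (simp add: powr_divide field_simps)
        qed
        also have "\<dots> = ennreal D * Lp_norm p f"
          using real L D by (simp add: Lp ennreal_powr_def L_def ennreal_mult[symmetric] mult.commute)
        finally show ?thesis .
      qed
    qed
  qed (use D in simp)
qed

lemma Lorentz_p1_norm_eq:
  assumes "0 < p"
  shows "Lorentz_p1_norm p f = ennreal p * lorentz_integral (1 / p) (\<lambda>w. norm (f w))"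
  by (simp add: Lorentz_p1_norm_def lorentz_integral_def distribution_def)

subsection \<open>Unboundedness\<close>

text \<open>Boundedness includes convergence almost everywhere, so a single function with divergent
  integrals refutes it for every target norm.\<close>

lemma not_maps_boundedly_of_not_integrable:
  assumes "f \<in> space_of_norm NX" "\<And>z. z \<in> ball 0 1 \<Longrightarrow> \<not> integrable disc_area (\<lambda>w. k z w * f w)"
  shows "\<not> maps_boundedly a k NX NY"
proof
  assume "maps_boundedly a k NX NY"
  then have "AE z in disc_area. integrable disc_area (\<lambda>w. k z w * f w)"
    using assms(1) by (simp add: maps_boundedly_def)
  from this AE_space have "AE z in disc_area. False"
    by eventually_elim (use assms(2) in auto)
  then show False by simp
qed

text \<open>With \<open>x = defect w\<close>, the power \<open>1 / \<beta>\<close> of this function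
  is \<open>1 / (x * (1 - ln x) powr (1 / \<beta>))\<close>, integrable as
  \<open>1 / \<beta> > 1\<close>; against the weight \<open>x powr (\<beta> - 1)\<close> only the
  first power of the logarithm remains. The summand \<open>1\<close> keeps the denominator at least
  \<open>1\<close>.\<close>

definition log_test :: "real \<Rightarrow> complex \<Rightarrow> complex" where
  "log_test \<beta> w = of_real (defect w powr - \<beta> / (1 - ln (defect w)))"

lemma measurable_log_test: "log_test \<beta> \<in> borel_measurable disc_area"
  unfolding log_test_def by (intro measurable_disc_area_borel) measurable

text \<open>The antiderivative \<open>?F\<close> equals \<open>1 / (P - 1)\<close> at
  \<open>1\<close> and is nonnegative; monotone convergence passes to the left endpoint
  \<open>0\<close>.\<close>

lemma nn_integral_log_weight_le:
  assumes P: "1 < (P::real)"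
  shows "(\<integral>\<^sup>+x\<in>{0<..<1}. ennreal (1 / (x * (1 - ln x) powr P)) \<partial>lborel) \<le> ennreal (1 / (P - 1))"
proof -
  let ?f = "\<lambda>x::real. 1 / (x * (1 - ln x) powr P)"
  let ?F = "\<lambda>x::real. (1 - ln x) powr (1 - P) / (P - 1)"
  have le: "(\<integral>\<^sup>+x\<in>{1 / real (Suc n)..1}. ennreal (?f x) \<partial>lborel) \<le> ennreal (1 / (P - 1))" for n
  proof -
    have "(\<integral>\<^sup>+x\<in>{1 / real (Suc n)..1}. ennreal (?f x) \<partial>lborel) = ?F 1 - ?F (1 / real (Suc n))"
    proof (rule nn_integral_FTC_Icc)
      fix x assume "x \<in> {1 / real (Suc n)..1}"
      then have x: "0 < x" "x \<le> 1" by (auto intro: less_le_trans[rotated])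
      then have l: "0 < 1 - ln x" using ln_le_zero_iff[of x] by linarith
      have "((\<lambda>x. 1 - ln x) has_real_derivative - 1 / x) (at x)"
        using x by (auto intro!: derivative_eq_intros)
      from DERIV_cdivide[OF DERIV_fun_powr[OF this l, of "1 - P"], of "P - 1"]
      have "(?F has_real_derivative (1 - P) * (1 - ln x) powr (- P) * (- 1 / x) / (P - 1)) (at x)"
        by simp
      also have "(1 - P) * (1 - ln x) powr (- P) * (- 1 / x) / (P - 1) = ?f x"
        using x l P by (simp add: powr_minus_divide field_simps)
      finally show "(?F has_real_derivative ?f x) (at x)" .
      show "0 \<le> ?f x" using x by simp
    qed (auto simp: field_simps)
    also have "\<dots> \<le> ennreal (1 / (P - 1))" using P by (intro ennreal_leI) simp
    finally show ?thesis .
  qed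
  have "(\<integral>\<^sup>+x\<in>{0<..<1}. ennreal (?f x) \<partial>lborel) \<le> (\<integral>\<^sup>+x. (SUP n. ennreal (?f x) * indicator {1 / real (Suc n)..1} x) \<partial>lborel)"
  proof (rule nn_integral_mono)
    fix x :: real
    show "ennreal (?f x) * indicator {0<..<1} x \<le> (SUP n. ennreal (?f x) * indicator {1 / real (Suc n)..1} x)"
    proof (cases "x \<in> {0<..<1}")
      case True
      then obtain n where "inverse (real (Suc n)) < x" using reals_Archimedean[of x] by auto
      with True show ?thesis by (intro SUP_upper2[of n]) (auto simp: inverse_eq_divide)
    qed simp
  qed
  also have "\<dots> = (SUP n. (\<integral>\<^sup>+x\<in>{1 / real (Suc n)..1}. ennreal (?f x) \<partial>lborel))"
  proof (rule nn_integral_monotone_convergence_SUP)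
    show "incseq (\<lambda>n x. ennreal (?f x) * indicator {1 / real (Suc n)..1} x)"
    proof (intro incseq_SucI le_funI mult_left_mono)
      fix n x
      have "1 / real (Suc (Suc n)) \<le> 1 / real (Suc n)" by (intro divide_left_mono) auto
      then show "indicator {1 / real (Suc n)..1} x \<le> (indicator {1 / real (Suc (Suc n))..1} x :: ennreal)"
        by (auto simp: indicator_def)
    qed simp
  qed measurable
  also have "\<dots> \<le> ennreal (1 / (P - 1))" by (intro SUP_least le)
  finally show ?thesis .
qed

lemma nn_integral_log_weight_infinite:
  "(\<integral>\<^sup>+x\<in>{0<..<1}. ennreal (1 / (x * (1 - ln x))) \<partial>lborel) = \<infinity>"
proof (rule ccontr)
  let ?f = "\<lambda>x::real. 1 / (x * (1 - ln x))"
  let ?F = "\<lambda>x::real. - ln (1 - ln x)"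
  assume "\<not> ?thesis"
  then obtain B where B: "0 \<le> B" "(\<integral>\<^sup>+x\<in>{0<..<1}. ennreal (?f x) \<partial>lborel) = ennreal B"
    by (cases "\<integral>\<^sup>+x\<in>{0<..<1}. ennreal (?f x) \<partial>lborel") auto
  \<comment> \<open>This solves \<open>ln (1 - ln e) = B + 1\<close>, so the integral from
    \<open>e\<close> to \<open>1\<close> already exceeds the supposed total
    \<open>B\<close>.\<close>
  define e where "e = exp (1 - exp (B + 1))"
  have e: "0 < e" "e \<le> 1" "ln e = 1 - exp (B + 1)" using B by (auto simp: e_def)
  have "(\<integral>\<^sup>+x\<in>{e..1}. ennreal (?f x) \<partial>lborel) = ?F 1 - ?F e"
  proof (rule nn_integral_FTC_Icc)
    fix x assume "x \<in> {e..1}"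
    then have x: "0 < x" "x \<le> 1" using e by auto
    then have l: "0 < 1 - ln x" using ln_le_zero_iff[of x] by linarith
    show "(?F has_real_derivative ?f x) (at x)"
      using x l by (auto intro!: derivative_eq_intros simp: field_simps)
    show "0 \<le> ?f x" using x l by simp
  qed (use e in auto)
  also have "\<dots> = ennreal (B + 1)" using e by (simp add: add.commute)
  finally have "ennreal (B + 1) \<le> (\<integral>\<^sup>+x\<in>{0<..<1}. ennreal (?f x) \<partial>lborel)"
  proof (rule ord_eq_le_trans[OF sym])
    show "(\<integral>\<^sup>+x\<in>{e..1}. ennreal (?f x) \<partial>lborel) \<le> (\<integral>\<^sup>+x\<in>{0<..<1}. ennreal (?f x) \<partial>lborel)"
    proof (rule nn_integral_mono_AE)
      show "AE x in lborel. ennreal (?f x) * indicator {e..1} x \<le> ennreal (?f x) * indicator {0<..<1} x"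
        using AE_lborel_singleton[of "1::real"] by eventually_elim (use e in \<open>auto simp: indicator_def\<close>)
    qed
  qed
  then show False using B by simp
qed

lemma Lp_norm_log_test_finite:
  assumes \<beta>: "0 < \<beta>" "\<beta> < 1"
  shows "Lp_norm (ennreal (1 / \<beta>)) (log_test \<beta>) < \<infinity>"
proof -
  have "(\<integral>\<^sup>+w. ennreal (norm (log_test \<beta> w) powr (1 / \<beta>)) \<partial>disc_area)
     = (\<integral>\<^sup>+w. ennreal (1 / (defect w * (1 - ln (defect w)) powr (1 / \<beta>))) \<partial>disc_area)"
  proof (rule nn_integral_cong)
    fix w assume "w \<in> space disc_area"
    then have d: "0 < defect w" "defect w \<le> 1" using defect_pos[of w] by auto
    then have l: "0 < 1 - ln (defect w)" using ln_le_zero_iff[of "defect w"] by linarith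
    have "norm (log_test \<beta> w) = defect w powr - \<beta> / (1 - ln (defect w))"
      using l unfolding log_test_def norm_of_real by (intro abs_of_nonneg divide_nonneg_pos) auto
    then have "norm (log_test \<beta> w) powr (1 / \<beta>) = defect w powr -1 / (1 - ln (defect w)) powr (1 / \<beta>)"
      using d l \<beta> by (simp only: powr_divide powr_ge_zero less_imp_le powr_powr) simp
    also have "\<dots> = 1 / (defect w * (1 - ln (defect w)) powr (1 / \<beta>))"
      using d by (simp add: powr_minus_divide)
    finally show "ennreal (norm (log_test \<beta> w) powr (1 / \<beta>)) = ennreal (1 / (defect w * (1 - ln (defect w)) powr (1 / \<beta>)))"
      by simp
  qed
  also have "\<dots> = (\<integral>\<^sup>+x\<in>{0<..<1}. ennreal (1 / (x * (1 - ln x) powr (1 / \<beta>))) \<partial>lborel)"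
    by (rule nn_integral_defect) measurable
  also have "\<dots> \<le> ennreal (1 / (1 / \<beta> - 1))" using \<beta> by (intro nn_integral_log_weight_le) simp
  also have "\<dots> < \<infinity>" by simp
  finally show ?thesis using \<beta> by (simp add: Lp_norm_def ennreal_powr_def less_top)
qed

text \<open>On the disc \<open>norm (1 - z * cnj w)\<close> is below \<open>2\<close>, so for
  \<open>c \<ge> 0\<close> the unweighted kernel is at least \<open>2 powr - c\<close> and cannot
  restore convergence, whatever \<open>z\<close> is.\<close>

lemma log_test_not_integrable:
  assumes norm_k: "\<And>z w. norm (k z w) = defect w powr (\<beta> - 1) * norm (1 - z * cnj w) powr - c"
    and c: "0 \<le> c" and z: "z \<in> ball 0 1"
  shows "\<not> integrable disc_area (\<lambda>w. k z w * log_test \<beta> w)"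
proof
  assume "integrable disc_area (\<lambda>w. k z w * log_test \<beta> w)"
  then have fin: "(\<integral>\<^sup>+w. ennreal (norm (k z w * log_test \<beta> w)) \<partial>disc_area) < \<infinity>"
    by (simp add: integrable_iff_bounded)
  have "(\<integral>\<^sup>+w. ennreal (1 / (defect w * (1 - ln (defect w)))) \<partial>disc_area) = (\<integral>\<^sup>+x\<in>{0<..<1}. ennreal (1 / (x * (1 - ln x))) \<partial>lborel)"
    by (rule nn_integral_defect) measurable
  also have "\<dots> = \<infinity>" by (rule nn_integral_log_weight_infinite)
  finally have "\<infinity> = (\<integral>\<^sup>+w. ennreal (1 / (defect w * (1 - ln (defect w)))) \<partial>disc_area)" by simp
  also have "\<dots> \<le> (\<integral>\<^sup>+w. ennreal (2 powr c) * ennreal (norm (k z w * log_test \<beta> w)) \<partial>disc_area)"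
  proof (rule nn_integral_mono)
    fix w assume "w \<in> space disc_area"
    then have w: "w \<in> ball 0 1" by simp
    have d: "0 < defect w" "defect w \<le> 1" using defect_pos[OF w] by auto
    then have l: "0 < 1 - ln (defect w)" using ln_le_zero_iff[of "defect w"] by linarith
    let ?y = "norm (1 - z * cnj w)"
    have y: "0 < ?y" using one_minus_mult_cnj_nonzero[OF z w] by simp
    have "?y \<le> 1 + norm (z * cnj w)" using norm_triangle_ineq4[of 1 "z * cnj w"] by simp
    also have "norm (z * cnj w) \<le> 1 * 1"
      unfolding norm_mult complex_mod_cnj using z w by (intro mult_mono) auto
    finally have "?y powr c \<le> 2 powr c" using y c by (intro powr_mono2) auto
    then have ge: "1 \<le> 2 powr c * ?y powr - c" using y by (simp add: powr_minus field_simps)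
    have "norm (log_test \<beta> w) = defect w powr - \<beta> / (1 - ln (defect w))"
      using l unfolding log_test_def norm_of_real by (intro abs_of_nonneg divide_nonneg_pos) auto
    then have "norm (k z w * log_test \<beta> w) = (defect w powr (\<beta> - 1) * defect w powr - \<beta>) / (1 - ln (defect w)) * ?y powr - c"
      unfolding norm_mult norm_k by (simp add: mult_ac)
    also have "defect w powr (\<beta> - 1) * defect w powr - \<beta> = 1 / defect w"
      unfolding powr_add[symmetric] using d by (simp add: powr_minus_divide)
    finally have eq: "norm (k z w * log_test \<beta> w) = 1 / (defect w * (1 - ln (defect w))) * ?y powr - c"
      using d l by simp
    have "1 / (defect w * (1 - ln (defect w))) * 1 \<le> 1 / (defect w * (1 - ln (defect w))) * (2 powr c * ?y powr - c)"
      using d l by (intro mult_left_mono ge) simp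
    also have "\<dots> = 2 powr c * norm (k z w * log_test \<beta> w)" unfolding eq by (simp only: mult_ac)
    finally show "ennreal (1 / (defect w * (1 - ln (defect w)))) \<le> ennreal (2 powr c) * ennreal (norm (k z w * log_test \<beta> w))"
      by (simp add: ennreal_mult[symmetric] ennreal_leI)
  qed
  also have "\<dots> = ennreal (2 powr c) * (\<integral>\<^sup>+w. ennreal (norm (k z w * log_test \<beta> w)) \<partial>disc_area)"
    using \<open>integrable disc_area (\<lambda>w. k z w * log_test \<beta> w)\<close> by (intro nn_integral_cmult) auto
  also have "\<dots> < \<infinity>" using fin by (simp add: ennreal_mult_less_top)
  finally show False by simp
qed

lemma not_maps_boundedly_Lp:
  assumes norm_k: "\<And>z w. norm (k z w) = defect w powr (\<beta> - 1) * norm (1 - z * cnj w) powr - c"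
    and c: "0 \<le> c" and \<beta>: "0 < \<beta>" "\<beta> < 1"
  shows "\<not> maps_boundedly a k (Lp_norm (ennreal (1 / \<beta>))) NY"
  by (rule not_maps_boundedly_of_not_integrable[OF _ log_test_not_integrable[OF norm_k c]])
    (use Lp_norm_log_test_finite[OF \<beta>] measurable_log_test in \<open>simp_all add: space_of_norm_def\<close>)

text \<open>Because \<open>1 / p\<close> exceeds \<open>\<beta>\<close>, the space
  \<open>L^(1/\<beta>)\<close> is contained in \<open>L^(p,1)\<close>, so the same test function
  applies.\<close>

lemma not_maps_boundedly_Lorentz:
  assumes norm_k: "\<And>z w. norm (k z w) = defect w powr (\<beta> - 1) * norm (1 - z * cnj w) powr - c"
    and c: "0 \<le> c" and \<beta>: "0 < \<beta>" "\<beta> < 1" and p: "\<beta> < 1 / p"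
  shows "\<not> maps_boundedly a k (Lorentz_p1_norm p) NY"
proof (rule not_maps_boundedly_of_not_integrable[OF _ log_test_not_integrable[OF norm_k c]])
  have p0: "0 < p" using p \<beta> by (metis less_trans zero_less_divide_1_iff)
  have "1 / ennreal (1 / \<beta>) = ennreal \<beta>"
    using \<beta> divide_ennreal[of 1 "1 / \<beta>"] by simp
  then have "1 / ennreal (1 / \<beta>) < ennreal (1 / p)" using p p0 by (simp add: ennreal_lessI)
  then obtain D where D: "0 \<le> D"
    "\<And>f. f \<in> borel_measurable disc_area \<Longrightarrow> lorentz_integral (1 / p) (\<lambda>w. norm (f w)) \<le> ennreal D * Lp_norm (ennreal (1 / \<beta>)) f"
    using lorentz_integral_le_Lp_norm[of "1 / p"] p0 by auto
  have "lorentz_integral (1 / p) (\<lambda>w. norm (log_test \<beta> w)) \<le> ennreal D * Lp_norm (ennreal (1 / \<beta>)) (log_test \<beta>)"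
    by (rule D(2)[OF measurable_log_test])
  also have "\<dots> < \<infinity>" using Lp_norm_log_test_finite[OF \<beta>] by (simp add: ennreal_mult_less_top)
  finally show "log_test \<beta> \<in> space_of_norm (Lorentz_p1_norm p)"
    using measurable_log_test p0 by (simp add: space_of_norm_def Lorentz_p1_norm_eq ennreal_mult_less_top)
qed

text \<open>On the annulus \<open>defect z < \<delta>\<close> the circular means of the kernel, hence the transform of the
  annulus itself, exceed those for \<open>T\<close> by a factor \<open>ln (1 / \<delta>)\<close>.\<close>

lemma S_kernel_not_maps_boundedly:
  assumes \<beta>: "0 < \<beta>" "\<beta> < 1"
  shows "\<not> maps_boundedly (-1) (S_kernel (\<beta> - 1) 1) (Lorentz_p1_norm (1 / \<beta>)) weak_L1_norm"
proof
  let ?k = "S_kernel (\<beta> - 1) 1"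
  assume "maps_boundedly (-1) ?k (Lorentz_p1_norm (1 / \<beta>)) weak_L1_norm"
  then obtain C :: real where int: "\<And>f. f \<in> space_of_norm (Lorentz_p1_norm (1 / \<beta>)) \<Longrightarrow> AE z in disc_area. integrable disc_area (\<lambda>w. ?k z w * f w)"
    and C: "\<And>f. f \<in> space_of_norm (Lorentz_p1_norm (1 / \<beta>)) \<Longrightarrow> disc_operator (-1) ?k f \<in> space_of_norm weak_L1_norm"
      "\<And>f. f \<in> space_of_norm (Lorentz_p1_norm (1 / \<beta>)) \<Longrightarrow> weak_L1_norm (disc_operator (-1) ?k f) \<le> ennreal C * Lorentz_p1_norm (1 / \<beta>) f"
    unfolding maps_boundedly_def by blast
  define L where "L = \<bar>C\<bar> + 1"
  have L0: "0 < L" by (simp add: L_def)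
  \<comment> \<open>For \<open>z\<close> and \<open>w\<close> in the annulus,
    \<open>1 - |z w|^2\<close> is at most \<open>2 * \<delta>\<close>, and
    \<open>- ln (2 * \<delta>) / pi\<close> is exactly \<open>L\<close>, which exceeds
    \<open>\<bar>C\<bar>\<close>.\<close>
  define \<delta> where "\<delta> = exp (- pi * L) / 2"
  have "exp (- pi * L) \<le> 1" by (simp add: L_def)
  then have "\<delta> \<le> 1 / 2" unfolding \<delta>_def by linarith
  moreover have "0 < \<delta>" "2 * \<delta> = exp (- pi * L)" by (simp_all add: \<delta>_def)
  ultimately have \<delta>: "0 < \<delta>" "\<delta> < 1" "2 * \<delta> = exp (- pi * L)" by linarith+
  define f :: "complex \<Rightarrow> complex" where "f w = (if defect w < \<delta> then 1 else 0)" for w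
  have f_meas: "f \<in> borel_measurable disc_area"
    unfolding f_def by (intro measurable_disc_area_borel) measurable
  have ann: "emeasure disc_area {w \<in> ball 0 1. defect w < \<delta>} = ennreal \<delta>"
  proof -
    have "emeasure disc_area {w \<in> ball 0 1. defect w < \<delta>} = (\<integral>\<^sup>+w. indicator {w \<in> ball 0 1. defect w < \<delta>} w \<partial>disc_area)"
      by (intro nn_integral_indicator[symmetric] borel_in_sets_disc_area) auto
    also have "\<dots> = (\<integral>\<^sup>+w. indicator {..<\<delta>} (defect w) \<partial>disc_area)"
      by (intro nn_integral_cong) (auto simp: indicator_def)
    also have "\<dots> = (\<integral>\<^sup>+x\<in>{0<..<1}. indicator {..<\<delta>} x \<partial>lborel)"
      by (rule nn_integral_defect) measurable
    also have "\<dots> = (\<integral>\<^sup>+x. indicator {0<..<\<delta>} x \<partial>lborel)"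
      using \<delta> by (intro nn_integral_cong) (auto simp: indicator_def)
    also have "\<dots> = ennreal \<delta>" using \<delta> by simp
    finally show ?thesis .
  qed
  have "lorentz_integral \<beta> (\<lambda>w. norm (f w)) = (\<integral>\<^sup>+t. ennreal (\<delta> powr \<beta>) * indicator {0<..<1::real} t \<partial>lborel)"
    unfolding lorentz_integral_def
  proof (rule nn_integral_cong)
    fix t :: real
    consider "t \<le> 0" | "0 < t" "t < 1" | "1 \<le> t" by linarith
    then show "ennreal (distribution (\<lambda>w. norm (f w)) t powr \<beta>) * indicator {0<..} t = ennreal (\<delta> powr \<beta>) * indicator {0<..<1} t"
    proof cases
      case 2
      then have "{w \<in> ball 0 1. t < norm (f w)} = {w \<in> ball 0 1. defect w < \<delta>}" by (auto simp: f_def split: if_splits)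
      then have "distribution (\<lambda>w. norm (f w)) t = \<delta>"
        using ann \<delta> unfolding distribution_def measure_def by (simp only:) simp
      then show ?thesis using 2 by simp
    next
      case 3
      then have "{w \<in> ball 0 1. t < norm (f w)} = {}" by (auto simp: f_def split: if_splits)
      then have "distribution (\<lambda>w. norm (f w)) t = 0" unfolding distribution_def by (simp only: measure_empty)
      then show ?thesis using 3 by simp
    qed auto
  qed
  then have "lorentz_integral \<beta> (\<lambda>w. norm (f w)) = ennreal (\<delta> powr \<beta>)"
    by (simp add: nn_integral_cmult_indicator)
  then have NX: "Lorentz_p1_norm (1 / \<beta>) f = ennreal (\<delta> powr \<beta> / \<beta>)"
    using \<beta> by (subst Lorentz_p1_norm_eq) (auto simp: ennreal_mult[symmetric])
  then have f_space: "f \<in> space_of_norm (Lorentz_p1_norm (1 / \<beta>))"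
    using f_meas by (simp add: space_of_norm_def)
  \<comment> \<open>On the annulus the integral is at least
    \<open>L * \<delta> powr \<beta> / \<beta>\<close>, and dividing by
    \<open>defect z < \<delta>\<close> gives more than \<open>t\<close>.\<close>
  define t where "t = L * \<delta> powr \<beta> / \<beta> / \<delta>"
  have t: "0 < t" using \<beta> \<delta> by (simp add: t_def L_def)
  have big: "AE z in disc_area. z \<in> {w \<in> ball 0 1. defect w < \<delta>} \<longrightarrow> z \<in> {z \<in> space disc_area. t < norm (disc_operator (-1) ?k f z)}"
    using int[OF f_space]
  proof eventually_elim
    fix z assume int: "integrable disc_area (\<lambda>w. ?k z w * f w)"
    show "z \<in> {w \<in> ball 0 1. defect w < \<delta>} \<longrightarrow> z \<in> {z \<in> space disc_area. t < norm (disc_operator (-1) ?k f z)}"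
    proof
      assume "z \<in> {w \<in> ball 0 1. defect w < \<delta>}"
      then have z: "z \<in> ball 0 1" "defect z < \<delta>" by auto
      define r where "r w = (if defect w < \<delta> then defect w powr (\<beta> - 1) else 0) * (1 / norm (1 - z * cnj w))" for w
      have kf: "?k z w * f w = of_real (r w)" for w by (simp add: r_def S_kernel_def f_def)
      have r0: "0 \<le> r w" for w by (simp add: r_def)
      have int_r: "integrable disc_area r" using int unfolding kf by (simp only: complex_of_real_integrable_eq)
      have "ennreal (L * (\<delta> powr \<beta> / \<beta>)) \<le> (\<integral>\<^sup>+w. ennreal (r w) \<partial>disc_area)"
      proof -
        have "ennreal (L * (\<delta> powr \<beta> / \<beta>)) = (\<integral>\<^sup>+x\<in>{0..\<delta>}. ennreal (x powr (\<beta> - 1)) \<partial>lborel) * ennreal L"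
          using \<beta> \<delta> L0 by (subst nn_integral_powr_from_0) (auto simp: ennreal_mult[symmetric] mult.commute)
        also have "\<dots> = (\<integral>\<^sup>+x\<in>{0<..<1}. (if x < \<delta> then ennreal (x powr (\<beta> - 1)) else 0) \<partial>lborel) * ennreal L"
        proof (intro arg_cong2[where f = "(*)"] refl nn_integral_cong_AE)
          show "AE x in lborel. ennreal (x powr (\<beta> - 1)) * indicator {0..\<delta>} x = (if x < \<delta> then ennreal (x powr (\<beta> - 1)) else 0) * indicator {0<..<1} x"
            using AE_lborel_singleton[of "0::real"] AE_lborel_singleton[of \<delta>]
            by eventually_elim (use \<delta> in \<open>auto simp: indicator_def\<close>)
        qed
        also have "\<dots> = (\<integral>\<^sup>+w. (if defect w < \<delta> then ennreal (defect w powr (\<beta> - 1)) else 0) \<partial>disc_area) * ennreal L"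
          by (subst nn_integral_defect[of "\<lambda>x. if x < \<delta> then ennreal (x powr (\<beta> - 1)) else 0"]) auto
        also have "\<dots> = (\<integral>\<^sup>+w. (if defect w < \<delta> then ennreal (defect w powr (\<beta> - 1)) else 0) * ennreal L \<partial>disc_area)"
          by (intro nn_integral_multc[symmetric] measurable_disc_area_borel) measurable
        also have "\<dots> \<le> (\<integral>\<^sup>+w. (\<integral>\<^sup>+u. ennreal (r (w * u)) \<partial>circle) \<partial>disc_area)"
        proof (rule nn_integral_mono)
          fix w assume "w \<in> space disc_area"
          then have w: "w \<in> ball 0 1" by simp
          show "(if defect w < \<delta> then ennreal (defect w powr (\<beta> - 1)) else 0) * ennreal L \<le> (\<integral>\<^sup>+u. ennreal (r (w * u)) \<partial>circle)"
          proof (cases "defect w < \<delta>")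
            case True
            \<comment> \<open>Conjugating \<open>1 - z * cnj (w * u)\<close> gives
              \<open>1 - cnj z * w * u\<close>, so the logarithmic bound is applied at the point
              \<open>cnj z * w\<close>.\<close>
            have cw: "cnj z * w \<in> ball 0 1"
              using mult_strict_mono'[of "norm z" 1 "norm w" 1] z w by (simp add: norm_mult)
            have "(1 - \<delta>) * (1 - \<delta>) \<le> (norm z)\<^sup>2 * (norm w)\<^sup>2"
              using True z \<delta> by (intro mult_mono) auto
            then have "1 - (norm (cnj z * w))\<^sup>2 \<le> 1 - (1 - \<delta>) * (1 - \<delta>)"
              by (simp add: norm_mult power_mult_distrib)
            also have "\<dots> \<le> 2 * \<delta>" by (simp add: algebra_simps)
            finally have "ln (1 - (norm (cnj z * w))\<^sup>2) \<le> ln (2 * \<delta>)"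
              using defect_pos[OF cw] by (intro ln_mono) auto
            also have "\<dots> = - pi * L" unfolding \<delta>(3) by simp
            finally have "L \<le> - ln (1 - (norm (cnj z * w))\<^sup>2) / pi" by (simp add: field_simps)
            then have "ennreal L \<le> (\<integral>\<^sup>+u. ennreal (1 / norm (1 - cnj z * w * u)) \<partial>circle)"
              using log_le_inverse_norm_mean[OF cw] by (auto intro: order_trans[OF ennreal_leI])
            then have "ennreal (defect w powr (\<beta> - 1)) * ennreal L
              \<le> ennreal (defect w powr (\<beta> - 1)) * (\<integral>\<^sup>+u. ennreal (1 / norm (1 - cnj z * w * u)) \<partial>circle)"
              by (rule mult_left_mono) simp
            also have "\<dots> = (\<integral>\<^sup>+u. ennreal (defect w powr (\<beta> - 1)) * ennreal (1 / norm (1 - cnj z * w * u)) \<partial>circle)"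
              by (rule nn_integral_cmult[symmetric]) measurable
            also have "\<dots> = (\<integral>\<^sup>+u. ennreal (r (w * u)) \<partial>circle)"
            proof (intro nn_integral_cong_AE, use AE_circle in eventually_elim)
              fix u :: complex assume u: "norm u = 1"
              have "norm (1 - cnj z * w * u) = norm (cnj (1 - cnj z * w * u))" by (simp only: complex_mod_cnj)
              also have "\<dots> = norm (1 - z * cnj (w * u))" by (simp add: mult.assoc)
              finally show "ennreal (defect w powr (\<beta> - 1)) * ennreal (1 / norm (1 - cnj z * w * u)) = ennreal (r (w * u))"
                using True u by (simp add: r_def norm_mult ennreal_mult[symmetric])
            qed
            finally show ?thesis using True by simp
          qed simp
        qed
        also have "\<dots> = (\<integral>\<^sup>+w. ennreal (r w) \<partial>disc_area)"
        proof (rule nn_integral_disc_area_circle[symmetric])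
          have "(\<lambda>w. 1 - z * cnj w) \<in> borel_measurable borel"
            by (intro borel_measurable_continuous_onI continuous_intros)
          then show "(\<lambda>w. ennreal (r w)) \<in> borel_measurable borel" unfolding r_def by measurable
        qed
        finally show ?thesis .
      qed
      also have "\<dots> = ennreal (\<integral>w. r w \<partial>disc_area)"
        using r0 by (intro nn_integral_eq_integral int_r) simp
      finally have ge: "L * (\<delta> powr \<beta> / \<beta>) \<le> (\<integral>w. r w \<partial>disc_area)"
        using r0 by (subst (asm) ennreal_le_iff) auto
      have d: "0 < defect z" using defect_pos[OF z(1)] .
      have pos: "0 < L * (\<delta> powr \<beta> / \<beta>)" using \<beta> \<delta> by (simp add: L_def)
      have "t = L * (\<delta> powr \<beta> / \<beta>) / \<delta>" by (simp add: t_def)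
      also have "\<dots> < L * (\<delta> powr \<beta> / \<beta>) / defect z"
        by (rule divide_strict_left_mono[OF z(2) pos mult_pos_pos[OF \<delta>(1) d]])
      also have "\<dots> \<le> (\<integral>w. r w \<partial>disc_area) / defect z"
        using d ge by (intro divide_right_mono) auto
      also have "\<dots> = norm (disc_operator (-1) ?k f z)"
      proof -
        have "disc_operator (-1) ?k f z = of_real (defect z powr -1 * (\<integral>w. r w \<partial>disc_area))"
          unfolding disc_operator_def kf by simp
        also have "norm \<dots> = defect z powr -1 * (\<integral>w. r w \<partial>disc_area)"
          unfolding norm_of_real using r0 by (intro abs_of_nonneg mult_nonneg_nonneg) auto
        also have "\<dots> = (\<integral>w. r w \<partial>disc_area) / defect z"
          using d by (simp only: powr_minus_divide powr_one less_imp_le) simp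
        finally show ?thesis by simp
      qed
      finally show "z \<in> {z \<in> space disc_area. t < norm (disc_operator (-1) ?k f z)}"
        using z by simp
    qed
  qed
  have "(\<lambda>z. norm (disc_operator (-1) ?k f z)) \<in> borel_measurable disc_area"
    using C(1)[OF f_space] by (auto simp: space_of_norm_def)
  from superlevel_in_sets[OF this, of t]
  \<comment> \<open>The weak norm is thus at least
    \<open>t * \<delta> = L * \<delta> powr \<beta> / \<beta>\<close>, that is \<open>L\<close>
    times the Lorentz norm of \<open>f\<close>, against \<open>L > \<bar>C\<bar>\<close>.\<close>
  have "ennreal \<delta> \<le> emeasure disc_area {z \<in> space disc_area. t < norm (disc_operator (-1) ?k f z)}"
    unfolding ann[symmetric] by (intro emeasure_mono_AE big) simp
  then have "ennreal t * ennreal \<delta> \<le> ennreal t * emeasure disc_area {z \<in> space disc_area. t < norm (disc_operator (-1) ?k f z)}"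
    by (rule mult_left_mono) simp
  also have "\<dots> \<le> weak_L1_norm (disc_operator (-1) ?k f)"
    unfolding weak_L1_norm_def using t by (intro SUP_upper) simp
  also have "\<dots> \<le> ennreal C * ennreal (\<delta> powr \<beta> / \<beta>)" using C(2)[OF f_space] NX by simp
  also have "\<dots> \<le> ennreal (\<bar>C\<bar> * (\<delta> powr \<beta> / \<beta>))"
    using \<beta> by (subst ennreal_mult) (auto intro!: mult_right_mono ennreal_leI)
  finally have "ennreal (t * \<delta>) \<le> ennreal (\<bar>C\<bar> * (\<delta> powr \<beta> / \<beta>))"
    using t \<delta> by (simp add: ennreal_mult)
  then have "t * \<delta> \<le> \<bar>C\<bar> * (\<delta> powr \<beta> / \<beta>)" using \<beta> by (subst (asm) ennreal_le_iff) auto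
  moreover have "t * \<delta> = L * (\<delta> powr \<beta> / \<beta>)" using \<delta> by (simp add: t_def)
  moreover have "0 < \<delta> powr \<beta> / \<beta>" using \<delta> \<beta> by simp
  ultimately show False unfolding L_def distrib_right by linarith
qed

theorem theorem12p3:
  fixes a b c :: real
  assumes "a = -1" and "b > -1" and "0 \<le> 2 - c + b" and "2 - c + b < 1" and "c \<le> 1"
  shows
    "(c = 1 \<longrightarrow>
       (\<forall>p::ennreal. 0 \<le> 1 / p \<and> 1 / p < ennreal (b + 1) \<longrightarrow>
          T_maps_boundedly a b c (Lp_norm p) weak_L1_norm \<and>
          S_maps_boundedly a b c (Lp_norm p) weak_L1_norm) \<and>
       \<not> T_maps_boundedly a b c (Lp_norm (ennreal (1 / (b + 1)))) weak_L1_norm \<and>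
       \<not> S_maps_boundedly a b c (Lp_norm (ennreal (1 / (b + 1)))) weak_L1_norm \<and>
       T_maps_boundedly a b c (Lorentz_p1_norm (1 / (b + 1))) weak_L1_norm \<and>
       \<not> S_maps_boundedly a b c (Lorentz_p1_norm (1 / (b + 1))) weak_L1_norm \<and>
       (\<forall>p::real. b + 1 < 1 / p \<and> 1 / p \<le> 1 \<longrightarrow>
          \<not> T_maps_boundedly a b c (Lorentz_p1_norm p) weak_L1_norm \<and>
          \<not> S_maps_boundedly a b c (Lorentz_p1_norm p) weak_L1_norm))
     \<and>
     (c < 1 \<longrightarrow>
       (\<forall>p::ennreal. 0 \<le> 1 / p \<and> 1 / p < ennreal (b + 1) \<longrightarrow>
          T_maps_boundedly a b c (Lp_norm p) weak_L1_norm \<and>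
          S_maps_boundedly a b c (Lp_norm p) weak_L1_norm) \<and>
       \<not> T_maps_boundedly a b c (Lp_norm (ennreal (1 / (b + 1)))) weak_L1_norm \<and>
       \<not> S_maps_boundedly a b c (Lp_norm (ennreal (1 / (b + 1)))) weak_L1_norm \<and>
       T_maps_boundedly a b c (Lorentz_p1_norm (1 / (b + 1))) weak_L1_norm \<and>
       S_maps_boundedly a b c (Lorentz_p1_norm (1 / (b + 1))) weak_L1_norm \<and>
       (\<forall>p::real. b + 1 < 1 / p \<and> 1 / p \<le> 1 \<longrightarrow>
          \<not> T_maps_boundedly a b c (Lorentz_p1_norm p) weak_L1_norm \<and>
          \<not> S_maps_boundedly a b c (Lorentz_p1_norm p) weak_L1_norm))"
proof -
  have a: "a = -1" by fact
  have \<beta>: "0 < b + 1" "b + 1 < 1" and c: "b + 1 < c" "0 \<le> c" using assms by auto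
  have nT: "norm (T_kernel b c z w) = defect w powr (b + 1 - 1) * norm (1 - z * cnj w) powr - c"
    and nS: "norm (S_kernel b c z w) = defect w powr (b + 1 - 1) * norm (1 - z * cnj w) powr - c" for z w
    by (simp_all add: norm_T_kernel norm_S_kernel)
  have Lp: "maps_boundedly a (T_kernel b c) (Lp_norm p) weak_L1_norm \<and> maps_boundedly a (S_kernel b c) (Lp_norm p) weak_L1_norm"
    if p: "1 / p < ennreal (b + 1)" for p
  proof -
    obtain r where r: "0 \<le> r" "1 / p = ennreal r" using p by (cases "1 / p") auto
    then have "r < b + 1" using p by (simp add: ennreal_less_iff)
    \<comment> \<open>The gap between \<open>1 / p\<close> and \<open>b + 1\<close> is shared: one
      part becomes the \<open>\<epsilon>\<close> traded in the kernel, the other keeps the embedding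
      into the Lorentz space strict.\<close>
    then obtain \<beta>' where \<beta>': "r < \<beta>'" "\<beta>' < b + 1" using dense by blast
    define \<epsilon> where "\<epsilon> = b + 1 - \<beta>'"
    have \<epsilon>: "0 < \<epsilon>" "\<epsilon> < b + 1" using \<beta>' r by (auto simp: \<epsilon>_def)
    have "1 / p < ennreal (b + 1 - \<epsilon>)" using r \<beta>' by (simp add: \<epsilon>_def ennreal_lessI)
    then obtain D where "0 \<le> D"
      "\<And>f. f \<in> borel_measurable disc_area \<Longrightarrow> lorentz_integral (b + 1 - \<epsilon>) (\<lambda>w. norm (f w)) \<le> ennreal D * Lp_norm p f"
      using lorentz_integral_le_Lp_norm[of "b + 1 - \<epsilon>" p] \<epsilon> by auto
    then show ?thesis
      unfolding a using \<epsilon> c \<beta> assms(5)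
      by (intro conjI maps_boundedly_of_powr_kernel[where \<epsilon> = \<epsilon> and b = b and c = c and D = D]
          measurable_T_kernel measurable_S_kernel norm_T_kernel norm_S_kernel) auto
  qed
  \<comment> \<open>The factor \<open>b + 1\<close> cancels the leading \<open>1 / (b + 1)\<close>
    of the Lorentz norm, so the two sides are equal.\<close>
  have Lorentz_le: "lorentz_integral (b + 1) (\<lambda>w. norm (f w)) \<le> ennreal (b + 1) * Lorentz_p1_norm (1 / (b + 1)) f" for f
    using \<beta> by (simp add: Lorentz_p1_norm_eq mult.assoc[symmetric] ennreal_mult[symmetric])
  have Lorentz: "maps_boundedly a (T_kernel b c) (Lorentz_p1_norm (1 / (b + 1))) weak_L1_norm \<and>
    maps_boundedly a (S_kernel b c) (Lorentz_p1_norm (1 / (b + 1))) weak_L1_norm" if "c < 1"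
    unfolding a using that c \<beta> Lorentz_le
    by (intro conjI maps_boundedly_of_powr_kernel[where \<epsilon> = 0 and b = b and c = c and D = "b + 1"]
        measurable_T_kernel measurable_S_kernel norm_T_kernel norm_S_kernel) auto
  have T1: "maps_boundedly a (T_kernel b c) (Lorentz_p1_norm (1 / (b + 1))) weak_L1_norm" if "c = 1"
    using T_kernel_maps_boundedly[OF \<beta> less_imp_le[OF \<beta>(1)] Lorentz_le] that a by simp
  have S1: "\<not> maps_boundedly a (S_kernel b c) (Lorentz_p1_norm (1 / (b + 1))) weak_L1_norm" if "c = 1"
    using S_kernel_not_maps_boundedly[OF \<beta>] that a by simp
  show ?thesis
    using Lp Lorentz T1 S1 not_maps_boundedly_Lp[OF nT c(2) \<beta>] not_maps_boundedly_Lp[OF nS c(2) \<beta>]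
      not_maps_boundedly_Lorentz[OF nT c(2) \<beta>] not_maps_boundedly_Lorentz[OF nS c(2) \<beta>]
    by auto
qed

end
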